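(* Let $V=\mathbb R^n$ with Euclidean metric $g_0$, let $V=U+W$ be a $g_0$-orthogonal decomposition with $\dim U=p$, $\dim W=q$, $p+q=n$, and let $H=SO(U)\times SO(W)=SO_p\times SO_q\subset SL_n(\mathbb R)$. Then the homogeneous manifold $M_{p,q}=SL_n(\mathbb R)/(SO_p\times SO_q)$ is admissible. Any invariant Lorentzian metric on it is defined by a scalar product on $\mathfrak m\simeq \mathbb R b+(U\otimes W)\otimes\mathbb R^2+S^2_0U+S^2_0W$ of the form $$g=-\lambda_1\,b^*\otimes b^*+g_1\otimes g_{\mathbb R^2}+\lambda_2g_2+\lambda_3g_3,$$ where $\lambda_i$, $i=1,2,3$, are positive constants, $g_1,g_2,g_3$ are the Euclidean scalar products in $U\otimes W$, $S^2_0U$ and $S^2_0W$ respectively, induced by the metric $g_0$, and $g_{\mathbb R^2}$ is a Euclidean scalar product in $\mathbb R^2$.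
   Context: A homogeneous manifold $G/H$ with compact connected stabilizer $H$ is admissible if it admits a $G$-invariant Lorentzian metric. The reductive decomposition of $M_{p,q}=SL(V)/(SO(U)\times SO(W))$ is $$\mathfrak{sl}(V)=\mathfrak h+\mathfrak m=(\mathfrak{so}(U)+\mathfrak{so}(W))+(\mathbb R b+U^*\wedge W^*+S_0^2U^*+S_0^2W^*+U^*\vee W^* ),$$ where bilinear forms are identified with endomorphisms by means of $g_0$, $\vee$ is the symmetric product, $b=q\,g_0|_U-p\,g_0|_W$, and $S_0^2U^*,S_0^2W^*$ are the spaces of traceless symmetric bilinear forms. As an $H$-module, $\mathfrak m\simeq \mathbb R b+(U\otimes W)\otimes\mathbb R^2+S^2_0U+S^2_0W$, where $(U\otimes W)\otimes \mathbb R^2$ corresponds to $U^*\wedge W^*+U^*\vee W^*$. $b^*$ is the linear form on $\mathfrak m$ with $b^*(b)=1$ vanishing on the other summands. Invariant metrics on $M_{p,q}$ are identified with $\mathrm{Ad}_H$-invariant scalar products on $\mathfrak m$.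
   Formalization: It is assumed that p,q≥1. If p or q is 2, the identification of (U⊗W)⊗R² with U*∧W*+U*∨W* may depend on the metric, and if p=q=1 the isomorphism of m need not preserve Rb; with a fixed identification the claim fails in these cases. *)

theory Defs
  imports "HOL-Analysis.Analysis"
begin

section \<open>Smooth functions\<close>

primrec Ck_on :: "nat \<Rightarrow> 'a::euclidean_space set \<Rightarrow> ('a \<Rightarrow> real) \<Rightarrow> bool" where
  "Ck_on 0 S f \<longleftrightarrow> continuous_on S f"
| "Ck_on (Suc k) S f \<longleftrightarrow>
     (\<exists>f'. (\<forall>x\<in>S. (f has_derivative f' x) (at x)) \<and> (\<forall>v. Ck_on k S (\<lambda>x. f' x v)))"

text \<open>Smoothness on an embedded submanifold \<open>M\<close>: locally the restriction of a smooth function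
  defined on an open set of the ambient space.\<close>
definition smooth_on :: "'a::euclidean_space set \<Rightarrow> ('a \<Rightarrow> real) \<Rightarrow> bool" where
  "smooth_on M f \<longleftrightarrow>
     (\<forall>x\<in>M. \<exists>N F. open N \<and> x \<in> N \<and> (\<forall>k. Ck_on k N F) \<and> (\<forall>y\<in>M \<inter> N. f y = F y))"

section \<open>Scalar products\<close>

definition symmetric_form_on :: "'a::real_vector set \<Rightarrow> ('a \<Rightarrow> 'a \<Rightarrow> real) \<Rightarrow> bool" where
  "symmetric_form_on E \<beta> \<longleftrightarrow>
     (\<forall>x\<in>E. \<forall>y\<in>E. \<beta> x y = \<beta> y x) \<and>
     (\<forall>x\<in>E. \<forall>y\<in>E. \<forall>z\<in>E. \<beta> (x + y) z = \<beta> x z + \<beta> y z) \<and>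
     (\<forall>c. \<forall>x\<in>E. \<forall>y\<in>E. \<beta> (c *\<^sub>R x) y = c * \<beta> x y)"

definition euclidean_scalar_product_on :: "'a::real_vector set \<Rightarrow> ('a \<Rightarrow> 'a \<Rightarrow> real) \<Rightarrow> bool" where
  "euclidean_scalar_product_on E \<beta> \<longleftrightarrow>
     symmetric_form_on E \<beta> \<and> (\<forall>x\<in>E. x \<noteq> 0 \<longrightarrow> \<beta> x x > 0)"

definition form_index :: "'a::euclidean_space set \<Rightarrow> ('a \<Rightarrow> 'a \<Rightarrow> real) \<Rightarrow> nat" where
  "form_index E \<beta> = Max {dim N | N. subspace N \<and> N \<subseteq> E \<and> (\<forall>x\<in>N. x \<noteq> 0 \<longrightarrow> \<beta> x x < 0)}"

text \<open>A Lorentzian scalar product (nondegenerate, signature \<open>(-,+,\<dots>,+)\<close>) on the quotient \<open>E / K\<close>,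
  given by its pullback to \<open>E\<close>: the radical is exactly \<open>K\<close>. Negative definite subspaces of \<open>E\<close>
  meet \<open>K\<close> trivially, so that the index computed in \<open>E\<close> is the index on \<open>E / K\<close>.\<close>
definition lorentzian_mod :: "'a::euclidean_space set \<Rightarrow> 'a set \<Rightarrow> ('a \<Rightarrow> 'a \<Rightarrow> real) \<Rightarrow> bool" where
  "lorentzian_mod E K \<beta> \<longleftrightarrow>
     symmetric_form_on E \<beta> \<and> {x\<in>E. \<forall>y\<in>E. \<beta> x y = 0} = K \<and> form_index E \<beta> = 1"

section \<open>Homogeneous manifolds of matrix groups\<close>

definition Ad :: "real^'n^'n \<Rightarrow> real^'n^'n \<Rightarrow> real^'n^'n" where
  "Ad a X = a ** X ** matrix_inv a"

definition coset :: "(real^'n^'n) set \<Rightarrow> real^'n^'n \<Rightarrow> (real^'n^'n) set" where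
  "coset H a = (\<lambda>h. a ** h) ` H"

definition coset_space :: "(real^'n^'n) set \<Rightarrow> (real^'n^'n) set \<Rightarrow> (real^'n^'n) set set" where
  "coset_space G H = coset H ` G"

text \<open>The Lie algebra of the stabilizer of the point \<open>x = a H\<close> of \<open>G / H\<close>, i.e. \<open>Ad a\<close> of the Lie
  algebra \<open>\<hh>\<close> of \<open>H\<close>. (It does not depend on the choice of \<open>a\<close> in \<open>x\<close>.)\<close>
definition isotropy_algebra :: "(real^'n^'n) set \<Rightarrow> (real^'n^'n) set \<Rightarrow> (real^'n^'n) set" where
  "isotropy_algebra \<hh> x = {Ad a X | a X. a \<in> x \<and> X \<in> \<hh>}"

text \<open>In what follows \<open>\<gg>\<close> and \<open>\<hh>\<close> are the Lie algebras of \<open>G\<close> and \<open>H\<close>. The tangent space of \<open>G / H\<close>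
  at \<open>x\<close> is identified with \<open>\<gg> / isotropy_algebra \<hh> x\<close>: the class of \<open>X\<close> is the value at \<open>x\<close> of the
  fundamental vector field \<open>d/dt exp(tX) x\<close>. A metric is thus a family \<open>Q\<close> of bilinear forms on
  \<open>\<gg>\<close> indexed by the points of \<open>G / H\<close>. It is smooth iff it is smooth on all pairs of fundamental
  vector fields, and a function on \<open>G / H\<close> is smooth iff its pullback to \<open>G\<close> is.\<close>
definition lorentzian_metric ::
  "(real^'n^'n) set \<Rightarrow> (real^'n^'n) set \<Rightarrow> (real^'n^'n) set \<Rightarrow> (real^'n^'n) set \<Rightarrow>
   ((real^'n^'n) set \<Rightarrow> real^'n^'n \<Rightarrow> real^'n^'n \<Rightarrow> real) \<Rightarrow> bool" where
  "lorentzian_metric G \<gg> H \<hh> Q \<longleftrightarrow>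
     (\<forall>x\<in>coset_space G H. lorentzian_mod \<gg> (isotropy_algebra \<hh> x) (Q x)) \<and>
     (\<forall>X\<in>\<gg>. \<forall>Y\<in>\<gg>. smooth_on G (\<lambda>a. Q (coset H a) X Y))"

text \<open>Left translation by \<open>a\<close> sends the fundamental field of \<open>X\<close> at \<open>x\<close> to that of \<open>Ad a X\<close> at \<open>a x\<close>.\<close>
definition invariant_metric ::
  "(real^'n^'n) set \<Rightarrow> (real^'n^'n) set \<Rightarrow> (real^'n^'n) set \<Rightarrow>
   ((real^'n^'n) set \<Rightarrow> real^'n^'n \<Rightarrow> real^'n^'n \<Rightarrow> real) \<Rightarrow> bool" where
  "invariant_metric G \<gg> H Q \<longleftrightarrow>
     (\<forall>a\<in>G. \<forall>x\<in>coset_space G H. \<forall>X\<in>\<gg>. \<forall>Y\<in>\<gg>.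
        Q ((\<lambda>y. a ** y) ` x) (Ad a X) (Ad a Y) = Q x X Y)"

definition admissible ::
  "(real^'n^'n) set \<Rightarrow> (real^'n^'n) set \<Rightarrow> (real^'n^'n) set \<Rightarrow> (real^'n^'n) set \<Rightarrow> bool" where
  "admissible G \<gg> H \<hh> \<longleftrightarrow> (\<exists>Q. lorentzian_metric G \<gg> H \<hh> Q \<and> invariant_metric G \<gg> H Q)"

section \<open>The groups and Lie algebras\<close>

definition orthogonal_decomposition :: "(real^'n) set \<Rightarrow> (real^'n) set \<Rightarrow> bool" where
  "orthogonal_decomposition U W \<longleftrightarrow>
     subspace U \<and> subspace W \<and> (\<forall>u\<in>U. \<forall>w\<in>W. orthogonal u w) \<and> {u + w | u w. u \<in> U \<and> w \<in> W} = UNIV"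

definition SL :: "(real^'n^'n) set" where
  "SL = {A. det A = 1}"

definition sl :: "(real^'n^'n) set" where
  "sl = {X. trace X = 0}"

text \<open>\<open>SO(U)\<close> as a subgroup of \<open>SL(V)\<close>, acting trivially on the orthogonal complement of \<open>U\<close>.\<close>
definition SO :: "(real^'n) set \<Rightarrow> (real^'n^'n) set" where
  "SO U = {A. rotation_matrix A \<and> (\<forall>v\<in>U\<^sup>\<bottom>. A *v v = v)}"

definition SOxSO :: "(real^'n) set \<Rightarrow> (real^'n) set \<Rightarrow> (real^'n^'n) set" where
  "SOxSO U W = {A ** B | A B. A \<in> SO U \<and> B \<in> SO W}"

text \<open>Bilinear forms are identified with endomorphisms by means of the Euclidean metric:
  \<open>tensor u v\<close> is the matrix of both \<open>u\<^sup>* \<otimes> v\<^sup>*\<close> and the endomorphism \<open>x \<mapsto> (v \<bullet> x) u\<close>.\<close>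
definition tensor :: "real^'n \<Rightarrow> real^'n \<Rightarrow> real^'n^'n" where
  "tensor u v = (\<chi> i j. u $ i * v $ j)"

definition tensor_space :: "(real^'n) set \<Rightarrow> (real^'n) set \<Rightarrow> (real^'n^'n) set" where
  "tensor_space U W = span {tensor u w | u w. u \<in> U \<and> w \<in> W}"

definition so :: "(real^'n) set \<Rightarrow> (real^'n^'n) set" where
  "so U = {X \<in> tensor_space U U. transpose X = - X}"

definition so_plus_so :: "(real^'n) set \<Rightarrow> (real^'n) set \<Rightarrow> (real^'n^'n) set" where
  "so_plus_so U W = {X + Y | X Y. X \<in> so U \<and> Y \<in> so W}"

section \<open>The isotropy module\<close>

definition b_endo :: "(real^'n) set \<Rightarrow> (real^'n) set \<Rightarrow> real^'n^'n" where
  "b_endo U W = (THE B. (\<forall>u\<in>U. B *v u = real (dim W) *\<^sub>R u) \<and> (\<forall>w\<in>W. B *v w = - real (dim U) *\<^sub>R w))"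

definition wedge_space :: "(real^'n) set \<Rightarrow> (real^'n) set \<Rightarrow> (real^'n^'n) set" where
  "wedge_space U W = span {tensor u w - tensor w u | u w. u \<in> U \<and> w \<in> W}"

definition vee_space :: "(real^'n) set \<Rightarrow> (real^'n) set \<Rightarrow> (real^'n^'n) set" where
  "vee_space U W = span {tensor u w + tensor w u | u w. u \<in> U \<and> w \<in> W}"

definition S20 :: "(real^'n) set \<Rightarrow> (real^'n^'n) set" where
  "S20 U = {X \<in> tensor_space U U. transpose X = X \<and> trace X = 0}"

definition m_space :: "(real^'n) set \<Rightarrow> (real^'n) set \<Rightarrow> (real^'n^'n) set" where
  "m_space U W = {t *\<^sub>R b_endo U W + A + S + T + C | t A S T C.
     A \<in> wedge_space U W \<and> S \<in> S20 U \<and> T \<in> S20 W \<and> C \<in> vee_space U W}"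

text \<open>The module \<open>\<real> b + (U \<otimes> W) \<otimes> \<real>\<^sup>2 + S\<^sub>0\<^sup>2 U + S\<^sub>0\<^sup>2 W\<close> as a set of quadruples \<open>(t, Z, S, T)\<close>, with
  \<open>t\<close> standing for \<open>t b\<close> and \<open>Z\<close> for \<open>Z $ 1 \<otimes> e\<^sub>1 + Z $ 2 \<otimes> e\<^sub>2\<close>. An orthogonal matrix \<open>h\<close> acts on
  tensors by \<open>u \<otimes> w \<mapsto> h u \<otimes> h w\<close>, which is conjugation by \<open>h\<close>.\<close>
type_synonym 'n model = "real \<times> ((real^'n^'n)^2) \<times> (real^'n^'n) \<times> (real^'n^'n)"

definition model_space :: "(real^'n) set \<Rightarrow> (real^'n) set \<Rightarrow> 'n model set" where
  "model_space U W = {(t, Z, S, T). (\<forall>i. Z $ i \<in> tensor_space U W) \<and> S \<in> S20 U \<and> T \<in> S20 W}"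

definition model_action :: "real^'n^'n \<Rightarrow> 'n model \<Rightarrow> 'n model" where
  "model_action h = (\<lambda>(t, Z, S, T). (t, (\<chi> i. Ad h (Z $ i)), Ad h S, Ad h T))"

definition module_iso :: "(real^'n) set \<Rightarrow> (real^'n) set \<Rightarrow> ('n model \<Rightarrow> real^'n^'n) \<Rightarrow> bool" where
  "module_iso U W \<Phi> \<longleftrightarrow>
     linear \<Phi> \<and> bij_betw \<Phi> (model_space U W) (m_space U W) \<and>
     (\<forall>h\<in>SOxSO U W. \<forall>z\<in>model_space U W. \<Phi> (model_action h z) = Ad h (\<Phi> z))"

text \<open>Compatibility with the decompositions of both sides: the identity on \<open>\<real> b\<close>, \<open>S\<^sub>0\<^sup>2 U\<close>, \<open>S\<^sub>0\<^sup>2 W\<close>, while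
  \<open>(U \<otimes> W) \<otimes> \<real>\<^sup>2\<close> corresponds to \<open>U\<^sup>* \<and> W\<^sup>* + U\<^sup>* \<or> W\<^sup>*\<close>. If \<open>dim U = 2\<close> or \<open>dim W = 2\<close>, then \<open>U \<otimes> W\<close>
  is not absolutely irreducible, and the last correspondence must be allowed to depend on the metric;
  if \<open>dim U = dim W = 1\<close>, then the group is trivial and even the line \<open>\<real> b\<close> is not distinguished.\<close>
definition adapted_iso :: "(real^'n) set \<Rightarrow> (real^'n) set \<Rightarrow> ('n model \<Rightarrow> real^'n^'n) \<Rightarrow> bool" where
  "adapted_iso U W \<Phi> \<longleftrightarrow>
     (\<forall>t. \<forall>S\<in>S20 U. \<forall>T\<in>S20 W. \<Phi> (t, 0, S, T) = t *\<^sub>R b_endo U W + S + T) \<and>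
     (\<lambda>Z. \<Phi> (0, Z, 0, 0)) ` {Z. \<forall>i. Z $ i \<in> tensor_space U W} =
       {A + C | A C. A \<in> wedge_space U W \<and> C \<in> vee_space U W}"

text \<open>\<open>(u \<otimes> w) \<otimes> e\<^sub>1 \<mapsto> u \<and> w\<close> and \<open>(u \<otimes> w) \<otimes> e\<^sub>2 \<mapsto> u \<or> w\<close>.\<close>
definition canonical_iso :: "(real^'n) set \<Rightarrow> (real^'n) set \<Rightarrow> 'n model \<Rightarrow> real^'n^'n" where
  "canonical_iso U W = (\<lambda>(t, Z, S, T). t *\<^sub>R b_endo U W +
     (Z $ 1 - transpose (Z $ 1)) + (Z $ 2 + transpose (Z $ 2)) + S + T)"

text \<open>The form \<open>-\<lambda>\<^sub>1 b\<^sup>* \<otimes> b\<^sup>* + g\<^sub>1 \<otimes> \<gamma> + \<lambda>\<^sub>2 g\<^sub>2 + \<lambda>\<^sub>3 g\<^sub>3\<close> with \<open>\<gamma>\<close> a scalar product of \<open>\<real>\<^sup>2\<close>. The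
  scalar products induced by the Euclidean metric on tensors,
  \<open>\<langle>u \<otimes> w, u' \<otimes> w'\<rangle> = (u \<bullet> u') (w \<bullet> w')\<close>, are the restrictions of the inner product of matrices.\<close>
definition model_form ::
  "real \<Rightarrow> (real^2 \<Rightarrow> real^2 \<Rightarrow> real) \<Rightarrow> real \<Rightarrow> real \<Rightarrow> ('n::finite) model \<Rightarrow> 'n model \<Rightarrow> real" where
  "model_form l1 \<gamma> l2 l3 = (\<lambda>(t, Z, S, T) (t', Z', S', T').
     - l1 * (t * t') +
     (\<Sum>i\<in>UNIV. \<Sum>j\<in>UNIV. (Z $ i \<bullet> Z' $ j) * \<gamma> (axis i 1) (axis j 1)) +
     l2 * (S \<bullet> S') + l3 * (T \<bullet> T'))"

end

theory Submission
  imports Defs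
begin

text \<open>Write \<open>\<mm> = \<real> b + (U \<otimes> W) \<otimes> \<real>\<^sup>2 + S\<^sub>0\<^sup>2 U + S\<^sub>0\<^sup>2 W\<close> and \<open>n = p + q\<close>. An invariant metric is the same thing as an
  \<open>Ad\<^sub>H\<close>-invariant scalar product on \<open>\<mm>\<close>, that is, an invariant form \<open>B\<close> with radical \<open>\<hh>\<close> on \<open>\<ss>\<ll>(V)\<close>.

  \<^emph>\<open>Existence.\<close> The Euclidean product of matrices is invariant under \<open>H\<close>. Projecting it along \<open>\<hh>\<close> and
  reversing its sign on the invariant vector \<open>b\<close> gives \<open>base_form\<close>, and left translation spreads it over
  the group. The result is smooth because the inverse of a matrix of determinant 1 is polynomial in the
  entries (\<open>admissible_split\<close>).

  \<^emph>\<open>Orthogonality of the summands.\<close> For \<open>n \<ge> 3\<close> the summands other than \<open>\<real> b\<close> contain no invariant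
  vectors and are pairwise disjoint as representations, so that they are orthogonal for \<open>B\<close>. In each
  case an explicit rotation shows this: a half turn reverses the sign of \<open>u \<otimes> w\<close> and fixes the other
  argument, and an invariant linear functional on the symmetric tensors over \<open>U\<close> is a multiple of the
  trace, as \<open>SO(U)\<close> is transitive on the unit sphere (\<open>block_form\<close>).

  \<^emph>\<open>The form on each summand.\<close> Rotations by 90 and 45 degrees reduce \<open>B\<close> on \<open>S\<^sub>0\<^sup>2 U\<close> to a multiple of the
  Euclidean product (\<open>form_on_S20\<close>). On \<open>(U \<otimes> W) \<otimes> \<real>\<^sup>2\<close> it is \<open>g\<^sub>1 \<otimes> \<gamma>\<close> if neither dimension is 2
  (\<open>form_on_mixed\<close>). If one of them is 2, the quarter turn of that plane is an invariant complex structure,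
  and \<open>B\<close> is only Hermitian with respect to it. It becomes a tensor product after a change of variable
  that commutes with \<open>H\<close>, built from the eigenspaces of \<open>B\<close> (\<open>equivariant_normalization\<close>).

  \<^emph>\<open>Signs.\<close> A negative vector in a summand other than \<open>\<real> b\<close> would come with a second negative vector
  orthogonal to it, namely one of its images under the group or, for \<open>g\<^sub>1 \<otimes> \<gamma>\<close>, another decomposable
  tensor. As the index is 1, these summands are positive and \<open>b\<close> is negative (\<open>mixed_positive\<close>,
  \<open>S20_positive\<close>, \<open>b_negative\<close>).

  For \<open>n = 2\<close> the group \<open>H\<close> is trivial and the theorem is the diagonalization of a Lorentzian form on a space
  of dimension 3 (\<open>normal_form_two_dimensional\<close>).\<close>

section \<open>Matrices and tensors\<close>

lemma matrix_mul_add_left: "((B::real^'n^'m) + C) ** A = B ** A + C ** A"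
  by (simp add: matrix_matrix_mult_def vec_eq_iff distrib_right sum.distrib)

lemma matrix_sub_ldistrib: "(A::real^'n^'m) ** (B - C) = A ** B - A ** C"
  by (simp add: matrix_matrix_mult_def vec_eq_iff right_diff_distrib sum_subtractf)

lemma matrix_sub_rdistrib: "((B::real^'n^'m) - C) ** A = B ** A - C ** A"
  by (simp add: matrix_matrix_mult_def vec_eq_iff left_diff_distrib sum_subtractf)

lemma matrix_neg_left: "(- A :: real^'n^'m) ** B = - (A ** B)"
  by (simp add: matrix_matrix_mult_def vec_eq_iff sum_negf)

lemma matrix_neg_right: "(A :: real^'n^'m) ** (- B) = - (A ** B)"
  by (simp add: matrix_matrix_mult_def vec_eq_iff sum_negf)

lemma matrix_scaleR_left: "(c *\<^sub>R A :: real^'n^'m) ** B = c *\<^sub>R (A ** B)"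
  by (simp add: matrix_matrix_mult_def vec_eq_iff sum_distrib_left ac_simps)

lemma matrix_scaleR_right: "(A :: real^'n^'m) ** (c *\<^sub>R B) = c *\<^sub>R (A ** B)"
  by (simp add: matrix_matrix_mult_def vec_eq_iff sum_distrib_left ac_simps)

lemma transpose_add: "transpose ((A::real^'n^'m) + B) = transpose A + transpose B"
  by (simp add: transpose_def vec_eq_iff)

lemma transpose_sub: "transpose ((A::real^'n^'m) - B) = transpose A - transpose B"
  by (simp add: transpose_def vec_eq_iff)

lemma transpose_neg: "transpose (- (A::real^'n^'m)) = - transpose A"
  by (simp add: transpose_def vec_eq_iff)

lemma transpose_zero: "transpose (0::real^'n^'m) = 0"
  by (simp add: transpose_def vec_eq_iff)

lemmas matrix_ring =
  matrix_add_ldistrib matrix_mul_add_left matrix_sub_ldistrib matrix_sub_rdistrib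
  matrix_neg_left matrix_neg_right matrix_scaleR_left matrix_scaleR_right
  matrix_mul_assoc[symmetric]

lemmas transpose_ring =
  transpose_add transpose_sub transpose_neg transpose_scalar transpose_zero matrix_transpose_mul

lemma trace_scaleR: "trace (c *\<^sub>R (A::real^'n^'n)) = c * trace A"
  by (simp add: trace_def sum_distrib_left)

lemma trace_neg: "trace (- (A::real^'n^'n)) = - trace A"
  by (simp add: trace_def sum_negf)

lemma trace_zero: "trace (0::real^'n^'n) = 0"
  by (simp add: trace_def)

lemma trace_transpose: "trace (transpose (A::real^'n^'n)) = trace A"
  by (simp add: trace_def transpose_def)

lemmas trace_ring = trace_add trace_sub trace_scaleR trace_neg trace_zero trace_transpose

lemma inner_matrix_trace: "(A::real^'n^'n) \<bullet> B = trace (transpose A ** B)"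
proof -
  have "A \<bullet> B = (\<Sum>i\<in>UNIV. \<Sum>j\<in>UNIV. A$i$j * B$i$j)"
    by (simp add: inner_vec_def)
  also have "\<dots> = (\<Sum>j\<in>UNIV. \<Sum>i\<in>UNIV. A$i$j * B$i$j)"
    by (rule sum.swap)
  finally show ?thesis
    by (simp add: trace_def matrix_matrix_mult_def transpose_def)
qed

lemma inner_matrix_mul_left: "((A::real^'n^'n) ** (X::real^'n^'n)) \<bullet> Y = X \<bullet> (transpose A ** Y)"
  by (simp add: inner_matrix_trace matrix_transpose_mul matrix_mul_assoc)

lemma inner_matrix_mul_right: "((X::real^'n^'n) ** (A::real^'n^'n)) \<bullet> Y = X \<bullet> (Y ** transpose A)"
proof -
  have "(X ** A) \<bullet> Y = trace (transpose A ** (transpose X ** Y))"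
    by (simp add: inner_matrix_trace matrix_transpose_mul matrix_mul_assoc)
  also have "\<dots> = trace ((transpose X ** Y) ** transpose A)"
    by (rule trace_mul_sym)
  finally show ?thesis
    by (simp add: inner_matrix_trace matrix_mul_assoc)
qed

lemma inner_transpose: "transpose (A::real^'n^'n) \<bullet> transpose B = A \<bullet> B"
proof -
  have "transpose A \<bullet> transpose B = trace (A ** transpose B)"
    by (simp add: inner_matrix_trace)
  also have "\<dots> = trace (transpose B ** A)" by (rule trace_mul_sym)
  also have "\<dots> = B \<bullet> A" by (simp add: inner_matrix_trace)
  finally show ?thesis by (simp add: inner_commute)
qed

lemma transpose_tensor: "transpose (tensor u v) = tensor v u"
  by (simp add: tensor_def transpose_def vec_eq_iff)

lemma trace_tensor: "trace (tensor u v) = u \<bullet> v"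
  by (simp add: tensor_def trace_def inner_vec_def)

lemma matrix_mul_tensor: "A ** tensor u v = tensor (A *v u) v"
  by (simp add: tensor_def matrix_matrix_mult_def matrix_vector_mult_def vec_eq_iff
      sum_distrib_left mult_ac)

lemma tensor_mul_matrix: "tensor u v ** A = tensor u (transpose A *v v)"
  by (simp add: tensor_def matrix_matrix_mult_def vector_matrix_mult_def vec_eq_iff
      sum_distrib_left mult_ac)

lemma tensor_mult_vec: "tensor u v *v x = (v \<bullet> x) *\<^sub>R u"
  by (simp add: tensor_def matrix_vector_mult_def vec_eq_iff inner_vec_def sum_distrib_right
      sum_distrib_left ac_simps)

lemma tensor_tensor: "tensor a b ** tensor c d = (b \<bullet> c) *\<^sub>R tensor a d"
  by (simp add: tensor_def matrix_matrix_mult_def vec_eq_iff inner_vec_def sum_distrib_right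
      sum_distrib_left ac_simps)

lemma inner_tensor: "tensor a b \<bullet> tensor c d = (a \<bullet> c) * (b \<bullet> d)"
  by (simp add: inner_matrix_trace transpose_tensor tensor_tensor trace_scaleR trace_tensor)

lemma tensor_add_left: "tensor (a + b) c = tensor a c + tensor b c"
  by (simp add: tensor_def vec_eq_iff algebra_simps)
lemma tensor_add_right: "tensor c (a + b) = tensor c a + tensor c b"
  by (simp add: tensor_def vec_eq_iff algebra_simps)
lemma tensor_diff_left: "tensor (a - b) c = tensor a c - tensor b c"
  by (simp add: tensor_def vec_eq_iff algebra_simps)
lemma tensor_diff_right: "tensor c (a - b) = tensor c a - tensor c b"
  by (simp add: tensor_def vec_eq_iff algebra_simps)
lemma tensor_neg_left: "tensor (- a) c = - tensor a c"
  by (simp add: tensor_def vec_eq_iff)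
lemma tensor_neg_right: "tensor c (- a) = - tensor c a"
  by (simp add: tensor_def vec_eq_iff)
lemma tensor_scaleR_left: "tensor (k *\<^sub>R a) c = k *\<^sub>R tensor a c"
  by (simp add: tensor_def vec_eq_iff)
lemma tensor_scaleR_right: "tensor c (k *\<^sub>R a) = k *\<^sub>R tensor c a"
  by (simp add: tensor_def vec_eq_iff)
lemma tensor_zero_left: "tensor 0 c = 0"
  by (simp add: tensor_def vec_eq_iff)
lemma tensor_zero_right: "tensor c 0 = 0"
  by (simp add: tensor_def vec_eq_iff)

lemmas tensor_bilinear = tensor_add_left tensor_add_right tensor_diff_left tensor_diff_right
  tensor_neg_left tensor_neg_right tensor_scaleR_left tensor_scaleR_right
  tensor_zero_left tensor_zero_right

lemma matrix_eq_sum_tensor: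
  "(X::real^'n^'n) = (\<Sum>i\<in>UNIV. \<Sum>j\<in>UNIV. X$i$j *\<^sub>R tensor (axis i 1) (axis j 1))"
proof -
  have "(\<Sum>i\<in>UNIV. \<Sum>j\<in>UNIV. X$i$j *\<^sub>R tensor (axis i 1) (axis j 1)) $ k $ l = X$k$l" for k l
  proof -
    have "(\<Sum>i\<in>UNIV. \<Sum>j\<in>UNIV. X$i$j *\<^sub>R tensor (axis i 1) (axis j 1)) $ k $ l
      = (\<Sum>i\<in>UNIV. \<Sum>j\<in>UNIV. if j = l then (if i = k then X$i$j else 0) else 0)"
      unfolding sum_component vector_scaleR_component
      by (intro sum.cong refl) (simp add: tensor_def axis_def)
    then show ?thesis by simp
  qed
  then show ?thesis by (simp add: vec_eq_iff)
qed

text \<open>For projections \<open>A\<close> and \<open>B\<close> this writes a matrix as a combination of tensors of vectors in their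
  ranges.\<close>
lemma sandwich_eq_sum_tensor:
  fixes A B :: "real^'n^'n"
  shows "A ** (X::real^'n^'n) ** transpose B =
    (\<Sum>i\<in>UNIV. \<Sum>j\<in>UNIV. X$i$j *\<^sub>R tensor (A *v axis i 1) (B *v axis j 1))"
proof -
  have lin: "linear (\<lambda>Y. A ** Y ** transpose B)"
    by (rule linearI) (simp_all add: matrix_ring)
  have "A ** X ** transpose B =
    A ** (\<Sum>i\<in>UNIV. \<Sum>j\<in>UNIV. X$i$j *\<^sub>R tensor (axis i 1) (axis j 1)) ** transpose B"
    using matrix_eq_sum_tensor[of X] by simp
  also have "\<dots> = (\<Sum>i\<in>UNIV. \<Sum>j\<in>UNIV. X$i$j *\<^sub>R (A ** tensor (axis i 1) (axis j 1) ** transpose B))"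
    by (simp add: linear_sum[OF lin, unfolded o_def] linear_scale[OF lin])
  also have "\<dots> = (\<Sum>i\<in>UNIV. \<Sum>j\<in>UNIV. X$i$j *\<^sub>R tensor (A *v axis i 1) (B *v axis j 1))"
    unfolding matrix_mul_tensor tensor_mul_matrix transpose_transpose ..
  finally show ?thesis .
qed

text \<open>Polarization: \<open>2 (u \<otimes> v + v \<otimes> u)\<close> is the difference of the squares of \<open>u + v\<close> and \<open>u - v\<close>, so the
  squares \<open>a \<otimes> a\<close> span the symmetric tensors.\<close>
lemma symmetric_tensor_ext:
  fixes f g :: "real^'n^'n \<Rightarrow> real"
  assumes "linear f" "linear g" and U: "subspace U"
    and eq: "\<And>a. a \<in> U \<Longrightarrow> f (tensor a a) = g (tensor a a)"
    and A: "\<And>x. A *v x \<in> U" and X: "A ** X ** transpose A = X" "transpose X = X"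
  shows "f X = g X"
proof -
  define h where "h = (\<lambda>X. f X - g X)"
  have lin: "linear h" unfolding h_def using assms(1,2) by (rule linear_compose_sub)
  have anti: "h (tensor u v) + h (tensor v u) = 0" if "u \<in> U" "v \<in> U" for u v
  proof -
    have "h (tensor (u + v) (u + v)) = 0" "h (tensor u u) = 0" "h (tensor v v) = 0"
      using eq that subspace_add[OF U] by (auto simp: h_def)
    then show ?thesis by (simp add: tensor_bilinear linear_add[OF lin])
  qed
  have Xsym: "X $ i $ j = X $ j $ i" for i j
    using X(2) by (metis transpose_def vec_lambda_beta)
  have e: "h X = (\<Sum>i\<in>UNIV. \<Sum>j\<in>UNIV. X$i$j * h (tensor (A *v axis i 1) (A *v axis j 1)))"
    (is "_ = ?s")
  proof -
    have "h X = h (\<Sum>i\<in>UNIV. \<Sum>j\<in>UNIV. X$i$j *\<^sub>R tensor (A *v axis i 1) (A *v axis j 1))"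
      using sandwich_eq_sum_tensor[of A X A] X(1) by simp
    then show ?thesis by (simp add: linear_sum[OF lin, unfolded o_def] linear_scale[OF lin])
  qed
  have "?s = (\<Sum>i\<in>UNIV. \<Sum>j\<in>UNIV. X$j$i * h (tensor (A *v axis j 1) (A *v axis i 1)))"
    by (rule sum.swap)
  also have "\<dots> = (\<Sum>i\<in>UNIV. \<Sum>j\<in>UNIV. - (X$i$j * h (tensor (A *v axis i 1) (A *v axis j 1))))"
    using anti[OF A A] by (intro sum.cong refl) (metis Xsym add_eq_0_iff2 mult_minus_right)
  also have "\<dots> = - ?s" by (simp add: sum_negf)
  finally show ?thesis using e by (simp add: h_def)
qed

lemma matrix_inv_eqI:
  fixes A B :: "real^'n^'n"
  assumes "A ** B = mat 1"
  shows "matrix_inv A = B"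
proof -
  have BA: "B ** A = mat 1" using assms by (simp add: matrix_left_right_inverse)
  have "A ** matrix_inv A = mat 1 \<and> matrix_inv A ** A = mat 1"
    unfolding matrix_inv_def by (rule someI[where x = B]) (use assms BA in simp)
  then show ?thesis
    by (metis BA matrix_mul_assoc matrix_mul_lid matrix_mul_rid)
qed

lemma matrix_inv_mul:
  fixes A :: "real^'n^'n"
  assumes "det A \<noteq> 0"
  shows "A ** matrix_inv A = mat 1" "matrix_inv A ** A = mat 1"
proof -
  obtain B where "A ** B = mat 1"
    using assms by (metis invertible_def invertible_det_nz)
  then show "A ** matrix_inv A = mat 1" by (metis matrix_inv_eqI)
  then show "matrix_inv A ** A = mat 1" by (simp add: matrix_left_right_inverse)
qed

lemma orthogonal_matrix_matrix_inv:
  "orthogonal_matrix (h::real^'n^'n) \<Longrightarrow> matrix_inv h = transpose h"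
  unfolding orthogonal_matrix_def by (intro matrix_inv_eqI) simp

lemma Ad_orthogonal:
  "orthogonal_matrix h \<Longrightarrow> Ad h X = h ** X ** transpose h"
  by (simp add: Ad_def orthogonal_matrix_matrix_inv)

lemma Ad_tensor:
  "orthogonal_matrix h \<Longrightarrow> Ad h (tensor u v) = tensor (h *v u) (h *v v)"
  by (simp add: Ad_orthogonal matrix_mul_tensor tensor_mul_matrix)

lemma linear_Ad: "linear (Ad h)"
  unfolding Ad_def by (rule linearI) (simp_all add: matrix_ring)

lemma Ad_mul:
  assumes "det a \<noteq> 0" "det b \<noteq> 0"
  shows "Ad (a ** b) X = Ad a (Ad b X)"
proof -
  have "(a ** b) ** (matrix_inv b ** matrix_inv a) = a ** (b ** matrix_inv b) ** matrix_inv a"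
    by (simp add: matrix_mul_assoc)
  then have "matrix_inv (a ** b) = matrix_inv b ** matrix_inv a"
    using assms by (intro matrix_inv_eqI) (simp add: matrix_inv_mul)
  then show ?thesis by (simp add: Ad_def matrix_mul_assoc)
qed

lemma Ad_mat_1: "Ad (mat 1 :: real^'n^'n) X = X"
proof -
  have "matrix_inv (mat 1 :: real^'n^'n) = mat 1" by (intro matrix_inv_eqI) simp
  then show ?thesis by (simp add: Ad_def)
qed

lemma trace_Ad: "det h \<noteq> 0 \<Longrightarrow> trace (Ad h X) = trace X"
  unfolding Ad_def
  by (subst trace_mul_sym) (simp add: matrix_mul_assoc matrix_inv_mul)

lemma inner_Ad:
  assumes "orthogonal_matrix h"
  shows "Ad h X \<bullet> Ad h Y = X \<bullet> Y"
proof -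
  have "Ad h X \<bullet> Ad h Y = X \<bullet> (transpose h ** ((h ** Y ** transpose h) ** h))"
    unfolding Ad_orthogonal[OF assms] inner_matrix_mul_right[of "h ** X"] inner_matrix_mul_left[of h X]
    by simp
  also have "transpose h ** ((h ** Y ** transpose h) ** h) = (transpose h ** h) ** Y ** (transpose h ** h)"
    by (simp only: matrix_mul_assoc)
  finally show ?thesis using assms by (simp add: orthogonal_matrix_def)
qed

section \<open>Plane rotations\<close>

definition plane_rotation :: "real^'n \<Rightarrow> real^'n \<Rightarrow> real \<Rightarrow> real^'n^'n" where
  "plane_rotation u v t = mat 1 + (cos t - 1) *\<^sub>R (tensor u u + tensor v v)
     + sin t *\<^sub>R (tensor v u - tensor u v)"

lemma plane_rotation_vec:
  "plane_rotation u v t *v x = x + ((cos t - 1) * (u \<bullet> x) - sin t * (v \<bullet> x)) *\<^sub>R u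
     + ((cos t - 1) * (v \<bullet> x) + sin t * (u \<bullet> x)) *\<^sub>R v"
  by (simp add: plane_rotation_def matrix_vector_mult_add_rdistrib matrix_vector_mult_diff_rdistrib
      scaleR_matrix_vector_assoc[symmetric] tensor_mult_vec algebra_simps)

context
  fixes u v :: "real^'n"
  assumes uv: "norm u = 1" "norm v = 1" "u \<bullet> v = 0"
begin

lemma uv_inner: "u \<bullet> u = 1" "v \<bullet> v = 1" "v \<bullet> u = 0" "u \<bullet> v = 0"
  using uv by (auto simp: norm_eq_1 inner_commute)

lemma plane_rotation_u: "plane_rotation u v t *v u = cos t *\<^sub>R u + sin t *\<^sub>R v"
  by (simp add: plane_rotation_vec uv_inner algebra_simps)

lemma plane_rotation_v: "plane_rotation u v t *v v = cos t *\<^sub>R v - sin t *\<^sub>R u"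
  by (simp add: plane_rotation_vec uv_inner algebra_simps)

lemma plane_rotation_fix: "u \<bullet> x = 0 \<Longrightarrow> v \<bullet> x = 0 \<Longrightarrow> plane_rotation u v t *v x = x"
  by (simp add: plane_rotation_vec)

lemma plane_rotation_add:
  "plane_rotation u v s ** plane_rotation u v t = plane_rotation u v (s + t)"
proof -
  have "plane_rotation u v s *v (plane_rotation u v t *v x) = plane_rotation u v (s + t) *v x" for x
    unfolding plane_rotation_vec[of u v t x]
    by (simp add: matrix_vector_right_distrib matrix_vector_mult_scaleR plane_rotation_u plane_rotation_v)
      (simp add: plane_rotation_vec cos_add sin_add algebra_simps)
  then show ?thesis
    by (simp add: matrix_eq matrix_vector_mul_assoc)
qed

lemma plane_rotation_transpose: "transpose (plane_rotation u v t) = plane_rotation u v (- t)"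
  by (simp add: plane_rotation_def transpose_ring transpose_tensor algebra_simps)

lemma plane_rotation_zero: "plane_rotation u v 0 = mat 1"
  by (simp add: plane_rotation_def)

lemma orthogonal_plane_rotation: "orthogonal_matrix (plane_rotation u v t)"
  by (simp add: orthogonal_matrix_def plane_rotation_transpose plane_rotation_add plane_rotation_zero)

text \<open>A rotation is the square of the rotation by half the angle, so its determinant is a square.\<close>
lemma rotation_plane_rotation: "rotation_matrix (plane_rotation u v t)"
proof -
  have "det (plane_rotation u v t) = det (plane_rotation u v (t/2)) * det (plane_rotation u v (t/2))"
    by (simp add: plane_rotation_add flip: det_mul)
  moreover have "det (plane_rotation u v (t/2)) = 1 \<or> det (plane_rotation u v (t/2)) = -1"
    using det_orthogonal_matrix[OF orthogonal_plane_rotation] .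
  ultimately have "det (plane_rotation u v t) = 1" by auto
  then show ?thesis by (simp add: rotation_matrix_def orthogonal_plane_rotation)
qed

lemma plane_rotation_in_SO:
  assumes "u \<in> U" "v \<in> U"
  shows "plane_rotation u v t \<in> SO U"
  using assms rotation_plane_rotation
  by (auto simp: SO_def orthogonal_comp_def orthogonal_def intro!: plane_rotation_fix)

end

section \<open>Normalizing an invariant scalar product\<close>

lemma orthogonal_projection_exists:
  fixes S :: "'a::euclidean_space set"
  assumes "subspace S"
  obtains p where "linear p" "\<And>x. p x \<in> S" "\<And>x y. y \<in> S \<Longrightarrow> (x - p x) \<bullet> y = 0"
    "\<And>x. x \<in> S \<Longrightarrow> p x = x"
proof -
  obtain B where B: "B \<subseteq> S" "pairwise orthogonal B" "\<And>x. x \<in> B \<Longrightarrow> norm x = 1"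
    "independent B" "card B = dim S" "span B = S"
    by (rule orthonormal_basis_subspace[OF assms]) blast
  have fin: "finite B" using B(4) by (rule independent_imp_finite)
  define p where "p x = (\<Sum>b\<in>B. (x \<bullet> b) *\<^sub>R b)" for x
  have lin: "linear p"
    by (rule linearI) (simp_all add: p_def algebra_simps sum.distrib scaleR_sum_right)
  have pS: "p x \<in> S" for x
    unfolding p_def using B(1) assms by (intro subspace_sum) (auto intro: subspace_scale)
  have ortho: "(x - p x) \<bullet> y = 0" if "y \<in> S" for x y
  proof -
    have b: "(x - p x) \<bullet> b = 0" if "b \<in> B" for b
    proof -
      have "p x \<bullet> b = (\<Sum>c\<in>B. (x \<bullet> c) * (c \<bullet> b))" by (simp add: p_def inner_sum_left)
      also have "\<dots> = (\<Sum>c\<in>B. if c = b then x \<bullet> c else 0)"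
        using that B(2,3) by (intro sum.cong refl) (auto simp: pairwise_def orthogonal_def norm_eq_1)
      finally show ?thesis using that fin by (simp add: inner_diff_left)
    qed
    have "orthogonal (x - p x) y"
      by (rule orthogonal_to_span[of y B]) (use that B(6) b in \<open>auto simp: orthogonal_def\<close>)
    then show ?thesis by (simp add: orthogonal_def)
  qed
  have "p x = x" if "x \<in> S" for x
  proof -
    have "x - p x \<in> S" using that pS assms by (auto intro: subspace_diff)
    then have "(x - p x) \<bullet> (x - p x) = 0" by (rule ortho)
    then show ?thesis by simp
  qed
  with lin pS ortho show ?thesis by (rule that)
qed

text \<open>Cauchy--Schwarz for a positive semidefinite form: its isotropic vectors lie in the radical.\<close>
lemma isotropic_imp_radical:
  fixes B :: "'a::real_vector \<Rightarrow> 'a \<Rightarrow> real"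
  assumes B: "bilinear B" and sym: "\<And>x y. B x y = B y x" and E: "subspace E"
    and nonneg: "\<And>x. x \<in> E \<Longrightarrow> B x x \<ge> 0"
    and "z \<in> E" "B z z = 0" "y \<in> E"
  shows "B z y = 0"
proof (rule ccontr)
  assume ne: "B z y \<noteq> 0"
  define c where "c = B y y + 1"
  have c: "c \<ge> 1" using nonneg[OF \<open>y \<in> E\<close>] by (simp add: c_def)
  \<comment> \<open>The minimum over \<open>t\<close> is at \<open>- B z y / B y y\<close>; adding 1 avoids the division by 0.\<close>
  define t where "t = - B z y / c"
  have "z + t *\<^sub>R y \<in> E" using assms by (simp add: subspace_add subspace_scale)
  then have "0 \<le> B (z + t *\<^sub>R y) (z + t *\<^sub>R y)" by (rule nonneg)
  also have "\<dots> = 2 * t * B z y + t\<^sup>2 * (c - 1)"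
    using \<open>B z z = 0\<close> sym[of y z]
    by (simp add: c_def bilinear_ladd[OF B] bilinear_radd[OF B] bilinear_lmul[OF B]
        bilinear_rmul[OF B] power2_eq_square algebra_simps)
  also have "\<dots> = - ((B z y)\<^sup>2 * (c + 1) / c\<^sup>2)"
    using c by (simp add: t_def field_simps power2_eq_square)
  also have "\<dots> < 0" using ne c by simp
  finally show False by simp
qed

text \<open>A unit vector \<open>x\<close> maximizing \<open>B x x\<close> is isotropic for the semidefinite form \<open>B x x (y \<bullet> z) - B y z\<close>,
  hence in its radical.\<close>
lemma max_eigenvector:
  fixes B :: "'a::euclidean_space \<Rightarrow> 'a \<Rightarrow> real"
  assumes B: "bilinear B" and sym: "\<And>x y. B x y = B y x"
    and E: "subspace E" and nz: "E \<noteq> {0}"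
  obtains x where "x \<in> E" "norm x = 1" "\<And>y. y \<in> E \<Longrightarrow> B x y = B x x * (x \<bullet> y)"
proof -
  let ?K = "E \<inter> sphere 0 1"
  obtain e where e: "e \<in> E" "e \<noteq> 0" using nz subspace_0[OF E] by auto
  have "compact ?K"
    using closed_Int_compact[OF closed_subspace[OF E] compact_sphere] .
  moreover have "?K \<noteq> {}"
  proof -
    have "e /\<^sub>R norm e \<in> ?K" using e E by (auto simp: subspace_scale)
    then show ?thesis by blast
  qed
  moreover have "continuous_on ?K (\<lambda>x. B x x)"
    by (rule bilinear_continuous_on_compose[OF continuous_on_id continuous_on_id B, simplified])
  ultimately obtain x where x: "x \<in> ?K" "\<And>y. y \<in> ?K \<Longrightarrow> B y y \<le> B x x"
    using continuous_attains_sup[of ?K "\<lambda>x. B x x"] by blast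
  define D where "D = (\<lambda>y z. B x x * (y \<bullet> z) - B y z)"
  have D: "bilinear D"
    unfolding D_def bilinear_def
    by (auto intro!: linearI simp: inner_add bilinear_ladd[OF B] bilinear_radd[OF B]
        bilinear_lmul[OF B] bilinear_rmul[OF B] algebra_simps)
  have "D y y \<ge> 0" if "y \<in> E" for y
  proof (cases "y = 0")
    case True then show ?thesis by (simp add: bilinear_lzero[OF D])
  next
    case False
    then have "y /\<^sub>R norm y \<in> ?K" using that E by (auto simp: subspace_scale)
    from x(2)[OF this] have "B y y / (norm y)\<^sup>2 \<le> B x x"
      by (simp add: bilinear_lmul[OF B] bilinear_rmul[OF B] field_simps power2_eq_square)
    then show ?thesis using False by (simp add: D_def field_simps power2_norm_eq_inner)
  qed
  moreover have "D y z = D z y" for y z by (simp add: D_def sym[of y z] inner_commute)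
  moreover have "D x x = 0" using x(1) by (simp add: D_def norm_eq_1)
  ultimately have "D x y = 0" if "y \<in> E" for y
    using isotropic_imp_radical[OF D _ E, of x y] that x(1) by auto
  then show ?thesis using that[of x] x(1) by (auto simp: D_def)
qed

lemma isometry_onto_invariant_subspace:
  fixes h :: "'a::euclidean_space \<Rightarrow> 'a"
  assumes "linear h" "subspace S" "\<And>x. x \<in> S \<Longrightarrow> h x \<in> S"
    and "\<And>x. x \<in> S \<Longrightarrow> h x \<bullet> h x = x \<bullet> x"
  shows "h ` S = S"
proof (rule subspace_dim_equal)
  show "subspace (h ` S)" using assms by (simp add: linear_subspace_image)
  show "h ` S \<subseteq> S" using assms by auto
  have "inj_on h (span S)"
  proof (rule inj_onI)
    fix x y assume xy: "x \<in> span S" "y \<in> span S" "h x = h y"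
    then have "x - y \<in> S" using assms(2) by (metis span_eq_iff subspace_diff)
    from assms(4)[OF this] show "x = y" using xy(3) by (simp add: linear_diff[OF assms(1)])
  qed
  then show "dim S \<le> dim (h ` S)" using assms(1) by (simp add: dim_image_eq)
qed fact

lemma injective_endomorphism_onto:
  fixes L :: "'b::euclidean_space \<Rightarrow> 'b"
  assumes L: "linear L" and E: "subspace E" and LE: "\<And>x. x \<in> E \<Longrightarrow> L x \<in> E"
    and inj: "\<And>x. x \<in> E \<Longrightarrow> L x = 0 \<Longrightarrow> x = 0"
  shows "L ` E = E" "inj_on L E"
proof -
  show i: "inj_on L E"
  proof (rule inj_onI)
    fix x y assume "x \<in> E" "y \<in> E" "L x = L y"
    then have "x - y \<in> E" "L (x - y) = 0" using E by (simp_all add: subspace_diff linear_diff[OF L])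
    then have "x - y = 0" by (rule inj)
    then show "x = y" by simp
  qed
  have "inj_on L (span E)" using E i by (simp only: span_eq_iff[THEN iffD2])
  then have "dim (L ` E) = dim E" by (rule dim_image_eq[OF L])
  then show "L ` E = E" using L E LE by (intro subspace_dim_equal) (auto intro: linear_subspace_image)
qed

text \<open>An invariant scalar product differs from the Euclidean one by a change of variable \<open>L\<close> that
  commutes with the group: split off the eigenspace of the greatest eigenvalue \<open>\<mu>\<close>, which is
  invariant and on which \<open>L\<close> is the scalar \<open>1 / sqrt \<mu>\<close>, and pass to its orthogonal complement.\<close>
lemma equivariant_normalization:
  fixes B :: "'a::euclidean_space \<Rightarrow> 'a \<Rightarrow> real" and A :: "('a \<Rightarrow> 'a) set"
  assumes B: "bilinear B" and sym: "\<And>x y. B x y = B y x"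
    and "subspace E" and "\<And>x. x \<in> E \<Longrightarrow> x \<noteq> 0 \<Longrightarrow> B x x > 0"
    and lin: "\<And>h. h \<in> A \<Longrightarrow> linear h"
    and "\<And>h x. h \<in> A \<Longrightarrow> x \<in> E \<Longrightarrow> h x \<in> E"
    and "\<And>h x y. h \<in> A \<Longrightarrow> x \<in> E \<Longrightarrow> y \<in> E \<Longrightarrow> h x \<bullet> h y = x \<bullet> y"
    and "\<And>h x y. h \<in> A \<Longrightarrow> x \<in> E \<Longrightarrow> y \<in> E \<Longrightarrow> B (h x) (h y) = B x y"
  shows "\<exists>L. linear L \<and> (\<forall>x\<in>E. L x \<in> E) \<and> (\<forall>h\<in>A. \<forall>x\<in>E. L (h x) = h (L x)) \<and>
     (\<forall>x\<in>E. \<forall>y\<in>E. B (L x) (L y) = x \<bullet> y)"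
  using assms(3,4,6-8)
proof (induction "dim E" arbitrary: E rule: less_induct)
  case less
  note E = less.prems(1) and pos = less.prems(2) and hE = less.prems(3)
    and iso = less.prems(4) and inv = less.prems(5)
  show ?case
  proof (cases "E = {0}")
    case True
    have "h 0 = 0" if "h \<in> A" for h using lin[OF that] by (rule linear_0)
    then show ?thesis using True
      by (intro exI[of _ "\<lambda>x. 0"]) (auto simp: bilinear_lzero[OF B] linear_iff)
  next
    case False
    obtain x0 where x0: "x0 \<in> E" "norm x0 = 1" "\<And>y. y \<in> E \<Longrightarrow> B x0 y = B x0 x0 * (x0 \<bullet> y)"
      by (rule max_eigenvector[OF B sym E False]) blast
    define \<mu> where "\<mu> = B x0 x0"
    have "x0 \<noteq> 0" using x0(2) by auto
    then have \<mu>: "\<mu> > 0" using pos[OF x0(1)] by (simp add: \<mu>_def)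
    define E1 where "E1 = {x\<in>E. \<forall>y\<in>E. B x y = \<mu> * (x \<bullet> y)}"
    define E2 where "E2 = {x\<in>E. \<forall>y\<in>E1. x \<bullet> y = 0}"
    have E1: "subspace E1"
      using E unfolding E1_def subspace_def
      by (auto simp: bilinear_ladd[OF B] bilinear_lmul[OF B] bilinear_lzero[OF B] algebra_simps)
    have E2: "subspace E2"
      using E unfolding E2_def subspace_def by (auto simp: algebra_simps)
    have E1E: "E1 \<subseteq> E" and E2E: "E2 \<subseteq> E" by (auto simp: E1_def E2_def)
    have x01: "x0 \<in> E1" using x0(1,3) unfolding E1_def \<mu>_def by blast
    have "x0 \<bullet> x0 \<noteq> 0" using \<open>x0 \<noteq> 0\<close> by simp
    then have "x0 \<notin> E2" using x01 unfolding E2_def by blast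
    then have "E2 \<subset> E" using E2E x0(1) by blast
    then have "dim E2 < dim E"
      using E E2 by (intro dim_psubset) (metis span_eq_iff)
    have hE1: "h x \<in> E1" if h: "h \<in> A" and x: "x \<in> E1" for h x
    proof -
      have onto: "h ` E = E"
        by (rule isometry_onto_invariant_subspace[OF lin[OF h] E hE[OF h] iso[OF h]])
      have "B (h x) y = \<mu> * (h x \<bullet> y)" if "y \<in> E" for y
      proof -
        have "y \<in> h ` E" using onto that by simp
        then obtain y' where y': "y' \<in> E" "y = h y'" by (rule imageE) simp
        have "x \<in> E" "B x y' = \<mu> * (x \<bullet> y')" using x y'(1) unfolding E1_def by blast+
        then show ?thesis using inv[OF h _ y'(1)] iso[OF h _ y'(1)] y'(2) by simp
      qed
      then show ?thesis using x hE[OF h] unfolding E1_def by blast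
    qed
    have hE2: "h x \<in> E2" if h: "h \<in> A" and x: "x \<in> E2" for h x
    proof -
      have "h ` E1 = E1"
      proof (rule isometry_onto_invariant_subspace[OF lin[OF h] E1 hE1[OF h]])
        show "h y \<bullet> h y = y \<bullet> y" if "y \<in> E1" for y using iso[OF h] E1E that by blast
      qed
      moreover have "h x \<bullet> h y = 0" if "y \<in> E1" for y
      proof -
        have "x \<in> E" "y \<in> E" "x \<bullet> y = 0" using that x E1E unfolding E2_def by blast+
        then show ?thesis using iso[OF h] by simp
      qed
      ultimately have "\<forall>y\<in>h ` E1. h x \<bullet> y = 0" by blast
      then have "\<forall>y\<in>E1. h x \<bullet> y = 0" unfolding \<open>h ` E1 = E1\<close> .
      then show ?thesis using x hE[OF h] unfolding E2_def by blast
    qed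
    have "\<exists>L. linear L \<and> (\<forall>x\<in>E2. L x \<in> E2) \<and> (\<forall>h\<in>A. \<forall>x\<in>E2. L (h x) = h (L x)) \<and>
     (\<forall>x\<in>E2. \<forall>y\<in>E2. B (L x) (L y) = x \<bullet> y)"
    proof (rule less.hyps[OF \<open>dim E2 < dim E\<close> E2])
      show "B x x > 0" if "x \<in> E2" "x \<noteq> 0" for x using pos that E2E by blast
      show "h x \<bullet> h y = x \<bullet> y" if "h \<in> A" "x \<in> E2" "y \<in> E2" for h x y
        using iso that E2E by blast
      show "B (h x) (h y) = B x y" if "h \<in> A" "x \<in> E2" "y \<in> E2" for h x y
        using inv that E2E by blast
    qed (rule hE2)
    then obtain M where M: "linear M" "\<And>x. x \<in> E2 \<Longrightarrow> M x \<in> E2"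
      "\<And>h x. h \<in> A \<Longrightarrow> x \<in> E2 \<Longrightarrow> M (h x) = h (M x)"
      "\<And>x y. x \<in> E2 \<Longrightarrow> y \<in> E2 \<Longrightarrow> B (M x) (M y) = x \<bullet> y" by blast
    obtain p where p: "linear p" "\<And>x. p x \<in> E1" "\<And>x y. y \<in> E1 \<Longrightarrow> (x - p x) \<bullet> y = 0"
      "\<And>x. x \<in> E1 \<Longrightarrow> p x = x"
      using orthogonal_projection_exists[OF E1] by metis
    have q: "x - p x \<in> E2" if "x \<in> E" for x
      using that p(2)[of x] p(3)[of _ x] E1E E by (auto simp: E2_def intro: subspace_diff)
    have ph: "p (h x) = h (p x)" if h: "h \<in> A" and x: "x \<in> E" for h x
    proof -
      have "p (h x) - h (p x) \<in> E1"
        using subspace_diff[OF E1 p(2) hE1[OF h p(2)]] .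
      moreover have "h (x - p x) - (h x - p (h x)) \<in> E2"
        using subspace_diff[OF E2 hE2[OF h q[OF x]] q[OF hE[OF h x]]] .
      then have "p (h x) - h (p x) \<in> E2" by (simp add: linear_diff[OF lin[OF h]])
      ultimately have "p (h x) - h (p x) \<in> E1" "p (h x) - h (p x) \<in> E2" .
      then have "(p (h x) - h (p x)) \<bullet> (p (h x) - h (p x)) = 0"
        unfolding E2_def by blast
      then show ?thesis by simp
    qed
    define L where "L x = (1 / sqrt \<mu>) *\<^sub>R p x + M (x - p x)" for x
    have "linear L"
      by (rule linearI) (simp_all add: L_def linear_add[OF p(1)] linear_scale[OF p(1)]
        linear_diff[OF M(1)] linear_add[OF M(1)] linear_scale[OF M(1)] algebra_simps)
    moreover have "L x \<in> E" if "x \<in> E" for x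
    proof -
      have "p x \<in> E" "M (x - p x) \<in> E" using p(2)[of x] M(2)[OF q[OF that]] E1E E2E by blast+
      then show ?thesis unfolding L_def using E by (intro subspace_add subspace_scale)
    qed
    moreover have "L (h x) = h (L x)" if "h \<in> A" "x \<in> E" for h x
    proof -
      have "M (h x - p (h x)) = h (M (x - p x))"
        using M(3)[OF that(1) q[OF that(2)]] ph[OF that] by (simp add: linear_diff[OF lin[OF that(1)]])
      then show ?thesis
        by (simp add: L_def ph[OF that] linear_add[OF lin[OF that(1)]] linear_scale[OF lin[OF that(1)]])
    qed
    moreover have "B (L x) (L y) = x \<bullet> y" if x: "x \<in> E" and y: "y \<in> E" for x y
    proof -
      have z: "B a b = 0" "a \<bullet> b = 0" if "a \<in> E1" "b \<in> E2" for a b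
        using that by (auto simp: E1_def E2_def inner_commute)
      have m: "M (x - p x) \<in> E2" "M (y - p y) \<in> E2" using M(2) q x y by auto
      have "B (p x) (p y) = \<mu> * (p x \<bullet> p y)"
        using p(2)[of x] p(2)[of y] E1E by (auto simp: E1_def)
      then have "(1 / sqrt \<mu>) * ((1 / sqrt \<mu>) * B (p x) (p y)) = p x \<bullet> p y"
        using \<mu> by (simp add: field_simps)
      moreover have "B (p x) (M (y - p y)) = 0" "B (M (x - p x)) (p y) = 0"
        using z m p(2) sym by auto
      moreover have "B (M (x - p x)) (M (y - p y)) = (x - p x) \<bullet> (y - p y)"
        using M(4) q x y by auto
      ultimately have "B (L x) (L y) = p x \<bullet> p y + (x - p x) \<bullet> (y - p y)"
        by (simp add: L_def bilinear_ladd[OF B] bilinear_radd[OF B] bilinear_lmul[OF B]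
            bilinear_rmul[OF B])
      also have "\<dots> = (p x + (x - p x)) \<bullet> (p y + (y - p y))"
        using z(2)[OF p(2)[of y] q[OF x]] z(2)[OF p(2)[of x] q[OF y]]
        unfolding inner_add_left inner_add_right
        by (simp only: inner_commute[of "x - p x" "p y"] add_0 add_0_right)
      finally show ?thesis by simp
    qed
    ultimately show ?thesis by (intro exI[of _ L]) simp
  qed
qed

section \<open>Rotations moving prescribed vectors\<close>

lemma unit_orthogonal_exists:
  fixes U :: "(real^'n) set"
  assumes U: "subspace U" and S: "finite S" "S \<subseteq> U" "card S < dim U"
  obtains f where "f \<in> U" "norm f = 1" "\<And>s. s \<in> S \<Longrightarrow> s \<bullet> f = 0"
proof -
  have "dim S < dim U" using dim_le_card'[OF S(1)] S(3) by simp
  then have "span S \<subset> span U"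
    using S(2) by (metis dim_span order_less_irrefl psubsetI span_mono)
  then obtain x where x: "x \<noteq> 0" "x \<in> span U" "\<And>y. y \<in> span S \<Longrightarrow> orthogonal x y"
    using orthogonal_to_subspace_exists_gen by blast
  have "x /\<^sub>R norm x \<in> U" using x(2) U by (metis span_eq_iff subspace_scale)
  moreover have "s \<bullet> (x /\<^sub>R norm x) = 0" if "s \<in> S" for s
    using x(3)[OF span_base[OF that]] by (simp add: orthogonal_def inner_commute)
  ultimately show ?thesis using that[of "x /\<^sub>R norm x"] x(1) by auto
qed

lemma orthonormal_pair_exists:
  fixes U :: "(real^'n) set"
  assumes U: "subspace U" and "dim U \<ge> 2" and a: "a \<in> U" "norm a = 1" and u: "u \<in> U"
  obtains f c where "f \<in> U" "norm f = 1" "a \<bullet> f = 0" "u = (a \<bullet> u) *\<^sub>R a + c *\<^sub>R f"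
proof -
  define r where "r = u - (a \<bullet> u) *\<^sub>R a"
  have rU: "r \<in> U" using U a u by (auto simp: r_def intro: subspace_diff subspace_scale)
  have ar: "a \<bullet> r = 0" using a(2) by (simp add: r_def algebra_simps norm_eq_1)
  show ?thesis
  proof (cases "r = 0")
    case True
    obtain f where "f \<in> U" "norm f = 1" "\<And>s. s \<in> {a} \<Longrightarrow> s \<bullet> f = 0"
      using unit_orthogonal_exists[OF U, of "{a}"] a assms(2) by auto
    then show ?thesis using that[of f 0] True by (auto simp: r_def)
  next
    case False
    then show ?thesis using that[of "r /\<^sub>R norm r" "norm r"] rU ar U
      by (auto simp: subspace_scale r_def)
  qed
qed

lemma mat_1_in_SO: "mat 1 \<in> SO U"
  by (simp add: SO_def rotation_matrix_def orthogonal_matrix_def)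

lemma SO_orthogonal: "h \<in> SO U \<Longrightarrow> orthogonal_matrix h"
  by (simp add: SO_def rotation_matrix_def)

lemma SO_mono: "U' \<subseteq> U \<Longrightarrow> SO U' \<subseteq> SO U"
  by (auto simp: SO_def orthogonal_comp_def)

text \<open>The rotation in the plane of \<open>z\<close> and \<open>z'\<close> through the angle between them.\<close>
lemma SO_transitive_squares:
  fixes U :: "(real^'n) set"
  assumes U: "subspace U" and z: "z \<in> U" "norm z = 1" and z': "z' \<in> U" "norm z' = 1"
  obtains h where "h \<in> SO U" "Ad h (tensor z z) = tensor z' z'"
proof (cases "\<exists>v\<in>U. norm v = 1 \<and> z \<bullet> v = 0 \<and> (\<exists>c. z' = (z \<bullet> z') *\<^sub>R z + c *\<^sub>R v)")
  case True
  then obtain v c where v: "v \<in> U" "norm v = 1" "z \<bullet> v = 0" "z' = (z \<bullet> z') *\<^sub>R z + c *\<^sub>R v" by blast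
  define d where "d = z \<bullet> z'"
  have "z' \<bullet> z' = d\<^sup>2 + c\<^sup>2"
    using v z(2) unfolding d_def[symmetric]
    by (simp add: inner_add norm_eq_1 inner_commute power2_eq_square)
  then have "d\<^sup>2 + c\<^sup>2 = 1" using z'(2) by (simp add: norm_eq_1)
  then obtain t where t: "d = cos t" "c = sin t" using sincos_total_2pi by metis
  have "plane_rotation z v t *v z = z'"
    using plane_rotation_u[OF z(2) v(2,3)] t v(4) by (simp add: d_def)
  then show ?thesis
    using that[of "plane_rotation z v t"] plane_rotation_in_SO[OF z(2) v(2,3) z(1) v(1)]
    by (simp add: Ad_tensor orthogonal_plane_rotation[OF z(2) v(2,3)])
next
  case False
  \<comment> \<open>Without a plane containing both vectors, \<open>z'\<close> is \<open>z\<close> or \<open>- z\<close>.\<close>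
  have "z' - (z \<bullet> z') *\<^sub>R z = 0" (is "?r = 0")
  proof (rule ccontr)
    assume ne: "?r \<noteq> 0"
    have "?r \<in> U" using U z z' by (auto intro: subspace_diff subspace_scale)
    moreover have "z \<bullet> ?r = 0" using z(2) by (simp add: algebra_simps norm_eq_1)
    ultimately have "?r /\<^sub>R norm ?r \<in> U" "norm (?r /\<^sub>R norm ?r) = 1" "z \<bullet> (?r /\<^sub>R norm ?r) = 0"
      "z' = (z \<bullet> z') *\<^sub>R z + norm ?r *\<^sub>R (?r /\<^sub>R norm ?r)"
      using ne U by (auto simp: subspace_scale)
    then show False using False by blast
  qed
  then obtain d where e: "z' = d *\<^sub>R z" by (metis eq_iff_diff_eq_0)
  have "d * d = 1" using z(2) z'(2) unfolding norm_eq_1 by (simp add: e)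
  then have "tensor z' z' = tensor z z" by (simp add: e tensor_scaleR_left tensor_scaleR_right)
  then show ?thesis using that[OF mat_1_in_SO] by (simp add: Ad_mat_1)
qed

lemma half_turn:
  fixes U :: "(real^'n) set"
  assumes U: "subspace U" and "dim U \<ge> 2" and "a \<in> U" "norm a = 1" "u \<in> U"
  obtains h where "h \<in> SO U" "h *v a = - a" "h *v u = - u"
proof -
  obtain f c where f: "f \<in> U" "norm f = 1" "a \<bullet> f = 0" "u = (a \<bullet> u) *\<^sub>R a + c *\<^sub>R f"
    using orthonormal_pair_exists[OF assms] .
  let ?h = "plane_rotation a f pi"
  have a: "?h *v a = - a" and "?h *v f = - f"
    using plane_rotation_u[OF assms(4) f(2,3)] plane_rotation_v[OF assms(4) f(2,3)] by simp_all
  then have "?h *v ((a \<bullet> u) *\<^sub>R a + c *\<^sub>R f) = - ((a \<bullet> u) *\<^sub>R a + c *\<^sub>R f)"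
    by (simp add: matrix_vector_right_distrib matrix_vector_mult_scaleR)
  then show ?thesis
    using that[of ?h] plane_rotation_in_SO[OF assms(4) f(2,3) assms(3) f(1)] a f(4) by simp
qed

lemma half_turn_negating:
  fixes U :: "(real^'n) set"
  assumes U: "subspace U" and "dim U \<ge> 2" and "u \<in> U"
  obtains h where "h \<in> SO U" "h *v u = - u"
proof -
  obtain a where "a \<in> U" "norm a = 1"
    using unit_orthogonal_exists[OF U, of "{}"] assms(2) by auto
  then show ?thesis using half_turn[OF U assms(2) _ _ assms(3)] that by metis
qed

lemma half_turn_fixing:
  fixes U :: "(real^'n) set"
  assumes U: "subspace U" and "dim U \<ge> 3" and u: "u \<in> U" and u': "u' \<in> U" "u \<bullet> u' = 0"
  obtains h where "h \<in> SO U" "h *v u = - u" "h *v u' = u'"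
proof (cases "u = 0")
  case True then show ?thesis using that[OF mat_1_in_SO] by simp
next
  case False
  define a where "a = u /\<^sub>R norm u"
  have a: "a \<in> U" "norm a = 1" "a \<bullet> u' = 0" "u = norm u *\<^sub>R a"
    using False u U u' by (auto simp: a_def subspace_scale)
  have "card {a, u'} < dim U" using assms(2) by (simp add: card_insert_if)
  then obtain f where f: "f \<in> U" "norm f = 1" "\<And>s. s \<in> {a, u'} \<Longrightarrow> s \<bullet> f = 0"
    using unit_orthogonal_exists[OF U, of "{a, u'}"] a(1) u'(1) by blast
  have af: "a \<bullet> f = 0" "f \<bullet> u' = 0" using f(3)[of a] f(3)[of u'] by (simp_all add: inner_commute)
  let ?h = "plane_rotation a f pi"
  have "?h *v a = - a" using plane_rotation_u[OF a(2) f(2) af(1)] by simp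
  then have "?h *v (norm u *\<^sub>R a) = - (norm u *\<^sub>R a)"
    by (simp add: matrix_vector_mult_scaleR)
  moreover have "?h *v u' = u'" using plane_rotation_fix[OF a(2) f(2) af(1) a(3) af(2)] .
  ultimately show ?thesis
    using that[of ?h] plane_rotation_in_SO[OF a(2) f(2) af(1) a(1) f(1)] a(4) by simp
qed

section \<open>An orthogonal splitting\<close>

lemma tensor_space_projector:
  fixes P R :: "real^'n^'n"
  assumes U: "\<And>x. x \<in> U \<longleftrightarrow> P *v x = x" and "P ** P = P"
    and W: "\<And>x. x \<in> W \<longleftrightarrow> R *v x = x" and "R ** R = R" and sym: "transpose R = R"
  shows "tensor_space U W = {X. P ** X ** R = X}"
proof
  have "subspace {X. P ** X ** R = X}"
    by (auto simp: subspace_def matrix_ring)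
  moreover have "tensor u w \<in> {X. P ** X ** R = X}" if "u \<in> U" "w \<in> W" for u w
  proof -
    have "transpose R *v w = w" using that W by (simp only: sym)
    then show ?thesis using that U by (simp add: matrix_mul_tensor tensor_mul_matrix)
  qed
  ultimately show "tensor_space U W \<subseteq> {X. P ** X ** R = X}"
    unfolding tensor_space_def by (intro span_minimal) auto
next
  show "{X. P ** X ** R = X} \<subseteq> tensor_space U W"
  proof clarify
    fix X assume X: "P ** X ** R = X"
    have "P *v x \<in> U" "R *v x \<in> W" for x using U W assms(2,4) by (simp_all add: matrix_vector_mul_assoc)
    then have "P ** X ** transpose R \<in> tensor_space U W"
      unfolding sandwich_eq_sum_tensor tensor_space_def
      by (intro span_sum span_scale span_base) blast
    then show "X \<in> tensor_space U W" using X by (simp add: sym)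
  qed
qed

text \<open>\<open>P\<close> and \<open>R\<close> are the orthogonal projections onto \<open>U\<close> and \<open>W\<close>. They turn membership in the spaces of
  tensors into equations between matrices. The two summands can be exchanged, so that each statement
  about \<open>U\<close> can be used for \<open>W\<close>.\<close>
locale orth_split =
  fixes U W :: "(real^'n) set" and P R :: "real^'n^'n"
  assumes P_sym: "transpose P = P" and R_sym: "transpose R = R"
    and P_idem: "P ** P = P" and PR_sum: "P + R = mat 1"
    and U_iff: "x \<in> U \<longleftrightarrow> P *v x = x" and W_iff: "x \<in> W \<longleftrightarrow> R *v x = x"
    and trace_P: "trace P = real (dim U)" and trace_R: "trace R = real (dim W)"
    and dim_U: "dim U \<ge> 1" and dim_W: "dim W \<ge> 1"
begin

lemma R_eq: "R = mat 1 - P" using PR_sum by (simp add: algebra_simps)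
lemma P_eq: "P = mat 1 - R" using PR_sum by (simp add: algebra_simps)
lemma PR: "P ** R = 0" by (simp add: R_eq matrix_ring P_idem)
lemma RP: "R ** P = 0" by (simp add: R_eq matrix_ring P_idem)
lemma R_idem: "R ** R = R" by (simp add: R_eq matrix_ring P_idem)

lemma absorb: "P ** (P ** X) = P ** X" "R ** (R ** X) = R ** X" "P ** (R ** X) = 0" "R ** (P ** X) = 0"
  by (simp_all add: matrix_mul_assoc P_idem R_idem PR RP)

lemmas proj = P_idem R_idem PR RP absorb P_sym R_sym

lemma orth_split_swap: "orth_split W U R P"
  using P_sym R_sym R_idem PR_sum U_iff W_iff trace_P trace_R dim_U dim_W
  by unfold_locales (simp_all add: add.commute)

lemma P_in_U: "P *v x \<in> U" by (simp add: U_iff matrix_vector_mul_assoc P_idem)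
lemma R_in_W: "R *v x \<in> W" by (simp add: W_iff matrix_vector_mul_assoc R_idem)

lemma subspace_U: "subspace U"
  by (auto simp: subspace_def U_iff matrix_vector_right_distrib matrix_vector_mult_scaleR)

lemma unit_vector:
  obtains u where "u \<in> U" "norm u = 1"
  using unit_orthogonal_exists[OF subspace_U, of "{}"] dim_U by auto

lemma P_W: "w \<in> W \<Longrightarrow> P *v w = 0"
  by (metis W_iff PR matrix_vector_mul_assoc matrix_vector_mult_0)

lemma R_U: "u \<in> U \<Longrightarrow> R *v u = 0"
  by (metis U_iff RP matrix_vector_mul_assoc matrix_vector_mult_0)

lemma vec_split: "P *v x + R *v x = x"
  by (simp add: PR_sum flip: matrix_vector_mult_add_rdistrib)

lemma inner_P: "(P *v x) \<bullet> y = x \<bullet> (P *v y)"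
  using dot_lmul_matrix[of x P y] by (simp add: P_sym inner_commute flip: transpose_matrix_vector)

lemma orth_UW: "u \<in> U \<Longrightarrow> w \<in> W \<Longrightarrow> u \<bullet> w = 0"
  using inner_P[of u w] by (simp add: U_iff[THEN iffD1] P_W)

lemma orthogonal_comp_U: "U\<^sup>\<bottom> = W"
proof
  show "U\<^sup>\<bottom> \<subseteq> W"
  proof
    fix x assume "x \<in> U\<^sup>\<bottom>"
    then have "(P *v x) \<bullet> x = 0" using P_in_U by (simp add: orthogonal_comp_def orthogonal_def)
    then have "(P *v x) \<bullet> (P *v x) = 0"
      by (simp add: inner_P matrix_vector_mul_assoc P_idem)
    then show "x \<in> W" using vec_split[of x] by (simp add: W_iff)
  qed
  show "W \<subseteq> U\<^sup>\<bottom>" using orth_UW by (auto simp: orthogonal_comp_def orthogonal_def)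
qed

lemma tensor_space_UW: "tensor_space U W = {X. P ** X ** R = X}"
  by (rule tensor_space_projector) (use U_iff W_iff proj in auto)

lemma tensor_space_UU: "tensor_space U U = {X. P ** X ** P = X}"
  by (rule tensor_space_projector) (use U_iff proj in auto)

lemma S20_U: "S20 U = {X. P ** X ** P = X \<and> transpose X = X \<and> trace X = 0}"
  by (auto simp: S20_def tensor_space_UU)

lemma so_U: "so U = {X. P ** X ** P = X \<and> transpose X = - X}"
  by (auto simp: so_def tensor_space_UU)

lemma tensor_vanish:
  assumes "P ** X ** R = X"
  shows "R ** X = 0" "X ** P = 0" "P ** X = X" "X ** R = X"
proof -
  have "R ** (P ** X ** R) = 0" "(P ** X ** R) ** P = 0" "P ** (P ** X ** R) = P ** X ** R"
    "(P ** X ** R) ** R = P ** X ** R"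
    by (simp_all add: matrix_ring proj)
  then show "R ** X = 0" "X ** P = 0" "P ** X = X" "X ** R = X" unfolding assms .
qed

lemma tensor_vanish_U:
  assumes "P ** X ** P = X"
  shows "R ** X = 0" "X ** R = 0" "P ** X = X" "X ** P = X"
proof -
  have "R ** (P ** X ** P) = 0" "(P ** X ** P) ** R = 0" "P ** (P ** X ** P) = P ** X ** P"
    "(P ** X ** P) ** P = P ** X ** P"
    by (simp_all add: matrix_ring proj)
  then show "R ** X = 0" "X ** R = 0" "P ** X = X" "X ** P = X" unfolding assms .
qed

lemma b_endo_eq: "b_endo U W = real (dim W) *\<^sub>R P - real (dim U) *\<^sub>R R"
  unfolding b_endo_def
proof (rule the_equality)
  let ?b = "real (dim W) *\<^sub>R P - real (dim U) *\<^sub>R R"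
  have b: "?b *v x = real (dim W) *\<^sub>R (P *v x) - real (dim U) *\<^sub>R (R *v x)" for x
    by (simp add: matrix_vector_mult_diff_rdistrib scaleR_matrix_vector_assoc)
  show *: "(\<forall>u\<in>U. ?b *v u = real (dim W) *\<^sub>R u) \<and> (\<forall>w\<in>W. ?b *v w = - real (dim U) *\<^sub>R w)"
    using U_iff W_iff by (simp add: b P_W R_U)
  fix B assume B: "(\<forall>u\<in>U. B *v u = real (dim W) *\<^sub>R u) \<and> (\<forall>w\<in>W. B *v w = - real (dim U) *\<^sub>R w)"
  have "B *v x = ?b *v x" for x
  proof -
    have "B *v (P *v x + R *v x) = ?b *v (P *v x + R *v x)"
      using B * P_in_U[of x] R_in_W[of x] by (simp add: matrix_vector_right_distrib)
    then show ?thesis by (simp only: vec_split)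
  qed
  then show "B = ?b" by (simp add: matrix_eq)
qed

lemma trace_b: "trace (b_endo U W) = 0"
  by (simp add: b_endo_eq trace_ring trace_P trace_R)

subsection \<open>The group\<close>

lemma SO_U_R:
  assumes "h \<in> SO U"
  shows "h ** R = R" "R ** h = R" "h ** P = P ** h"
proof -
  have "h *v (R *v x) = R *v x" for x
    using assms R_in_W[of x] orthogonal_comp_U by (simp add: SO_def)
  then show 1: "h ** R = R" by (simp add: matrix_eq matrix_vector_mul_assoc)
  have "transpose h ** (h ** R) = R"
    using SO_orthogonal[OF assms] by (simp add: matrix_mul_assoc orthogonal_matrix_def)
  then have "transpose h ** R = R" by (simp add: 1)
  then have "transpose (transpose h ** R) = R" by (simp add: R_sym)
  then show 2: "R ** h = R" by (simp add: matrix_transpose_mul R_sym)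
  show "h ** P = P ** h" by (simp add: P_eq matrix_ring 1 2)
qed

lemma SO_U_vec:
  assumes "h \<in> SO U"
  shows "u \<in> U \<Longrightarrow> h *v u \<in> U" "w \<in> W \<Longrightarrow> h *v w = w"
proof -
  show "h *v u \<in> U" if "u \<in> U"
    using SO_U_R(3)[OF assms] that by (metis U_iff matrix_vector_mul_assoc)
  show "h *v w = w" if "w \<in> W"
    using assms that orthogonal_comp_U by (simp add: SO_def)
qed

lemma SO_U_mul: "a \<in> SO U \<Longrightarrow> b \<in> SO U \<Longrightarrow> a ** b \<in> SO U"
  by (auto simp: SO_def rotation_matrix_def orthogonal_matrix_mul det_mul
      simp flip: matrix_vector_mul_assoc)

lemma SO_U_transpose:
  assumes "h \<in> SO U"
  shows "transpose h \<in> SO U"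
proof -
  have "transpose h ** R = R"
    using SO_U_R(2)[OF assms] by (metis R_sym matrix_transpose_mul)
  then have "transpose h *v w = w" if "w \<in> W" for w
    using that by (metis W_iff matrix_vector_mul_assoc)
  then show ?thesis
    using assms by (auto simp: SO_def rotation_matrix_def orthogonal_comp_U
      simp del: transpose_matrix_vector)
qed

lemma SO_commute:
  assumes a: "a \<in> SO U" and b: "b \<in> SO W"
  shows "a ** b = b ** a"
proof -
  interpret swap: orth_split W U R P by (rule orth_split_swap)
  note A = SO_U_R[OF a] and B = swap.SO_U_R[OF b]
  have "a ** b = a ** ((P + R) ** b)" by (simp add: PR_sum)
  also have "\<dots> = a ** (P ** b) + (a ** R) ** b"
    by (simp only: matrix_add_ldistrib matrix_mul_add_left matrix_mul_assoc)
  also have "\<dots> = P ** a + b ** R" by (simp only: A B)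
  also have "\<dots> = (b ** P) ** a + b ** (R ** a)" by (simp only: A B)
  also have "\<dots> = b ** ((P + R) ** a)"
    by (simp only: matrix_add_ldistrib matrix_mul_add_left matrix_mul_assoc)
  finally show ?thesis by (simp add: PR_sum)
qed

lemma SO_subset: "SO U \<subseteq> SOxSO U W" "SO W \<subseteq> SOxSO U W"
proof -
  have "a ** mat 1 \<in> SOxSO U W" if "a \<in> SO U" for a
    unfolding SOxSO_def using that mat_1_in_SO by blast
  moreover have "mat 1 ** a \<in> SOxSO U W" if "a \<in> SO W" for a
    unfolding SOxSO_def using that mat_1_in_SO by blast
  ultimately show "SO U \<subseteq> SOxSO U W" "SO W \<subseteq> SOxSO U W" by auto
qed

lemma SOxSO_swap: "SOxSO W U = SOxSO U W"
proof -
  have "(\<exists>A B. g = A ** B \<and> A \<in> SO W \<and> B \<in> SO U) \<longleftrightarrow> (\<exists>A B. g = A ** B \<and> A \<in> SO U \<and> B \<in> SO W)" for g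
    by (metis SO_commute)
  then show ?thesis by (simp add: SOxSO_def)
qed

lemma H_one: "mat 1 \<in> SOxSO U W"
  using SO_subset mat_1_in_SO by blast

lemma H_mul:
  assumes "g \<in> SOxSO U W" "h \<in> SOxSO U W"
  shows "g ** h \<in> SOxSO U W"
proof -
  interpret swap: orth_split W U R P by (rule orth_split_swap)
  obtain a b c d where g: "g = a ** b" "a \<in> SO U" "b \<in> SO W" and h: "h = c ** d" "c \<in> SO U" "d \<in> SO W"
    using assms by (auto simp: SOxSO_def)
  have "g ** h = a ** (b ** c) ** d" by (simp add: g h matrix_mul_assoc)
  also have "\<dots> = (a ** c) ** (b ** d)"
    by (simp add: SO_commute[OF h(2) g(3), symmetric] matrix_mul_assoc)
  finally show ?thesis
    unfolding SOxSO_def using g h SO_U_mul swap.SO_U_mul by blast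
qed

lemma H_orthogonal: "h \<in> SOxSO U W \<Longrightarrow> orthogonal_matrix h"
  by (auto simp: SOxSO_def SO_orthogonal orthogonal_matrix_mul)

lemma H_transpose:
  assumes "h \<in> SOxSO U W"
  shows "transpose h \<in> SOxSO U W"
proof -
  interpret swap: orth_split W U R P by (rule orth_split_swap)
  obtain a b where h: "h = a ** b" "a \<in> SO U" "b \<in> SO W"
    using assms by (auto simp: SOxSO_def)
  have "transpose h = transpose a ** transpose b"
    unfolding h(1) SO_commute[OF h(2,3)] by (rule matrix_transpose_mul)
  then show ?thesis
    unfolding SOxSO_def using h SO_U_transpose swap.SO_U_transpose by blast
qed

lemma H_det: "h \<in> SOxSO U W \<Longrightarrow> det h = 1"
  by (auto simp: SOxSO_def SO_def rotation_matrix_def det_mul)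

lemma H_P: "h \<in> SOxSO U W \<Longrightarrow> h ** P = P ** h"
proof -
  interpret swap: orth_split W U R P by (rule orth_split_swap)
  assume "h \<in> SOxSO U W"
  then obtain a b where h: "h = a ** b" "a \<in> SO U" "b \<in> SO W"
    by (auto simp: SOxSO_def)
  have "h ** P = a ** (b ** P)" by (simp add: h matrix_mul_assoc)
  also have "\<dots> = a ** P ** b"
    by (simp add: P_eq matrix_ring swap.SO_U_R(3)[OF h(3)])
  finally show ?thesis by (simp add: h SO_U_R(3)[OF h(2)] matrix_mul_assoc)
qed

lemma H_R: "h \<in> SOxSO U W \<Longrightarrow> h ** R = R ** h"
  by (simp add: R_eq matrix_ring H_P)

lemma H_Ad:
  assumes "h \<in> SOxSO U W"
  shows "Ad h (P ** X) = P ** Ad h X" "Ad h (X ** P) = Ad h X ** P"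
    "Ad h (R ** X) = R ** Ad h X" "Ad h (X ** R) = Ad h X ** R"
    "Ad h (transpose X) = transpose (Ad h X)" "trace (Ad h X) = trace X"
    "Ad h P = P" "Ad h R = R"
proof -
  note o = H_orthogonal[OF assms] and t = H_transpose[OF assms]
  show "Ad h (P ** X) = P ** Ad h X" "Ad h (R ** X) = R ** Ad h X"
    using H_P[OF assms] H_R[OF assms] by (simp_all add: Ad_orthogonal[OF o] matrix_mul_assoc)
  show "Ad h (X ** P) = Ad h X ** P" "Ad h (X ** R) = Ad h X ** R"
    using H_P[OF t] H_R[OF t] by (simp_all add: Ad_orthogonal[OF o] flip: matrix_mul_assoc)
  show "Ad h (transpose X) = transpose (Ad h X)"
    by (simp add: Ad_orthogonal[OF o] matrix_transpose_mul matrix_mul_assoc)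
  show "trace (Ad h X) = trace X" using H_det[OF assms] by (simp add: trace_Ad)
  show "Ad h P = P" "Ad h R = R"
    using o by (simp_all add: Ad_orthogonal[OF o] H_P[OF assms] H_R[OF assms] orthogonal_matrix_def
      flip: matrix_mul_assoc)
qed

lemma Ad_b:
  assumes "h \<in> SOxSO U W"
  shows "Ad h (b_endo U W) = b_endo U W"
  unfolding b_endo_eq linear_diff[OF linear_Ad] linear_scale[OF linear_Ad] H_Ad(7,8)[OF assms] ..

lemma Ad_UW:
  assumes "h \<in> SOxSO U W" "X \<in> tensor_space U W"
  shows "Ad h X \<in> tensor_space U W"
proof -
  have "P ** Ad h X ** R = Ad h (P ** X ** R)" unfolding H_Ad[OF assms(1)] ..
  then show ?thesis using assms(2) by (simp add: tensor_space_UW)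
qed

end

lemma linear_transpose: "linear (transpose :: real^'n^'n \<Rightarrow> real^'n^'n)"
  by (rule linearI) (simp_all add: transpose_ring)

lemma subspace_tensor_space: "subspace (tensor_space U W)"
  by (simp add: tensor_space_def)

lemma wedge_space_eq: "wedge_space U W = (\<lambda>Z. Z - transpose Z) ` tensor_space U W"
proof -
  have lin: "linear (\<lambda>Z::real^'n^'n. Z - transpose Z)"
    by (rule linearI) (simp_all add: transpose_ring algebra_simps)
  have "{tensor u w - tensor w u | u w. u \<in> U \<and> w \<in> W} =
    (\<lambda>Z. Z - transpose Z) ` {tensor u w | u w. u \<in> U \<and> w \<in> W}"
    by (force simp: transpose_tensor)
  then show ?thesis
    unfolding wedge_space_def tensor_space_def by (simp only: linear_span_image[OF lin])
qed

lemma vee_space_eq: "vee_space U W = (\<lambda>Z. Z + transpose Z) ` tensor_space U W"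
proof -
  have lin: "linear (\<lambda>Z::real^'n^'n. Z + transpose Z)"
    by (rule linearI) (simp_all add: transpose_ring algebra_simps)
  have "{tensor u w + tensor w u | u w. u \<in> U \<and> w \<in> W} =
    (\<lambda>Z. Z + transpose Z) ` {tensor u w | u w. u \<in> U \<and> w \<in> W}"
    by (force simp: transpose_tensor)
  then show ?thesis
    unfolding vee_space_def tensor_space_def by (simp only: linear_span_image[OF lin])
qed

lemma linear_canonical_iso: "linear (canonical_iso U W)"
  by (rule linearI)
    (auto simp: canonical_iso_def transpose_ring scaleR_add_left scaleR_add_right algebra_simps)

context orth_split
begin

subsection \<open>The isotropy module\<close>

text \<open>The orthogonal projection onto \<open>\<hh>\<close>, the skew part of the two diagonal blocks.\<close>
definition h_part :: "real^'n^'n \<Rightarrow> real^'n^'n" where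
  "h_part X = (1/2) *\<^sub>R (P ** (X - transpose X) ** P + R ** (X - transpose X) ** R)"

lemma linear_h_part: "linear h_part"
  by (rule linearI) (simp_all add: h_part_def matrix_ring transpose_ring algebra_simps)

lemma h_part_so_U:
  assumes "X \<in> so U"
  shows "h_part X = X"
proof -
  have X: "P ** X ** P = X" "transpose X = - X" using assms by (auto simp: so_U)
  show ?thesis
    unfolding h_part_def X(2)
    by (simp add: tensor_vanish_U[OF X(1)] matrix_ring flip: scaleR_2)
qed

lemma so_plus_so_iff: "X \<in> so_plus_so U W \<longleftrightarrow> h_part X = X"
proof
  interpret swap: orth_split W U R P by (rule orth_split_swap)
  have h: "swap.h_part = h_part"
    by (rule ext) (simp add: h_part_def swap.h_part_def add.commute)
  show "h_part X = X" if "X \<in> so_plus_so U W"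
    using that h_part_so_U swap.h_part_so_U
    by (auto simp: so_plus_so_def linear_add[OF linear_h_part] h)
  assume e: "h_part X = X"
  have "(1/2) *\<^sub>R (P ** (X - transpose X) ** P) \<in> so U" for X
    by (simp add: so_U matrix_ring transpose_ring proj algebra_simps)
  moreover have "(1/2) *\<^sub>R (R ** (X - transpose X) ** R) \<in> so W"
    by (simp add: swap.so_U matrix_ring transpose_ring proj algebra_simps)
  moreover have "X = (1/2) *\<^sub>R (P ** (X - transpose X) ** P) + (1/2) *\<^sub>R (R ** (X - transpose X) ** R)"
    using e by (simp add: h_part_def scaleR_add_right)
  ultimately show "X \<in> so_plus_so U W"
    unfolding so_plus_so_def by blast
qed

lemma trace_so_plus_so: "X \<in> so_plus_so U W \<Longrightarrow> trace X = 0"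
proof -
  interpret swap: orth_split W U R P by (rule orth_split_swap)
  have "trace X = 0" if "transpose X = - X" for X :: "real^'n^'n"
    using arg_cong[OF that, of trace] by (simp add: trace_ring)
  then show "X \<in> so_plus_so U W \<Longrightarrow> trace X = 0"
    by (auto simp: so_plus_so_def so_U swap.so_U trace_ring)
qed

lemma h_part_in: "h_part X \<in> so_plus_so U W"
  unfolding so_plus_so_iff
  by (simp add: h_part_def matrix_ring transpose_ring proj algebra_simps)

lemma subspace_model_space: "subspace (model_space U W)"
proof -
  interpret swap: orth_split W U R P by (rule orth_split_swap)
  show ?thesis
    unfolding model_space_def subspace_def
    by (auto simp: tensor_space_UW S20_U swap.S20_U matrix_ring transpose_ring trace_ring zero_prod_def)
qed

lemma transpose_vanish:
  assumes "P ** X ** R = X"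
  shows "P ** transpose X = 0" "transpose X ** R = 0" "R ** transpose X = transpose X"
    "transpose X ** P = transpose X"
proof -
  note v = tensor_vanish[OF assms]
  have "transpose (X ** P) = 0" "transpose (R ** X) = 0" "transpose (X ** R) = transpose X"
    "transpose (P ** X) = transpose X"
    using v by (simp_all add: transpose_zero)
  then show "P ** transpose X = 0" "transpose X ** R = 0" "R ** transpose X = transpose X"
    "transpose X ** P = transpose X"
    by (simp_all add: matrix_transpose_mul proj)
qed

lemma canonical_components:
  assumes "(t, Z, S, T) \<in> model_space U W"
  defines "X \<equiv> canonical_iso U W (t, Z, S, T)"
  shows "P ** X ** R = Z$1 + Z$2" "R ** X ** P = transpose (Z$2) - transpose (Z$1)"
    "P ** X ** P = (t * real (dim W)) *\<^sub>R P + S" "R ** X ** R = T - (t * real (dim U)) *\<^sub>R R"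
proof -
  interpret swap: orth_split W U R P by (rule orth_split_swap)
  have Z: "P ** Z$i ** R = Z$i" for i using assms(1) by (simp add: model_space_def tensor_space_UW)
  have S: "P ** S ** P = S" and T: "R ** T ** R = T"
    using assms(1) by (simp_all add: model_space_def S20_U swap.S20_U)
  note v = tensor_vanish[OF Z] transpose_vanish[OF Z] tensor_vanish_U[OF S]
    swap.tensor_vanish_U[OF T] proj
  show "P ** X ** R = Z$1 + Z$2" "R ** X ** P = transpose (Z$2) - transpose (Z$1)"
    "P ** X ** P = (t * real (dim W)) *\<^sub>R P + S" "R ** X ** R = T - (t * real (dim U)) *\<^sub>R R"
    by (simp_all add: X_def canonical_iso_def b_endo_eq matrix_ring v algebra_simps)
qed

lemma trace_S20: "X \<in> S20 U \<Longrightarrow> trace X = 0"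
  by (simp add: S20_def)

lemma trace_canonical: "z \<in> model_space U W \<Longrightarrow> trace (canonical_iso U W z) = 0"
proof -
  have "trace X = 0" if "P ** X ** R = X" for X
    using trace_mul_sym[of P X] by (simp add: tensor_vanish[OF that] trace_zero)
  then show "z \<in> model_space U W \<Longrightarrow> trace (canonical_iso U W z) = 0"
    by (cases z) (auto simp: canonical_iso_def model_space_def trace_ring trace_b S20_def
      tensor_space_UW)
qed

text \<open>Sandwiching with \<open>P\<close> and \<open>R\<close> isolates the components, and the diagonal blocks vanish because they are
  both symmetric and skew. Besides injectivity this gives \<open>\<mm> \<inter> \<hh> = 0\<close>.\<close>
lemma canonical_kernel:
  assumes z: "z \<in> model_space U W" and h: "canonical_iso U W z \<in> so_plus_so U W"
  shows "z = 0"
proof -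
  interpret swap: orth_split W U R P by (rule orth_split_swap)
  obtain t Z S T where zz: "z = (t, Z, S, T)" by (metis prod.exhaust)
  let ?X = "canonical_iso U W z"
  have X: "h_part ?X = ?X" using h by (simp add: so_plus_so_iff)
  note c = canonical_components[OF z[unfolded zz], folded zz]
  have "P ** h_part Y ** R = 0" "R ** h_part Y ** P = 0" for Y
    by (simp_all add: h_part_def matrix_ring proj)
  from this[of ?X] have "P ** ?X ** R = 0" "R ** ?X ** P = 0" unfolding X .
  then have "Z$1 + Z$2 = 0" "transpose (Z$2 - Z$1) = transpose 0"
    using c by (simp_all add: transpose_ring)
  then have "Z$1 + Z$2 = 0" "Z$2 - Z$1 = 0" by (simp_all only: transpose_iff)
  moreover have "2 *\<^sub>R Z$1 = (Z$1 + Z$2) - (Z$2 - Z$1)" "2 *\<^sub>R Z$2 = (Z$1 + Z$2) + (Z$2 - Z$1)"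
    by (simp_all add: scaleR_2)
  ultimately have "2 *\<^sub>R Z$1 = 0" "2 *\<^sub>R Z$2 = 0" by simp_all
  then have "Z$1 = 0" "Z$2 = 0" by simp_all
  then have Z: "Z = 0" by (simp add: vec_eq_iff forall_2)
  have m: "S \<in> S20 U" "T \<in> S20 W" using z by (auto simp: zz model_space_def)
  have skew: "transpose (P ** h_part Y ** P) = - (P ** h_part Y ** P)"
    "transpose (R ** h_part Y ** R) = - (R ** h_part Y ** R)" for Y
    by (simp_all add: h_part_def matrix_ring transpose_ring proj algebra_simps)
  have zero: "Y = 0" if "transpose Y = Y" "transpose Y = - Y" for Y :: "real^'n^'n"
  proof -
    have "Y + Y = 0" by (metis that add.right_inverse)
    then show ?thesis by (simp flip: scaleR_2)
  qed
  have sym: "transpose S = S" "transpose T = T" using m by (simp_all add: S20_def)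
  have a: "(t * real (dim W)) *\<^sub>R P + S = 0"
  proof (rule zero)
    show "transpose ((t * real (dim W)) *\<^sub>R P + S) = - ((t * real (dim W)) *\<^sub>R P + S)"
      using skew(1)[of ?X] unfolding X c(3) .
  qed (simp add: transpose_ring P_sym sym)
  have b: "T - (t * real (dim U)) *\<^sub>R R = 0"
  proof (rule zero)
    show "transpose (T - (t * real (dim U)) *\<^sub>R R) = - (T - (t * real (dim U)) *\<^sub>R R)"
      using skew(2)[of ?X] unfolding X c(4) .
  qed (simp add: transpose_ring R_sym sym)
  have "trace ((t * real (dim W)) *\<^sub>R P + S) = 0" unfolding a by (rule trace_zero)
  then have "t * real (dim W) * real (dim U) = 0"
    using m by (simp add: trace_ring trace_P trace_S20)
  moreover have "real (dim W) > 0" "real (dim U) > 0" using dim_U dim_W by linarith+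
  ultimately have "t = 0" unfolding mult_eq_0_iff by linarith
  then show ?thesis using a b Z by (simp add: zz zero_prod_def)
qed

lemma inj_canonical: "inj_on (canonical_iso U W) (model_space U W)"
proof (rule inj_onI)
  fix x y assume xy: "x \<in> model_space U W" "y \<in> model_space U W" "canonical_iso U W x = canonical_iso U W y"
  have "canonical_iso U W (x - y) = 0" using xy(3) by (simp add: linear_diff[OF linear_canonical_iso])
  moreover have "0 \<in> so_plus_so U W" by (simp add: so_plus_so_iff linear_0[OF linear_h_part])
  ultimately have "x - y = 0"
    using xy subspace_model_space by (intro canonical_kernel) (auto intro: subspace_diff)
  then show "x = y" by simp
qed

lemma canonical_onto: "canonical_iso U W ` model_space U W = m_space U W"
proof
  show "canonical_iso U W ` model_space U W \<subseteq> m_space U W"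
  proof clarify
    fix t and Z :: "(real^'n^'n)^2" and S T
    assume "(t, Z, S, T) \<in> model_space U W"
    then show "canonical_iso U W (t, Z, S, T) \<in> m_space U W"
      unfolding m_space_def wedge_space_eq vee_space_eq canonical_iso_def model_space_def
      by (intro CollectI exI[of _ t] exI[of _ "Z$1 - transpose (Z$1)"] exI[of _ "Z$2 + transpose (Z$2)"]
          exI[of _ S] exI[of _ T]) (auto simp: algebra_simps)
  qed
  show "m_space U W \<subseteq> canonical_iso U W ` model_space U W"
  proof
    fix X assume "X \<in> m_space U W"
    then obtain t Z1 Z2 S T where X: "X = t *\<^sub>R b_endo U W + (Z1 - transpose Z1) + S + T + (Z2 + transpose Z2)"
      "Z1 \<in> tensor_space U W" "Z2 \<in> tensor_space U W" "S \<in> S20 U" "T \<in> S20 W"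
      unfolding m_space_def wedge_space_eq vee_space_eq by blast
    define Z :: "(real^'n^'n)^2" where "Z = (\<chi> i. if i = 1 then Z1 else Z2)"
    have "X = canonical_iso U W (t, Z, S, T)" using X(1) by (simp add: canonical_iso_def Z_def)
    moreover have "(t, Z, S, T) \<in> model_space U W" using X by (simp add: model_space_def Z_def)
    ultimately show "X \<in> canonical_iso U W ` model_space U W" by blast
  qed
qed

text \<open>The summand \<open>\<real> b\<close> absorbs the traces of the two symmetric diagonal blocks, which are opposite
  to each other.\<close>
lemma sl_decomposition:
  assumes "trace X = 0"
  obtains z where "z \<in> model_space U W" "X = h_part X + canonical_iso U W z"
proof -
  interpret swap: orth_split W U R P by (rule orth_split_swap)
  define p q where "p = real (dim U)" and "q = real (dim W)"
  have pq: "p > 0" "q > 0" using dim_U dim_W by (auto simp: p_def q_def)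
  define s where "s = trace (P ** X)"
  have s': "trace (R ** X) = - s"
    using assms by (simp add: R_eq matrix_ring trace_ring s_def)
  have sT: "trace (P ** transpose X) = s" "trace (R ** transpose X) = - s"
    unfolding s'[symmetric] s_def
    using trace_transpose[of "X ** P"] trace_transpose[of "X ** R"] trace_mul_sym[of X P] trace_mul_sym[of X R]
      s'[unfolded s_def]
    by (simp_all add: matrix_transpose_mul P_sym R_sym)
  have cyc: "trace (P ** (Y ** P)) = trace (P ** Y)" "trace (R ** (Y ** R)) = trace (R ** Y)" for Y
    using trace_mul_sym[of "P ** Y" P] trace_mul_sym[of "R ** Y" R] 
    by (simp_all add: matrix_ring proj)
  define S where "S = (1/2) *\<^sub>R (P ** (X + transpose X) ** P) - (s / p) *\<^sub>R P"
  define T where "T = (1/2) *\<^sub>R (R ** (X + transpose X) ** R) + (s / q) *\<^sub>R R"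
  define Z :: "(real^'n^'n)^2" where
    "Z = (\<chi> i. if i = 1 then (1/2) *\<^sub>R (P ** (X - transpose X) ** R)
       else (1/2) *\<^sub>R (P ** (X + transpose X) ** R))"
  have "S \<in> S20 U"
    using pq by (simp add: S20_U S_def matrix_ring transpose_ring trace_ring proj cyc trace_P sT
        flip: p_def s_def)
  moreover have "T \<in> S20 W"
    using pq by (simp add: swap.S20_U T_def matrix_ring transpose_ring trace_ring proj cyc trace_R sT s'
        flip: q_def)
  moreover have "Z $ i \<in> tensor_space U W" for i
    by (simp add: Z_def tensor_space_UW matrix_ring proj)
  ultimately have z: "(s / (p * q), Z, S, T) \<in> model_space U W" by (simp add: model_space_def)
  have "X = (P + R) ** X ** (P + R)" by (simp add: PR_sum)
  also have "\<dots> = P ** X ** P + R ** X ** R + P ** X ** R + R ** X ** P"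
    by (simp add: matrix_ring)
  also have "\<dots> = h_part X + canonical_iso U W (s / (p * q), Z, S, T)"
  proof -
    have 1: "(s / (p * q)) *\<^sub>R b_endo U W = (s / p) *\<^sub>R P - (s / q) *\<^sub>R R"
      using pq by (simp add: b_endo_eq scaleR_diff_right flip: p_def q_def)
    show ?thesis
      unfolding canonical_iso_def prod.case 1 h_part_def S_def T_def Z_def
      by (simp add: matrix_ring transpose_ring proj scaleR_add_right scaleR_diff_right)
  qed
  finally show ?thesis using z that by blast
qed

lemma canonical_equivariant:
  assumes "h \<in> SOxSO U W"
  shows "canonical_iso U W (model_action h z) = Ad h (canonical_iso U W z)"
proof -
  obtain t Z S T where z: "z = (t, Z, S, T)" by (metis prod.exhaust)
  show ?thesis
    unfolding z model_action_def canonical_iso_def prod.case linear_add[OF linear_Ad] linear_diff[OF linear_Ad]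
      linear_scale[OF linear_Ad] Ad_b[OF assms] H_Ad(5)[OF assms] by simp
qed

end

section \<open>The index of a form\<close>

text \<open>A subspace of dimension at least 2 meets the kernel of \<open>f\<close>, so it is not negative definite.\<close>
lemma form_index_eq_1I:
  fixes \<beta> :: "'a::euclidean_space \<Rightarrow> 'a \<Rightarrow> real"
  assumes E: "subspace E" and \<beta>: "symmetric_form_on E \<beta>" and v: "v \<in> E" "\<beta> v v < 0"
    and f: "linear (f :: 'a \<Rightarrow> real)" and nonneg: "\<And>x. x \<in> E \<Longrightarrow> f x = 0 \<Longrightarrow> \<beta> x x \<ge> 0"
  shows "form_index E \<beta> = 1"
proof -
  let ?S = "{dim N | N. subspace N \<and> N \<subseteq> E \<and> (\<forall>x\<in>N. x \<noteq> 0 \<longrightarrow> \<beta> x x < 0)}"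
  have le: "d \<le> 1" if "d \<in> ?S" for d
  proof (rule ccontr)
    assume "\<not> d \<le> 1"
    with that obtain N where N: "subspace N" "N \<subseteq> E" "\<And>x. x \<in> N \<Longrightarrow> x \<noteq> 0 \<Longrightarrow> \<beta> x x < 0" "dim N > 1"
      by auto
    obtain y where y: "y \<in> N" "y \<noteq> 0" using N(4) by (metis dim_eq_0 not_one_less_zero singletonI subsetI)
    have "\<not> N \<subseteq> span {y}"
    proof
      assume "N \<subseteq> span {y}"
      then have "dim N \<le> dim (span {y})" by (rule dim_subset)
      also have "\<dots> \<le> 1" using dim_le_card'[of "{y}"] by simp
      finally show False using N(4) by simp
    qed
    then obtain z where z: "z \<in> N" "z \<notin> span {y}" by blast
    show False
    proof (cases "f y = 0")
      case True
      have "y \<in> E" using N(2) y(1) by blast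
      then show False using N(3)[OF y] nonneg[OF _ True] by linarith
    next
      case False
      define x where "x = z - (f z / f y) *\<^sub>R y"
      have xN: "x \<in> N" using y z N(1) by (simp add: x_def subspace_diff subspace_scale)
      have "(f z / f y) *\<^sub>R y \<in> span {y}" by (simp add: span_base span_scale)
      then have "x \<noteq> 0" using z(2) by (metis x_def right_minus_eq)
      have "f x = 0" using False by (simp add: x_def linear_diff[OF f] linear_scale[OF f])
      moreover have "x \<in> E" using N(2) xN by blast
      ultimately show False using N(3)[OF xN \<open>x \<noteq> 0\<close>] nonneg[of x] by linarith
    qed
  qed
  have "1 \<in> ?S"
  proof -
    have scale: "\<beta> (c *\<^sub>R x) y = c * \<beta> x y" and sym: "\<beta> x y = \<beta> y x" if "x \<in> E" "y \<in> E" for c x y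
      using \<beta> that unfolding symmetric_form_on_def by blast+
    have "\<beta> (c *\<^sub>R v) (c *\<^sub>R v) < 0" if "c \<noteq> 0" for c
    proof -
      have cv: "c *\<^sub>R v \<in> E" using v(1) E by (simp add: subspace_scale)
      have "\<beta> (c *\<^sub>R v) (c *\<^sub>R v) = c * (c * \<beta> v v)"
        using scale[OF v(1) cv, of c] sym[OF v(1) cv] scale[OF v(1) v(1), of c] by simp
      also have "\<dots> = (c * c) * \<beta> v v" by simp
      also have "\<dots> < 0" using that v(2) not_real_square_gt_zero[of c] by (intro mult_pos_neg) blast+
      finally show ?thesis .
    qed
    then have "\<forall>x\<in>span {v}. x \<noteq> 0 \<longrightarrow> \<beta> x x < 0" by (auto simp: span_singleton)
    moreover have "span {v} \<subseteq> E" using v(1) E by (simp add: span_minimal)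
    moreover have "v \<noteq> 0"
    proof
      assume "v = 0"
      then show False using scale[OF v(1) v(1), of 0] v(2) by simp
    qed
    then have "dim (span {v}) = 1" by (simp add: dim_eq_card_independent)
    ultimately show ?thesis
      by (intro CollectI exI[of _ "span {v}"]) simp
  qed
  moreover have "?S \<subseteq> {..1}" using le by blast
  then have "finite ?S" by (rule finite_subset) simp
  ultimately show ?thesis
    unfolding form_index_def by (intro Max_eqI le)
qed

lemma negative_vector_exists:
  fixes \<beta> :: "'a::euclidean_space \<Rightarrow> 'a \<Rightarrow> real"
  assumes E: "subspace E" and index: "form_index E \<beta> = 1"
  obtains x where "x \<in> E" "\<beta> x x < 0"
proof -
  let ?S = "{dim N | N. subspace N \<and> N \<subseteq> E \<and> (\<forall>x\<in>N. x \<noteq> 0 \<longrightarrow> \<beta> x x < 0)}"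
  have fin: "finite ?S"
    by (rule finite_subset[of _ "{..DIM('a)}"]) (auto simp: dim_subset_UNIV)
  have "dim {0::'a} \<in> ?S"
    using subspace_0[OF E] by (intro CollectI exI[of _ "{0}"]) (simp add: subspace_def)
  then have "Max ?S \<in> ?S" using fin by (intro Max_in) blast+
  then have "1 \<in> ?S" using index by (simp only: form_index_def)
  then obtain N where N: "1 = dim N" "N \<subseteq> E" "\<forall>x\<in>N. x \<noteq> 0 \<longrightarrow> \<beta> x x < 0" by blast
  have "\<not> N \<subseteq> {0}" using N(1) by (metis dim_eq_0 zero_neq_one)
  then show ?thesis using N(2,3) that by blast
qed

text \<open>Two orthogonal negative vectors span a negative definite plane.\<close>
lemma no_two_negative_vectors:
  fixes \<beta> :: "'a::euclidean_space \<Rightarrow> 'a \<Rightarrow> real"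
  assumes E: "subspace E" and \<beta>: "symmetric_form_on E \<beta>" and index: "form_index E \<beta> = 1"
    and x: "x \<in> E" "\<beta> x x < 0" and y: "y \<in> E" "\<beta> y y < 0" and xy: "\<beta> x y = 0"
  shows False
proof -
  let ?S = "{dim N | N. subspace N \<and> N \<subseteq> E \<and> (\<forall>x\<in>N. x \<noteq> 0 \<longrightarrow> \<beta> x x < 0)}"
  have fin: "finite ?S"
    by (rule finite_subset[of _ "{..DIM('a)}"]) (auto simp: dim_subset_UNIV)
  have sym: "\<beta> u v = \<beta> v u" and add: "\<beta> (u + w) v = \<beta> u v + \<beta> w v" and scale: "\<beta> (c *\<^sub>R u) v = c * \<beta> u v"
    if "u \<in> E" "v \<in> E" "w \<in> E" for u v w c
    using \<beta> that unfolding symmetric_form_on_def by blast+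
  have x0: "x \<noteq> 0" and y0: "y \<noteq> 0"
    using scale[OF x(1) x(1) x(1), of 0] scale[OF y(1) y(1) y(1), of 0] x(2) y(2) by auto
  have yx: "y \<notin> span {x}"
  proof
    assume "y \<in> span {x}"
    then obtain k where k: "y = k *\<^sub>R x" by (auto simp: span_singleton)
    have "0 = \<beta> y x" using sym[OF x(1) y(1) x(1)] xy by simp
    also have "\<dots> = k * \<beta> x x" unfolding k by (rule scale[OF x(1) x(1) x(1)])
    finally show False using x(2) y0 k by simp
  qed
  have "dim (span {y, x}) = 2"
    using yx x0 by (simp add: dim_insert)
  moreover have "\<beta> z z < 0" if z: "z \<in> span {y, x}" "z \<noteq> 0" for z
  proof -
    obtain a c where zz: "z = a *\<^sub>R y + c *\<^sub>R x"
    proof -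
      obtain a where "z - a *\<^sub>R y \<in> span {x}" using z(1) span_breakdown_eq by metis
      then obtain c where "z - a *\<^sub>R y = c *\<^sub>R x" by (auto simp: span_singleton)
      then have "z = a *\<^sub>R y + c *\<^sub>R x" by (simp add: algebra_simps)
      then show ?thesis using that by blast
    qed
    have E': "a *\<^sub>R y \<in> E" "c *\<^sub>R x \<in> E" "z \<in> E" using x(1) y(1) E by (auto simp: zz subspace_add subspace_scale)
    have "\<beta> z z = a * \<beta> z y + c * \<beta> z x"
    proof -
      have "\<beta> z z = \<beta> (a *\<^sub>R y) z + \<beta> (c *\<^sub>R x) z"
        using add[OF E'(1) E'(3) E'(2)] zz by simp
      then show ?thesis
        using scale[OF y(1) E'(3) x(1), of a] scale[OF x(1) E'(3) x(1), of c]
          sym[OF y(1) E'(3) x(1)] sym[OF x(1) E'(3) x(1)] by simp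
    qed
    moreover have "\<beta> z y = a * \<beta> y y"
      using add[OF E'(1) y(1) E'(2)] scale[OF y(1) y(1) y(1), of a] scale[OF x(1) y(1) y(1), of c] xy
      by (simp add: zz)
    moreover have "\<beta> z x = c * \<beta> x x"
      using add[OF E'(1) x(1) E'(2)] scale[OF y(1) x(1) y(1), of a] scale[OF x(1) x(1) y(1), of c]
        xy sym[OF x(1) y(1) x(1)]
      by (simp add: zz)
    ultimately have e: "\<beta> z z = (a * a) * \<beta> y y + (c * c) * \<beta> x x" by simp
    have "a \<noteq> 0 \<or> c \<noteq> 0" using z(2) zz by auto
    then have "0 < a * a \<or> 0 < c * c" using not_real_square_gt_zero by blast
    moreover have "0 \<le> a * a" "0 \<le> c * c" by simp_all
    ultimately have "(a * a) * \<beta> y y < 0 \<or> (c * c) * \<beta> x x < 0" "(a * a) * \<beta> y y \<le> 0" "(c * c) * \<beta> x x \<le> 0"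
      using x(2) y(2) by (auto simp: mult_less_0_iff mult_le_0_iff)
    then show ?thesis using e by linarith
  qed
  moreover have "span {y, x} \<subseteq> E" using x(1) y(1) E by (simp add: span_minimal)
  ultimately have "2 \<in> ?S" by (intro CollectI exI[of _ "span {y, x}"]) simp
  then have "2 \<le> Max ?S" using fin by (rule Max_ge[rotated])
  then show False using index by (simp add: form_index_def)
qed

section \<open>Polynomial functions are smooth\<close>

lemma real_polynomial_function_derivative:
  fixes f :: "'a::euclidean_space \<Rightarrow> real"
  assumes "real_polynomial_function f"
  shows "\<exists>f'. (\<forall>x. (f has_derivative f' x) (at x)) \<and> (\<forall>v. real_polynomial_function (\<lambda>x. f' x v))"
  using assms
proof (induction rule: real_polynomial_function.induct)
  case (linear f)
  then show ?case
    by (intro exI[of _ "\<lambda>x. f"]) (auto intro: bounded_linear_imp_has_derivative)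
next
  case (const c)
  show ?case by (intro exI[of _ "\<lambda>x v. 0"]) auto
next
  case (add f g)
  then obtain f' g' where "\<forall>x. (f has_derivative f' x) (at x)" "\<forall>v. real_polynomial_function (\<lambda>x. f' x v)"
    "\<forall>x. (g has_derivative g' x) (at x)" "\<forall>v. real_polynomial_function (\<lambda>x. g' x v)" by blast
  then show ?case
    by (intro exI[of _ "\<lambda>x v. f' x v + g' x v"]) (auto intro: has_derivative_add)
next
  case (mult f g)
  then obtain f' g' where "\<forall>x. (f has_derivative f' x) (at x)" "\<forall>v. real_polynomial_function (\<lambda>x. f' x v)"
    "\<forall>x. (g has_derivative g' x) (at x)" "\<forall>v. real_polynomial_function (\<lambda>x. g' x v)" by blast
  note d = this
  have "((\<lambda>x. f x * g x) has_derivative (\<lambda>v. f x * g' x v + f' x v * g x)) (at x)" for x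
    by (rule has_derivative_mult) (use d in blast)+
  moreover have "real_polynomial_function (\<lambda>x. f x * g' x v + f' x v * g x)" for v
    by (intro real_polynomial_function.intros(3,4) mult.hyps d[rule_format])
  ultimately show ?case by (intro exI[of _ "\<lambda>x v. f x * g' x v + f' x v * g x"]) simp
qed

lemma Ck_on_real_polynomial_function:
  fixes f :: "'a::euclidean_space \<Rightarrow> real"
  shows "real_polynomial_function f \<Longrightarrow> Ck_on k S f"
proof (induction k arbitrary: f)
  case 0
  then show ?case by (auto intro: continuous_at_imp_continuous_on continuous_real_polymonial_function)
next
  case (Suc k)
  from real_polynomial_function_derivative[OF Suc.prems]
  obtain f' where "\<forall>x. (f has_derivative f' x) (at x)" "\<forall>v. real_polynomial_function (\<lambda>x. f' x v)" by blast
  then show ?case using Suc.IH by (auto intro!: exI[of _ f'])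
qed

lemma smooth_on_polynomial:
  assumes "real_polynomial_function F" "\<And>x. x \<in> M \<Longrightarrow> f x = F x"
  shows "smooth_on M f"
  unfolding smooth_on_def using assms Ck_on_real_polynomial_function
  by (auto intro!: exI[of _ UNIV] exI[of _ F])

definition matrix_polynomial :: "(real^'n^'n \<Rightarrow> real^'n^'n) \<Rightarrow> bool" where
  "matrix_polynomial F \<longleftrightarrow> (\<forall>i j. real_polynomial_function (\<lambda>a. F a $ i $ j))"

lemma real_polynomial_function_prod:
  "finite I \<Longrightarrow> (\<And>i. i \<in> I \<Longrightarrow> real_polynomial_function (\<lambda>x. f x i)) \<Longrightarrow>
    real_polynomial_function (\<lambda>x. prod (f x) I)"
  by (induction I rule: finite_induct) auto

lemma real_polynomial_function_entry: "real_polynomial_function (\<lambda>a::real^'n^'n. a $ i $ j)"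
  by (intro real_polynomial_function.intros(1) bounded_linear_compose[OF bounded_linear_vec_nth]
      bounded_linear_vec_nth)

lemma matrix_polynomial_const: "matrix_polynomial (\<lambda>a. X)"
  by (auto simp: matrix_polynomial_def)

lemma matrix_polynomial_id: "matrix_polynomial (\<lambda>a. a)"
  by (simp add: matrix_polynomial_def real_polynomial_function_entry)

lemma matrix_polynomial_mul:
  "matrix_polynomial F \<Longrightarrow> matrix_polynomial G \<Longrightarrow> matrix_polynomial (\<lambda>a. F a ** G a)"
  by (auto simp: matrix_polynomial_def matrix_matrix_mult_def intro!: real_polynomial_function_sum)

lemma matrix_polynomial_add:
  "matrix_polynomial F \<Longrightarrow> matrix_polynomial G \<Longrightarrow> matrix_polynomial (\<lambda>a. F a + G a)"
  by (auto simp: matrix_polynomial_def)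

lemma matrix_polynomial_diff:
  "matrix_polynomial F \<Longrightarrow> matrix_polynomial G \<Longrightarrow> matrix_polynomial (\<lambda>a. F a - G a)"
  by (auto simp: matrix_polynomial_def)

lemma matrix_polynomial_scaleR:
  "matrix_polynomial F \<Longrightarrow> matrix_polynomial (\<lambda>a. c *\<^sub>R F a)"
  by (auto simp: matrix_polynomial_def)

lemma matrix_polynomial_transpose:
  "matrix_polynomial F \<Longrightarrow> matrix_polynomial (\<lambda>a. transpose (F a))"
  by (auto simp: matrix_polynomial_def transpose_def)

lemma real_polynomial_function_matrix_inner:
  "matrix_polynomial F \<Longrightarrow> matrix_polynomial G \<Longrightarrow> real_polynomial_function (\<lambda>a. F a \<bullet> G a)"
  by (auto simp: matrix_polynomial_def inner_vec_def intro!: real_polynomial_function_sum)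

text \<open>The columns of the inverse, as determined by Cramer's rule, without the division by the determinant.\<close>
definition adjugate :: "real^'n^'n \<Rightarrow> real^'n^'n" where
  "adjugate a = (\<chi> k l. det (\<chi> i j. if j = k then axis l 1 $ i else a $ i $ j))"

lemma matrix_polynomial_adjugate: "matrix_polynomial adjugate"
proof -
  have e: "real_polynomial_function (\<lambda>a. if c then x else (a::real^'n^'n) $ i $ j)" for c x i j
    by (cases c) (auto intro: real_polynomial_function_entry)
  show ?thesis
    unfolding matrix_polynomial_def adjugate_def det_def vec_lambda_beta
    by (intro allI real_polynomial_function_sum real_polynomial_function_prod e
        real_polynomial_function.intros(4) real_polynomial_function.intros(2) finite_permutations finite)
qed

text \<open>On \<open>SL(V)\<close> Cramer's rule makes the inverse a polynomial in the entries.\<close>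
lemma matrix_inv_eq_adjugate:
  assumes "det a = 1"
  shows "matrix_inv a = adjugate a"
proof -
  have "matrix_inv a $ k $ l = adjugate a $ k $ l" for k l
  proof -
    have "a *v (matrix_inv a *v axis l 1) = axis l 1"
      using assms by (simp add: matrix_vector_mul_assoc matrix_inv_mul)
    then have "matrix_inv a *v axis l 1 =
      (\<chi> k. det (\<chi> i j. if j = k then axis l 1 $ i else a $ i $ j) / det a)"
      using assms by (subst (asm) cramer) auto
    then have "(matrix_inv a *v axis l 1) $ k = adjugate a $ k $ l"
      using assms by (simp add: adjugate_def)
    then show ?thesis by (simp add: matrix_vector_mul_component inner_axis)
  qed
  then show ?thesis by (simp add: vec_eq_iff)
qed

context orth_split
begin

section \<open>An invariant Lorentzian metric\<close>

lemma inner_h_part: "h_part X \<bullet> Y = X \<bullet> h_part Y"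
proof -
  define M where "M = P ** Y ** P + R ** Y ** R"
  have sandwich: "(A ** B ** A) \<bullet> Y = B \<bullet> (A ** Y ** A)" if "transpose A = A" for A B
    unfolding inner_matrix_mul_right[of "A ** B"] inner_matrix_mul_left[of A B] that
    by (simp add: matrix_mul_assoc)
  have "h_part X \<bullet> Y = (1/2) * ((X - transpose X) \<bullet> M)"
    unfolding h_part_def M_def inner_scaleR_left inner_add_left inner_add_right
      sandwich[OF P_sym] sandwich[OF R_sym] ..
  also have "\<dots> = (1/2) * (X \<bullet> (M - transpose M))"
    using inner_transpose[of X "transpose M"] by (simp add: inner_diff_left inner_diff_right)
  also have "\<dots> = X \<bullet> h_part Y"
    by (simp add: h_part_def M_def transpose_ring matrix_ring proj algebra_simps)
  finally show ?thesis .
qed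

lemma h_part_idem: "h_part (h_part X) = h_part X"
  using h_part_in so_plus_so_iff by blast

lemma h_part_b: "h_part (b_endo U W) = 0"
  by (simp add: h_part_def b_endo_eq transpose_ring proj matrix_ring)

lemma b_nonzero: "b_endo U W \<bullet> b_endo U W > 0"
proof -
  have "b_endo U W \<noteq> 0"
  proof
    assume z: "b_endo U W = 0"
    have "trace (P ** b_endo U W) = real (dim W) * real (dim U)"
      by (simp add: b_endo_eq matrix_ring proj trace_ring trace_P)
    moreover have "P ** b_endo U W = 0" by (simp add: z)
    moreover have "real (dim W) * real (dim U) > 0" using dim_U dim_W by (intro mult_pos_pos) linarith+
    ultimately show False by (simp only: trace_zero)
  qed
  then show ?thesis by simp
qed

lemma h_part_Ad:
  assumes "h \<in> SOxSO U W"
  shows "h_part (Ad h X) = Ad h (h_part X)"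
  unfolding h_part_def linear_scale[OF linear_Ad] linear_add[OF linear_Ad] H_Ad(1-4)[OF assms]
    linear_diff[OF linear_Ad] H_Ad(5)[OF assms] ..

text \<open>The Euclidean product of matrices, projected along \<open>\<hh>\<close> and with the sign changed on \<open>b\<close>.\<close>
definition base_form :: "real^'n^'n \<Rightarrow> real^'n^'n \<Rightarrow> real" where
  "base_form X Y = X \<bullet> Y - h_part X \<bullet> h_part Y
     - 2 * (b_endo U W \<bullet> X) * (b_endo U W \<bullet> Y) / (b_endo U W \<bullet> b_endo U W)"

lemma base_form_inner:
  "base_form X Y = (X - h_part X - (2 * (b_endo U W \<bullet> X) / (b_endo U W \<bullet> b_endo U W)) *\<^sub>R b_endo U W) \<bullet> Y"
  using inner_h_part[of X "h_part Y"] inner_h_part[of "h_part X" Y]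
  by (simp add: base_form_def inner_diff_left h_part_idem)

lemma base_form_sym: "base_form X Y = base_form Y X"
  by (simp add: base_form_def inner_commute)

lemma linear_base_form: "linear (base_form X)"
  by (rule linearI) (simp_all add: base_form_inner inner_add_right)

lemma base_form_Ad:
  assumes "h \<in> SOxSO U W"
  shows "base_form (Ad h X) (Ad h Y) = base_form X Y"
proof -
  have "b_endo U W \<bullet> Ad h Z = b_endo U W \<bullet> Z" for Z
    using inner_Ad[OF H_orthogonal[OF assms], of "b_endo U W" Z] by (simp add: Ad_b[OF assms])
  then show ?thesis
    by (simp add: base_form_def h_part_Ad[OF assms] inner_Ad[OF H_orthogonal[OF assms]])
qed

text \<open>The form pairs \<open>X\<close> with the projection of \<open>X\<close> along \<open>\<hh>\<close>, up to the sign of its component along \<open>b\<close>. This is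
  a traceless matrix, so testing \<open>X\<close> against it shows that it vanishes.\<close>
lemma base_form_radical:
  assumes "trace X = 0"
  shows "(\<forall>Y\<in>sl. base_form X Y = 0) \<longleftrightarrow> X \<in> so_plus_so U W"
proof
  let ?b = "b_endo U W"
  have bh: "?b \<bullet> h_part X = 0" using inner_h_part[of ?b X] by (simp add: h_part_b)
  define V where "V = X - h_part X - (2 * (?b \<bullet> X) / (?b \<bullet> ?b)) *\<^sub>R ?b"
  assume "\<forall>Y\<in>sl. base_form X Y = 0"
  moreover have "V \<in> sl"
    using assms trace_so_plus_so[OF h_part_in] by (simp add: V_def sl_def trace_ring trace_b)
  ultimately have "V \<bullet> V = 0" by (simp add: base_form_inner V_def)
  then have V: "V = 0" by simp
  then have "?b \<bullet> V = 0" by simp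
  then have "?b \<bullet> X = 0" using b_nonzero by (simp add: V_def inner_diff_right bh)
  then have "h_part X = X" using V by (simp add: V_def)
  then show "X \<in> so_plus_so U W" by (simp add: so_plus_so_iff)
next
  assume "X \<in> so_plus_so U W"
  then have X: "h_part X = X" by (simp add: so_plus_so_iff)
  have "b_endo U W \<bullet> X = 0" using inner_h_part[of "b_endo U W" X] by (simp add: h_part_b X)
  then show "\<forall>Y\<in>sl. base_form X Y = 0" by (simp add: base_form_inner X)
qed

lemma base_form_nonneg:
  assumes "b_endo U W \<bullet> X = 0"
  shows "base_form X X \<ge> 0"
proof -
  have "h_part X \<bullet> h_part X = h_part X \<bullet> X"
    using inner_h_part[of "h_part X" X] by (simp add: h_part_idem)
  then have "base_form X X = (X - h_part X) \<bullet> (X - h_part X)"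
    using assms by (simp add: base_form_def inner_diff_left inner_diff_right inner_commute)
  then show ?thesis by simp
qed

lemma base_form_b: "base_form (b_endo U W) (b_endo U W) < 0"
  using b_nonzero by (simp add: base_form_def h_part_b)

text \<open>By the invariance under \<open>H\<close> the value does not depend on the chosen representative of the coset.\<close>
definition base_metric :: "(real^'n^'n) set \<Rightarrow> real^'n^'n \<Rightarrow> real^'n^'n \<Rightarrow> real" where
  "base_metric x X Y = (let a = (SOME a. a \<in> x) in
     base_form (Ad (matrix_inv a) X) (Ad (matrix_inv a) Y))"

lemma base_metric_eq:
  assumes a: "det a = 1" and c: "c \<in> coset (SOxSO U W) a"
  shows "base_metric (coset (SOxSO U W) a) X Y = base_form (Ad (matrix_inv c) X) (Ad (matrix_inv c) Y)"
proof -
  have *: "base_form (Ad (matrix_inv d) X) (Ad (matrix_inv d) Y) =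
    base_form (Ad (matrix_inv a) X) (Ad (matrix_inv a) Y)" if d: "d \<in> coset (SOxSO U W) a" for d
  proof -
    obtain h where h: "h \<in> SOxSO U W" "d = a ** h" using d by (auto simp: coset_def)
    have hh: "h ** transpose h = mat 1" using H_orthogonal[OF h(1)] by (simp add: orthogonal_matrix_def)
    have "d ** (transpose h ** matrix_inv a) = a ** (h ** transpose h) ** matrix_inv a"
      by (simp add: h(2) matrix_mul_assoc)
    then have inv: "matrix_inv d = transpose h ** matrix_inv a"
      using a by (intro matrix_inv_eqI) (simp add: hh matrix_inv_mul)
    have "det (matrix_inv a) \<noteq> 0"
      using matrix_inv_mul(1)[of a] a det_mul[of a "matrix_inv a"] by auto
    then have "Ad (matrix_inv d) Z = Ad (transpose h) (Ad (matrix_inv a) Z)" for Z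
      using H_det[OF h(1)] unfolding inv by (intro Ad_mul) simp_all
    then show ?thesis by (simp add: base_form_Ad[OF H_transpose[OF h(1)]])
  qed
  have "(SOME a'. a' \<in> coset (SOxSO U W) a) \<in> coset (SOxSO U W) a" using c by (rule someI)
  then show ?thesis using * c by (simp add: base_metric_def Let_def)
qed

lemma coset_self: "a \<in> coset (SOxSO U W) a"
  using H_one by (auto simp: coset_def intro!: image_eqI[of _ _ "mat 1"])

lemma invariant_base_metric: "invariant_metric SL sl (SOxSO U W) base_metric"
  unfolding invariant_metric_def
proof (intro ballI)
  fix a X Y :: "real^'n^'n" and x
  assume a: "a \<in> SL" and x: "x \<in> coset_space SL (SOxSO U W)"
  then obtain c where c: "det c = 1" "x = coset (SOxSO U W) c" by (auto simp: coset_space_def SL_def)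
  have da: "det a = 1" using a by (simp add: SL_def)
  have ax: "(\<lambda>y. a ** y) ` x = coset (SOxSO U W) (a ** c)"
    by (simp add: c coset_def image_image matrix_mul_assoc)
  have "(a ** c) ** (matrix_inv c ** matrix_inv a) = a ** (c ** matrix_inv c) ** matrix_inv a"
    by (simp add: matrix_mul_assoc)
  then have inv: "matrix_inv (a ** c) = matrix_inv c ** matrix_inv a"
    using c da by (intro matrix_inv_eqI) (simp add: matrix_inv_mul)
  have d: "det (matrix_inv b) \<noteq> 0" if "det b = 1" for b :: "real^'n^'n"
    using matrix_inv_mul(1)[of b] that det_mul[of b "matrix_inv b"] by auto
  have "Ad (matrix_inv (a ** c)) (Ad a Z) = Ad (matrix_inv c) Z" for Z
  proof -
    have "Ad (matrix_inv a) (Ad a Z) = Ad (matrix_inv a ** a) Z"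
      using da d[OF da] by (simp add: Ad_mul)
    then have "Ad (matrix_inv a) (Ad a Z) = Z" using da by (simp add: matrix_inv_mul Ad_mat_1)
    then show ?thesis unfolding inv using d da c by (simp add: Ad_mul)
  qed
  then show "base_metric ((\<lambda>y. a ** y) ` x) (Ad a X) (Ad a Y) = base_metric x X Y"
    unfolding ax using c da by (simp add: c base_metric_eq[OF _ coset_self] det_mul)
qed

lemma isotropy_algebra_coset:
  assumes a: "det a = 1"
  shows "isotropy_algebra (so_plus_so U W) (coset (SOxSO U W) a) = Ad a ` so_plus_so U W"
proof
  show "isotropy_algebra (so_plus_so U W) (coset (SOxSO U W) a) \<subseteq> Ad a ` so_plus_so U W"
  proof
    fix Y assume "Y \<in> isotropy_algebra (so_plus_so U W) (coset (SOxSO U W) a)"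
    then obtain h X where h: "h \<in> SOxSO U W" "X \<in> so_plus_so U W" "Y = Ad (a ** h) X"
      by (auto simp: isotropy_algebra_def coset_def)
    have "Y = Ad a (Ad h X)" using h(3) a H_det[OF h(1)] by (simp add: Ad_mul)
    moreover have "Ad h X \<in> so_plus_so U W"
      using h by (simp add: so_plus_so_iff h_part_Ad)
    ultimately show "Y \<in> Ad a ` so_plus_so U W" by blast
  qed
  show "Ad a ` so_plus_so U W \<subseteq> isotropy_algebra (so_plus_so U W) (coset (SOxSO U W) a)"
    unfolding isotropy_algebra_def using coset_self by blast
qed

lemma subspace_sl: "subspace sl"
  by (simp add: sl_def subspace_def trace_ring)

lemma lorentzian_base_metric: "lorentzian_metric SL sl (SOxSO U W) (so_plus_so U W) base_metric"
  unfolding lorentzian_metric_def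
proof (intro conjI ballI)
  fix x assume "x \<in> coset_space SL (SOxSO U W)"
  then obtain a where a: "det a = 1" "x = coset (SOxSO U W) a" by (auto simp: coset_space_def SL_def)
  let ?i = "matrix_inv a" and ?b = "b_endo U W"
  have di: "det ?i \<noteq> 0"
    using matrix_inv_mul(1)[of a] a det_mul[of a ?i] by auto
  have Q: "base_metric x X Y = base_form (Ad ?i X) (Ad ?i Y)" for X Y
    unfolding a(2) by (rule base_metric_eq[OF a(1) coset_self])
  have inv: "Ad a (Ad ?i Z) = Z" "Ad ?i (Ad a Z) = Z" for Z
    using a(1) di by (simp_all add: matrix_inv_mul Ad_mat_1 flip: Ad_mul)
  have tr: "trace (Ad a Z) = trace Z" "trace (Ad ?i Z) = trace Z" for Z
    using a(1) di by (simp_all add: trace_Ad)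
  have add: "base_form (Y + Z) X = base_form Y X + base_form Z X" 
    and scale: "base_form (c *\<^sub>R Y) X = c * base_form Y X" for X Y Z c
    using base_form_sym linear_add[OF linear_base_form] linear_scale[OF linear_base_form]
    by (metis, metis real_scaleR_def)
  have sym: "symmetric_form_on sl (base_metric x)"
    unfolding symmetric_form_on_def Q linear_add[OF linear_Ad] linear_scale[OF linear_Ad] add scale
    using base_form_sym by blast
  have "form_index sl (base_metric x) = 1"
  proof (rule form_index_eq_1I[OF subspace_sl sym])
    show "Ad a ?b \<in> sl" by (simp add: sl_def tr trace_b)
    show "base_metric x (Ad a ?b) (Ad a ?b) < 0" by (simp add: Q inv base_form_b)
    show "linear (\<lambda>X. ?b \<bullet> Ad ?i X)"
      by (rule linearI) (simp_all add: linear_add[OF linear_Ad] linear_scale[OF linear_Ad] inner_add_right)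
    show "0 \<le> base_metric x X X" if "?b \<bullet> Ad ?i X = 0" for X
      using base_form_nonneg[OF that] by (simp add: Q)
  qed
  moreover have "{X \<in> sl. \<forall>Y\<in>sl. base_metric x X Y = 0} = Ad a ` so_plus_so U W"
  proof -
    have "(\<forall>Y\<in>sl. base_metric x X Y = 0) \<longleftrightarrow> (\<forall>Y\<in>sl. base_form (Ad ?i X) Y = 0)" for X
      unfolding Q sl_def using inv tr by (metis (mono_tags) mem_Collect_eq)
    then have "(\<forall>Y\<in>sl. base_metric x X Y = 0) \<longleftrightarrow> Ad ?i X \<in> so_plus_so U W" if "X \<in> sl" for X
      using base_form_radical[of "Ad ?i X"] that tr(2)[of X] unfolding sl_def by simp
    then have "{X \<in> sl. \<forall>Y\<in>sl. base_metric x X Y = 0} = {X \<in> sl. Ad ?i X \<in> so_plus_so U W}"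
      by blast
    also have "\<dots> = Ad a ` so_plus_so U W"
    proof (intro set_eqI iffI)
      fix X assume "X \<in> {X \<in> sl. Ad ?i X \<in> so_plus_so U W}"
      then show "X \<in> Ad a ` so_plus_so U W" using inv(1)[of X] by force
    next
      fix X assume "X \<in> Ad a ` so_plus_so U W"
      then show "X \<in> {X \<in> sl. Ad ?i X \<in> so_plus_so U W}"
        using trace_so_plus_so by (auto simp: inv tr sl_def)
    qed
    finally show ?thesis .
  qed
  ultimately show "lorentzian_mod sl (isotropy_algebra (so_plus_so U W) x) (base_metric x)"
    unfolding lorentzian_mod_def a(2) isotropy_algebra_coset[OF a(1)] using sym a(2) by simp
next
  fix X Y :: "real^'n^'n"
  let ?F = "\<lambda>Z a. adjugate a ** Z ** a"
  have F: "matrix_polynomial (?F Z)" for Z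
    by (intro matrix_polynomial_mul matrix_polynomial_adjugate matrix_polynomial_const matrix_polynomial_id)
  have H: "matrix_polynomial (\<lambda>a. h_part (?F Z a))" for Z
    unfolding h_part_def
    by (intro matrix_polynomial_scaleR matrix_polynomial_add matrix_polynomial_mul
        matrix_polynomial_const matrix_polynomial_diff matrix_polynomial_transpose F)
  have "real_polynomial_function (\<lambda>a. base_form (?F X a) (?F Y a))"
    unfolding base_form_def divide_inverse
    by (intro real_polynomial_function_diff real_polynomial_function.intros(4) real_polynomial_function.intros(2)
        real_polynomial_function_matrix_inner F H matrix_polynomial_const)
  moreover have "base_metric (coset (SOxSO U W) a) X Y = base_form (?F X a) (?F Y a)" if "a \<in> SL" for a
  proof -
    have a: "det a = 1" using that by (simp add: SL_def)
    have "matrix_inv (matrix_inv a) = a" using a by (intro matrix_inv_eqI) (simp add: matrix_inv_mul)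
    then show ?thesis
      using base_metric_eq[OF a coset_self] by (simp add: Ad_def matrix_inv_eq_adjugate[OF a])
  qed
  ultimately show "smooth_on SL (\<lambda>a. base_metric (coset (SOxSO U W) a) X Y)"
    by (rule smooth_on_polynomial)
qed

lemma admissible_split: "admissible SL sl (SOxSO U W) (so_plus_so U W)"
  unfolding admissible_def using lorentzian_base_metric invariant_base_metric by blast

end

section \<open>Schur's lemma for the isotropy module\<close>

text \<open>Projecting one argument onto the other leaves only the values \<open>G u u\<close>. These are compared with \<open>G e e\<close> for
  a fixed \<open>e\<close>, in the orthogonal case by testing \<open>e + u\<close> against the orthogonal vector
  \<open>(u \<bullet> u) e - (e \<bullet> e) u\<close>.\<close>
lemma form_vanishing_on_orthogonal_pairs:
  fixes G :: "'a::euclidean_space \<Rightarrow> 'a \<Rightarrow> real"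
  assumes G: "bilinear G" and U: "subspace U"
    and orth: "\<And>u v. u \<in> U \<Longrightarrow> v \<in> U \<Longrightarrow> u \<bullet> v = 0 \<Longrightarrow> G u v = 0"
  obtains c where "\<And>u v. u \<in> U \<Longrightarrow> v \<in> U \<Longrightarrow> G u v = c * (u \<bullet> v)"
proof (cases "U = {0}")
  case True
  then show ?thesis using that[of 0] by (simp add: bilinear_lzero[OF G])
next
  case False
  then obtain e where e: "e \<in> U" "e \<noteq> 0" using subspace_0[OF U] by auto
  have ee: "e \<bullet> e > 0" using e by simp
  have right: "(u \<bullet> u) * G u v = (u \<bullet> v) * G u u" if uv: "u \<in> U" "v \<in> U" for u v
  proof -
    have "(u \<bullet> u) *\<^sub>R v - (u \<bullet> v) *\<^sub>R u \<in> U" using uv U by (simp add: subspace_diff subspace_scale)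
    then have "G u ((u \<bullet> u) *\<^sub>R v - (u \<bullet> v) *\<^sub>R u) = 0"
      using orth[OF uv(1)] by (simp add: algebra_simps)
    then show ?thesis by (simp add: bilinear_rsub[OF G] bilinear_rmul[OF G])
  qed
  have left: "(v \<bullet> v) * G u v = (u \<bullet> v) * G v v" if uv: "u \<in> U" "v \<in> U" for u v
  proof -
    have "(v \<bullet> v) *\<^sub>R u - (u \<bullet> v) *\<^sub>R v \<in> U" using uv U by (simp add: subspace_diff subspace_scale)
    then have "G ((v \<bullet> v) *\<^sub>R u - (u \<bullet> v) *\<^sub>R v) v = 0"
      using orth[OF _ uv(2)] by (simp add: algebra_simps)
    then show ?thesis by (simp add: bilinear_lsub[OF G] bilinear_lmul[OF G])
  qed
  define c where "c = G e e / (e \<bullet> e)"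
  have diag: "G u u = c * (u \<bullet> u)" if u: "u \<in> U" for u
  proof (cases "e \<bullet> u = 0")
    case False
    have "(e \<bullet> u) * (u \<bullet> u) * G e e = (u \<bullet> u) * ((e \<bullet> e) * G e u)"
      using right[OF e(1) u] by simp
    also have "\<dots> = (e \<bullet> e) * ((e \<bullet> u) * G u u)"
      using left[OF e(1) u] by simp
    finally show ?thesis using False ee by (simp add: c_def field_simps)
  next
    case True
    define v where "v = e + u"
    have v: "v \<in> U" using e u U by (simp add: v_def subspace_add)
    have "e \<bullet> v = e \<bullet> e" using True by (simp add: v_def inner_add_right)
    then have "G e v = G e e" using right[OF e(1) v] ee by simp
    moreover have "G e v = G e e + G e u" by (simp add: v_def bilinear_radd[OF G])
    ultimately have eu: "G e u = 0" by simp
    have ue: "G u e = 0" using orth[OF u e(1)] True by (simp add: inner_commute)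
    define a where "a = (u \<bullet> u) *\<^sub>R e - (e \<bullet> e) *\<^sub>R u"
    have a: "a \<in> U" using e u U by (simp add: a_def subspace_diff subspace_scale)
    have "v \<bullet> a = 0" using True by (simp add: v_def a_def inner_add_left inner_add_right inner_diff_right inner_commute[of u e])
    then have "G v a = 0" using orth[OF v a] by simp
    then have "(u \<bullet> u) * G e e - (e \<bullet> e) * G u u = 0"
      using eu ue by (simp add: v_def a_def bilinear_ladd[OF G] bilinear_rsub[OF G] bilinear_rmul[OF G])
    then show ?thesis using ee by (simp add: c_def field_simps)
  qed
  have "G u v = c * (u \<bullet> v)" if uv: "u \<in> U" "v \<in> U" for u v
  proof (cases "u = 0")
    case True then show ?thesis by (simp add: bilinear_lzero[OF G])
  next
    case False
    then show ?thesis using right[OF uv] diag[OF uv(1)] by simp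
  qed
  then show ?thesis by (rule that)
qed

text \<open>\<open>SO(U)\<close> is transitive on the squares of unit vectors.\<close>
lemma invariant_functional_on_squares:
  fixes f :: "real^'n^'n \<Rightarrow> real"
  assumes U: "subspace U" and f: "linear f"
    and inv: "\<And>h a. h \<in> SO U \<Longrightarrow> a \<in> U \<Longrightarrow> f (Ad h (tensor a a)) = f (tensor a a)"
  obtains c where "\<And>a. a \<in> U \<Longrightarrow> f (tensor a a) = c * (a \<bullet> a)"
proof (cases "U = {0}")
  case True
  then show ?thesis using that[of 0] by (simp add: tensor_zero_left linear_0[OF f])
next
  case False
  then obtain e' where e': "e' \<in> U" "e' \<noteq> 0" using subspace_0[OF U] by auto
  define e where "e = e' /\<^sub>R norm e'"
  have e: "e \<in> U" "norm e = 1" using e' U by (auto simp: e_def subspace_scale)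
  have "f (tensor a a) = f (tensor e e) * (a \<bullet> a)" if a: "a \<in> U" for a
  proof (cases "a = 0")
    case True then show ?thesis by (simp add: tensor_zero_left linear_0[OF f])
  next
    case False
    define a' where "a' = a /\<^sub>R norm a"
    have a': "a' \<in> U" "norm a' = 1" "a = norm a *\<^sub>R a'" using a U False by (auto simp: a'_def subspace_scale)
    obtain h where h: "h \<in> SO U" "Ad h (tensor e e) = tensor a' a'"
      using SO_transitive_squares[OF U e a'(1,2)] .
    have "f (tensor a' a') = f (tensor e e)" using inv[OF h(1) e(1)] h(2) by simp
    moreover have "tensor a a = (a \<bullet> a) *\<^sub>R tensor a' a'"
      by (subst (1 2) a'(3)) (simp add: tensor_bilinear power2_norm_eq_inner[symmetric] power2_eq_square)
    ultimately show ?thesis by (simp add: linear_scale[OF f])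
  qed
  then show ?thesis by (rule that)
qed

lemma one_dimensional_collinear:
  fixes U :: "(real^'n) set"
  assumes U: "subspace U" and "dim U = 1" and e: "e \<in> U" "norm e = 1" and a: "a \<in> U"
  shows "a = (e \<bullet> a) *\<^sub>R e"
proof -
  have "e \<noteq> 0" using e by auto
  then have "dim (span {e}) = 1" by (simp add: dim_insert)
  then have "span {e} = U"
    using assms by (intro subspace_dim_equal) (auto intro: span_minimal[THEN subsetD])
  then obtain k where "a = k *\<^sub>R e" using a by (auto simp: span_singleton)
  then show ?thesis using e(2) by (simp add: norm_eq_1)
qed

context orth_split
begin

lemma Ad_fix_W_block:
  assumes h: "h \<in> SO U" and T: "R ** T ** R = T"
  shows "Ad h T = T"
proof -
  interpret swap: orth_split W U R P by (rule orth_split_swap)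
  have hT: "h ** T = T" using SO_U_R(1)[OF h] swap.tensor_vanish_U(3)[OF T] by (metis matrix_mul_assoc)
  have "transpose h ** R = R" using SO_U_R(1)[OF SO_U_transpose[OF h]] .
  moreover have "R ** transpose h = R" using SO_U_R(2)[OF SO_U_transpose[OF h]] .
  ultimately have "T ** transpose h = T"
    using swap.tensor_vanish_U(4)[OF T] by (metis matrix_mul_assoc)
  then show ?thesis using hT by (simp add: Ad_orthogonal[OF SO_orthogonal[OF h]])
qed

text \<open>The functional agrees with a multiple of the trace on squares, hence on all symmetric tensors.\<close>
lemma S20_functional_eq_0:
  fixes f :: "real^'n^'n \<Rightarrow> real"
  assumes f: "linear f" and inv: "\<And>h X. h \<in> SO U \<Longrightarrow> f (Ad h X) = f X" and X: "X \<in> S20 U"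
  shows "f X = 0"
proof -
  obtain c where c: "\<And>a. a \<in> U \<Longrightarrow> f (tensor a a) = c * (a \<bullet> a)"
    using invariant_functional_on_squares[OF subspace_U f inv] by blast
  have g: "linear (\<lambda>X::real^'n^'n. c * trace X)" by (rule linearI) (simp_all add: trace_ring algebra_simps)
  have "f X = c * trace X"
    by (rule symmetric_tensor_ext[OF f g subspace_U, where A = P])
      (use X c P_in_U in \<open>simp_all add: trace_tensor S20_U P_sym\<close>)
  then show ?thesis using X by (simp add: S20_U)
qed

lemma S20_one_dimensional:
  assumes "dim U = 1" and X: "X \<in> S20 U"
  shows "X = 0"
proof -
  obtain e where e: "e \<in> U" "norm e = 1" by (rule unit_vector) (rule that)
  have "X \<bullet> Y = 0" for Y
  proof -
    have f: "linear (\<lambda>X. X \<bullet> Y)" by (rule linearI) (simp_all add: inner_add_left)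
    have g: "linear (\<lambda>X::real^'n^'n. (tensor e e \<bullet> Y) * trace X)"
      by (rule linearI) (simp_all add: trace_ring algebra_simps)
    have "X \<bullet> Y = (tensor e e \<bullet> Y) * trace X"
    proof (rule symmetric_tensor_ext[OF f g subspace_U, where A = P])
      fix a assume "a \<in> U"
      then obtain k where "a = k *\<^sub>R e" using one_dimensional_collinear[OF subspace_U assms(1) e] by blast
      then show "tensor a a \<bullet> Y = tensor e e \<bullet> Y * trace (tensor a a)"
        using e(2) by (simp add: tensor_bilinear trace_ring trace_tensor norm_eq_1)
    qed (use X P_in_U in \<open>simp_all add: S20_U P_sym\<close>)
    then show ?thesis using X by (simp add: S20_U)
  qed
  from this[of X] show ?thesis by simp
qed

end

locale invariant_form = orth_split U W P R
  for U W :: "(real^'n) set" and P R :: "real^'n^'n" +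
  fixes B :: "real^'n^'n \<Rightarrow> real^'n^'n \<Rightarrow> real"
  assumes bil: "bilinear B" and sym: "B X Y = B Y X"
    and inv: "h \<in> SOxSO U W \<Longrightarrow> B (Ad h X) (Ad h Y) = B X Y"
begin

lemma invariant_form_swap: "invariant_form W U R P B"
proof -
  interpret swap: orth_split W U R P by (rule orth_split_swap)
  show ?thesis by unfold_locales (simp_all add: bil sym inv SOxSO_swap)
qed

lemmas B_simps = bilinear_ladd[OF bil] bilinear_radd[OF bil] bilinear_lsub[OF bil] bilinear_rsub[OF bil]
  bilinear_lmul[OF bil] bilinear_rmul[OF bil] bilinear_lneg[OF bil] bilinear_rneg[OF bil]
  bilinear_lzero[OF bil] bilinear_rzero[OF bil]

lemma linear_B: "linear (B X)" using bil by (simp add: bilinear_def)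
lemma linear_B': "linear (\<lambda>X. B X Y)" using bil by (simp add: bilinear_def)

lemma inv_U: "h \<in> SO U \<Longrightarrow> B (Ad h X) (Ad h Y) = B X Y"
  using inv SO_subset by blast

lemma Ad_tensor_U: "h \<in> SO U \<Longrightarrow> Ad h (tensor u v) = tensor (h *v u) (h *v v)"
  by (simp add: Ad_tensor SO_orthogonal)

text \<open>The square of \<open>x\<close> is half the sum of \<open>x\<^sup>2 + z\<^sup>2\<close> and \<open>x\<^sup>2 - z\<^sup>2\<close>. The quarter turn in the plane
  of \<open>x\<close> and \<open>z\<close> fixes the former and reverses the sign of \<open>x z + z x\<close>; the rotation by half of that
  angle sends \<open>x\<^sup>2 - z\<^sup>2\<close> to \<open>x z + z x\<close> and the latter to \<open>z\<^sup>2 - x\<^sup>2\<close>.\<close>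
lemma square_orthogonal_product:
  assumes x: "x \<in> U" "norm x = 1" and z: "z \<in> U" "norm z = 1" and xz: "x \<bullet> z = 0"
  shows "B (tensor x x) (tensor x z + tensor z x) = 0"
proof -
  let ?E = "tensor x z + tensor z x" and ?S = "tensor x x + tensor z z" and ?D = "tensor x x - tensor z z"
  note rot = plane_rotation_in_SO[OF x(2) z(2) xz x(1) z(1)]
  have q: "plane_rotation x z (pi/2) *v x = z" "plane_rotation x z (pi/2) *v z = - x"
    using plane_rotation_u[OF x(2) z(2) xz] plane_rotation_v[OF x(2) z(2) xz] by simp_all
  have "Ad (plane_rotation x z (pi/2)) ?S = ?S" "Ad (plane_rotation x z (pi/2)) ?E = - ?E"
    by (simp_all add: linear_add[OF linear_Ad] Ad_tensor_U[OF rot] q tensor_bilinear)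
  then have SE: "B ?S ?E = 0"
    using inv_U[OF rot[of "pi/2"], of ?S ?E] by (simp only: B_simps)
  define r where "r = sqrt 2 / 2"
  have r: "r * r = 1 / 2" by (simp add: r_def)
  have e: "plane_rotation x z (pi/4) *v x = r *\<^sub>R (x + z)" "plane_rotation x z (pi/4) *v z = r *\<^sub>R (z - x)"
    using plane_rotation_u[OF x(2) z(2) xz, of "pi/4"] plane_rotation_v[OF x(2) z(2) xz, of "pi/4"]
    by (simp_all add: r_def cos_45 sin_45 scaleR_add_right scaleR_diff_right)
  have "Ad (plane_rotation x z (pi/4)) ?D = ?E" "Ad (plane_rotation x z (pi/4)) ?E = - ?D"
    unfolding linear_add[OF linear_Ad] linear_diff[OF linear_Ad] Ad_tensor_U[OF rot] e
    by (simp_all add: tensor_bilinear r vec_eq_iff field_simps)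
  then have "B ?D ?E = B ?E (- ?D)"
    using inv_U[OF rot[of "pi/4"], of ?D ?E] by simp
  then have DE: "B ?D ?E = 0" using sym[of ?E ?D] by (simp only: bilinear_rneg[OF bil])
  have "2 * B (tensor x x) ?E = B ?S ?E + B ?D ?E" by (simp add: B_simps)
  then show ?thesis using SE DE by simp
qed

text \<open>The stabilizer of \<open>x\<close> contains the rotations of its complement in \<open>U\<close>, so \<open>B x\<^sup>2 z\<^sup>2\<close> is the same
  for all unit vectors \<open>z\<close> orthogonal to \<open>x\<close>. It does not depend on \<open>x\<close> either, because the sum over
  an orthonormal basis is \<open>B x\<^sup>2 P\<close>.\<close>
lemma form_on_squares:
  assumes "dim U \<ge> 2"
  obtains k n where "\<And>x y. x \<in> U \<Longrightarrow> y \<in> U \<Longrightarrow>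
    B (tensor x x) (tensor y y) = k * (x \<bullet> y)\<^sup>2 + n * ((x \<bullet> x) * (y \<bullet> y))"
proof -
  obtain e where e: "e \<in> U" "norm e = 1" by (rule unit_vector) (rule that)
  define \<alpha> where "\<alpha> = B (tensor e e) (tensor e e)"
  have \<alpha>: "B (tensor x x) (tensor x x) = \<alpha>" if x: "x \<in> U" "norm x = 1" for x
  proof -
    obtain h where "h \<in> SO U" "Ad h (tensor e e) = tensor x x"
      using SO_transitive_squares[OF subspace_U e x] .
    then show ?thesis using inv_U[of h "tensor e e" "tensor e e"] by (simp add: \<alpha>_def)
  qed
  have invP: "B P (Ad h X) = B P X" if "h \<in> SO U" for h X
    using inv_U[OF that, of P X] H_Ad(7)[of h] SO_subset that by (metis subsetD)
  obtain \<mu> where \<mu>: "\<And>a. a \<in> U \<Longrightarrow> B P (tensor a a) = \<mu> * (a \<bullet> a)"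
    using invariant_functional_on_squares[OF subspace_U linear_B invP] by blast
  \<comment> \<open>\<open>\<mu> - \<alpha>\<close> is the sum of \<open>B x\<^sup>2 z\<^sup>2\<close> over an orthonormal basis of the complement of \<open>x\<close> in \<open>U\<close>.\<close>
  define \<nu> where "\<nu> = (\<mu> - \<alpha>) / (real (dim U) - 1)"
  have \<nu>: "B (tensor x x) (tensor z z) = \<nu> * (z \<bullet> z)"
    if x: "x \<in> U" "norm x = 1" and z: "z \<in> U" "x \<bullet> z = 0" for x z
  proof -
    have xx: "x \<bullet> x = 1" using x(2) by (simp add: norm_eq_1)
    define U' where "U' = {u \<in> U. x \<bullet> u = 0}"
    have U': "subspace U'" using subspace_U by (auto simp: U'_def subspace_def inner_add_right)
    have fix_x: "Ad h (tensor x x) = tensor x x" "h \<in> SO U" if "h \<in> SO U'" for h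
    proof -
      show h: "h \<in> SO U" using SO_mono[of U' U] that by (auto simp: U'_def)
      have "x \<in> U'\<^sup>\<bottom>" by (auto simp: U'_def orthogonal_comp_def orthogonal_def inner_commute)
      then have "h *v x = x" using that by (simp add: SO_def)
      then show "Ad h (tensor x x) = tensor x x" by (simp add: Ad_tensor_U[OF h])
    qed
    have "B (tensor x x) (Ad h X) = B (tensor x x) X" if "h \<in> SO U'" for h X
      using inv_U[OF fix_x(2)[OF that], of "tensor x x" X] fix_x(1)[OF that] by simp
    then obtain c where c: "\<And>a. a \<in> U' \<Longrightarrow> B (tensor x x) (tensor a a) = c * (a \<bullet> a)"
      using invariant_functional_on_squares[OF U' linear_B] by blast
    define A where "A = P - tensor x x"
    have Px: "P *v x = x" using x(1) by (simp add: U_iff)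
    have At: "transpose A = A" by (simp add: A_def transpose_ring P_sym transpose_tensor)
    have t: "P ** tensor x x = tensor x x" "tensor x x ** P = tensor x x" "tensor x x ** tensor x x = tensor x x"
      using Px P_sym by (simp_all add: matrix_mul_tensor tensor_mul_matrix[of x x P, unfolded P_sym]
          tensor_mult_vec xx del: transpose_matrix_vector)
    have AA: "A ** A = A" by (simp add: A_def matrix_ring t P_idem)
    have AU: "A *v v \<in> U'" for v
    proof -
      have Av: "A *v v = P *v v - (x \<bullet> v) *\<^sub>R x"
        by (simp add: A_def matrix_vector_mult_diff_rdistrib tensor_mult_vec)
      have "x \<bullet> (P *v v) = x \<bullet> v" using inner_P[of x v] Px by simp
      then show ?thesis
        using P_in_U[of v] x(1) subspace_U xx
        by (simp add: U'_def Av subspace_diff subspace_scale inner_diff_right)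
    qed
    have g: "linear (\<lambda>X::real^'n^'n. c * trace X)" by (rule linearI) (simp_all add: trace_ring algebra_simps)
    have "B (tensor x x) A = c * trace A"
      by (rule symmetric_tensor_ext[OF linear_B g U' _ AU])
        (use c in \<open>simp_all add: trace_tensor At AA\<close>)
    moreover have "trace A = real (dim U) - 1" by (simp add: A_def trace_ring trace_P trace_tensor xx)
    moreover have "B (tensor x x) A = \<mu> - \<alpha>"
      using \<mu>[OF x(1)] \<alpha>[OF x] sym[of "tensor x x" P] by (simp add: A_def B_simps xx)
    ultimately have "c = \<nu>" using assms by (simp add: \<nu>_def field_simps)
    moreover have "z \<in> U'" using z by (simp add: U'_def)
    ultimately show ?thesis using c by simp
  qed
  have unit: "B (tensor x x) (tensor y y) = (\<alpha> - \<nu>) * (x \<bullet> y)\<^sup>2 + \<nu> * (y \<bullet> y)"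
    if x: "x \<in> U" "norm x = 1" and y: "y \<in> U" for x y
  proof -
    obtain f d where f: "f \<in> U" "norm f = 1" "x \<bullet> f = 0" "y = (x \<bullet> y) *\<^sub>R x + d *\<^sub>R f"
      using orthonormal_pair_exists[OF subspace_U assms x y] .
    define s where "s = x \<bullet> y"
    have yy: "y = s *\<^sub>R x + d *\<^sub>R f" using f(4) by (simp add: s_def)
    have ip: "x \<bullet> x = 1" "f \<bullet> f = 1" "f \<bullet> x = 0" using x(2) f(2,3) by (auto simp: norm_eq_1 inner_commute)
    have "y \<bullet> y = s * s + d * d" using ip f(3) by (simp add: yy inner_add)
    moreover have "tensor y y = (s * s) *\<^sub>R tensor x x + (s * d) *\<^sub>R (tensor x f + tensor f x) + (d * d) *\<^sub>R tensor f f"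
      by (simp add: yy tensor_bilinear algebra_simps)
    then have "B (tensor x x) (tensor y y) = s * s * \<alpha> + d * d * \<nu>"
      using square_orthogonal_product[OF x f(1-3)] \<alpha>[OF x] \<nu>[OF x f(1,3)] ip
      by (simp add: bilinear_radd[OF bil] bilinear_rmul[OF bil])
    ultimately show ?thesis by (simp add: s_def[symmetric] power2_eq_square algebra_simps)
  qed
  have "B (tensor x x) (tensor y y) = (\<alpha> - \<nu>) * (x \<bullet> y)\<^sup>2 + \<nu> * ((x \<bullet> x) * (y \<bullet> y))"
    if x: "x \<in> U" and y: "y \<in> U" for x y
  proof (cases "x = 0")
    case True then show ?thesis by (simp add: tensor_bilinear B_simps)
  next
    case False
    define x' where "x' = x /\<^sub>R norm x"
    have x': "x' \<in> U" "norm x' = 1" "x = norm x *\<^sub>R x'" using x subspace_U False by (auto simp: x'_def subspace_scale)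
    have "B (tensor x x) (tensor y y) = (norm x)\<^sup>2 * B (tensor x' x') (tensor y y)"
      by (subst (1 2) x'(3)) (simp add: tensor_bilinear B_simps power2_eq_square)
    also have "\<dots> = (norm x)\<^sup>2 * ((\<alpha> - \<nu>) * (x' \<bullet> y)\<^sup>2 + \<nu> * (y \<bullet> y))"
      by (simp add: unit[OF x'(1,2) y])
    also have "\<dots> = (\<alpha> - \<nu>) * ((norm x *\<^sub>R x') \<bullet> y)\<^sup>2 + \<nu> * ((norm x)\<^sup>2 * (y \<bullet> y))"
      by (simp add: algebra_simps power_mult_distrib)
    finally show ?thesis by (simp add: x'(3)[symmetric] power2_norm_eq_inner)
  qed
  then show ?thesis by (rule that)
qed

text \<open>The squares determine the form on symmetric tensors by polarization in each argument, and the term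
  with the constant \<open>n\<close> is a product of traces.\<close>
lemma form_on_S20:
  obtains k where "\<And>X Y. X \<in> S20 U \<Longrightarrow> Y \<in> S20 U \<Longrightarrow> B X Y = k * (X \<bullet> Y)"
proof (cases "dim U = 1")
  case True
  then show ?thesis using that[of 1] S20_one_dimensional by (metis B_simps(9) inner_zero_left mult_zero_right)
next
  case False
  then have "dim U \<ge> 2" using dim_U by simp
  then obtain k n where kn: "\<And>x y. x \<in> U \<Longrightarrow> y \<in> U \<Longrightarrow>
    B (tensor x x) (tensor y y) = k * (x \<bullet> y)\<^sup>2 + n * ((x \<bullet> x) * (y \<bullet> y))"
    using form_on_squares by blast
  have "B X Y = k * (X \<bullet> Y)" if X: "X \<in> S20 U" and Y: "Y \<in> S20 U" for X Y
  proof -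
    have half: "B X (tensor y y) = k * (X \<bullet> tensor y y)" if y: "y \<in> U" for y
    proof -
      have g: "linear (\<lambda>X::real^'n^'n. k * (X \<bullet> tensor y y) + n * (trace X * (y \<bullet> y)))"
        by (rule linearI) (simp_all add: trace_ring inner_add_left algebra_simps)
      have "B X (tensor y y) = k * (X \<bullet> tensor y y) + n * (trace X * (y \<bullet> y))"
        by (rule symmetric_tensor_ext[OF linear_B' g subspace_U, where A = P])
          (use X P_in_U kn y in \<open>simp_all add: trace_tensor S20_U P_sym inner_tensor power2_eq_square\<close>)
      then show ?thesis using X by (simp add: S20_U)
    qed
    have g: "linear (\<lambda>Y::real^'n^'n. k * (X \<bullet> Y))"
      by (rule linearI) (simp_all add: inner_add_right algebra_simps)
    show ?thesis
      by (rule symmetric_tensor_ext[OF linear_B g subspace_U, where A = P])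
        (use Y P_in_U half in \<open>simp_all add: S20_U P_sym\<close>)
  qed
  then show ?thesis by (rule that)
qed

text \<open>The half turn in a plane of \<open>U\<close> containing \<open>a\<close> and \<open>u\<close> fixes \<open>a\<^sup>2\<close> and reverses the sign of
  \<open>u \<otimes> w\<close>.\<close>
lemma S20_orthogonal_mixed:
  assumes S: "S \<in> S20 U" and u: "u \<in> U" and w: "w \<in> W"
  shows "B S (tensor u w) = 0" "B S (tensor w u) = 0"
proof -
  have "B S (tensor u w) = 0 \<and> B S (tensor w u) = 0"
  proof (cases "dim U = 1")
    case True
    then show ?thesis using S20_one_dimensional[OF True S] by (simp add: B_simps)
  next
    case False
    then have d: "dim U \<ge> 2" using dim_U by simp
    have sq: "B (tensor a a) (tensor u w) = 0 \<and> B (tensor a a) (tensor w u) = 0" if a: "a \<in> U" for a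
    proof (cases "a = 0")
      case True then show ?thesis by (simp add: tensor_bilinear B_simps)
    next
      case False
      define a' where "a' = a /\<^sub>R norm a"
      have a': "a' \<in> U" "norm a' = 1" "a = norm a *\<^sub>R a'" using a subspace_U False by (auto simp: a'_def subspace_scale)
      obtain h where h: "h \<in> SO U" "h *v a' = - a'" "h *v u = - u"
        using half_turn[OF subspace_U d a'(1,2) u] .
      have hw: "h *v w = w" using SO_U_vec(2)[OF h(1) w] .
      have ha: "h *v a = - a" by (subst (1 2) a'(3)) (simp add: matrix_vector_mult_scaleR h)
      have "Ad h (tensor a a) = tensor a a" "Ad h (tensor u w) = - tensor u w" "Ad h (tensor w u) = - tensor w u"
        by (simp_all add: Ad_tensor_U[OF h(1)] ha h(3) hw tensor_bilinear)
      then show ?thesis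
        using inv_U[OF h(1), of "tensor a a" "tensor u w"] inv_U[OF h(1), of "tensor a a" "tensor w u"]
        by (simp add: B_simps)
    qed
    have g: "linear (\<lambda>X::real^'n^'n. 0::real)" by (rule linearI) simp_all
    have "B S (tensor u w) = 0"
      by (rule symmetric_tensor_ext[OF linear_B' g subspace_U, where A = P])
        (use S P_in_U sq in \<open>simp_all add: S20_U P_sym\<close>)
    moreover have "B S (tensor w u) = 0"
      by (rule symmetric_tensor_ext[OF linear_B' g subspace_U, where A = P])
        (use S P_in_U sq in \<open>simp_all add: S20_U P_sym\<close>)
    ultimately show ?thesis ..
  qed
  then show "B S (tensor u w) = 0" "B S (tensor w u) = 0" by auto
qed

lemma fixed_orthogonal_mixed:
  assumes d: "dim U \<ge> 2" and M: "\<And>h. h \<in> SO U \<Longrightarrow> Ad h M = M" and u: "u \<in> U" and w: "w \<in> W"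
  shows "B M (tensor u w) = 0" "B M (tensor w u) = 0"
proof -
  obtain h where h: "h \<in> SO U" "h *v u = - u" using half_turn_negating[OF subspace_U d u] .
  have "Ad h (tensor u w) = - tensor u w" "Ad h (tensor w u) = - tensor w u"
    by (simp_all add: Ad_tensor_U[OF h(1)] h(2) SO_U_vec(2)[OF h(1) w] tensor_bilinear)
  then show "B M (tensor u w) = 0" "B M (tensor w u) = 0"
    using inv_U[OF h(1), of M "tensor u w"] inv_U[OF h(1), of M "tensor w u"] M[OF h(1)]
    by (simp_all add: B_simps)
qed

lemma fixed_orthogonal_S20:
  assumes M: "\<And>h. h \<in> SO U \<Longrightarrow> Ad h M = M" and S: "S \<in> S20 U"
  shows "B M S = 0"
proof (rule S20_functional_eq_0[OF linear_B _ S])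
  show "B M (Ad h X) = B M X" if "h \<in> SO U" for h X
    using inv_U[OF that, of M X] M[OF that] by simp
qed

end

section \<open>The mixed summands\<close>

text \<open>The two embeddings of \<open>U \<otimes> W\<close> into \<open>\<mm>\<close>, with images \<open>U \<and> W\<close> and \<open>U \<or> W\<close>.\<close>
definition mix :: "2 \<Rightarrow> real^'n^'n \<Rightarrow> real^'n^'n" where
  "mix i Z = (if i = 1 then Z - transpose Z else Z + transpose Z)"

definition mix_sum :: "(real^'n^'n)^2 \<Rightarrow> real^'n^'n" where
  "mix_sum Z = mix 1 (Z$1) + mix 2 (Z$2)"

definition mixed_space :: "(real^'n) set \<Rightarrow> (real^'n) set \<Rightarrow> ((real^'n^'n)^2) set" where
  "mixed_space U W = {Z. \<forall>i. Z $ i \<in> tensor_space U W}"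

lemma linear_mix: "linear (mix i)"
  by (rule linearI) (simp_all add: mix_def transpose_ring algebra_simps)

lemma linear_mix_sum: "linear mix_sum"
  by (rule linearI) (simp_all add: mix_sum_def linear_add[OF linear_mix] linear_scale[OF linear_mix] algebra_simps)

lemma canonical_iso_eq:
  "canonical_iso U W (t, Z, S, T) = t *\<^sub>R b_endo U W + mix_sum Z + S + T"
  by (simp add: canonical_iso_def mix_sum_def mix_def)

lemma subspace_mixed_space: "subspace (mixed_space U W)"
  using subspace_tensor_space[of U W] by (auto simp: mixed_space_def subspace_def)

lemma linear_tensor_left: "linear (\<lambda>u. tensor u w)"
  by (rule linearI) (simp_all add: tensor_bilinear)

lemma linear_tensor_right: "linear (tensor u)"
  by (rule linearI) (simp_all add: tensor_bilinear)

lemma mix_vanish: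
  fixes f :: "real^'n^'n \<Rightarrow> real"
  assumes f: "linear f"
    and 0: "\<And>u w. u \<in> U \<Longrightarrow> w \<in> W \<Longrightarrow> f (tensor u w) = 0 \<and> f (tensor w u) = 0"
    and Z: "Z \<in> tensor_space U W"
  shows "f (mix i Z) = 0"
proof -
  have lin: "linear (\<lambda>Z. f (mix i Z))"
    using linear_compose[OF linear_mix f] by (simp add: o_def)
  show ?thesis
    by (rule linear_eq_0_on_span[OF lin _ Z[unfolded tensor_space_def]])
      (use 0 in \<open>auto simp: mix_def transpose_tensor linear_add[OF f] linear_diff[OF f]\<close>)
qed

lemma mix_sum_vanish:
  fixes f :: "real^'n^'n \<Rightarrow> real"
  assumes f: "linear f"
    and 0: "\<And>u w. u \<in> U \<Longrightarrow> w \<in> W \<Longrightarrow> f (tensor u w) = 0 \<and> f (tensor w u) = 0"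
    and Z: "Z \<in> mixed_space U W"
  shows "f (mix_sum Z) = 0"
  using mix_vanish[OF f 0] Z by (simp add: mix_sum_def linear_add[OF f] mixed_space_def)

context orth_split
begin

text \<open>In dimension 1 one of two orthogonal vectors is 0, and from dimension 3 on there is a plane that
  contains the first vector and is orthogonal to the second.\<close>
lemma sign_change:
  assumes "dim U \<noteq> 2" and u: "u \<in> U" and u': "u' \<in> U" and orth: "u \<bullet> u' = 0"
  shows "u = 0 \<or> u' = 0 \<or> (\<exists>h\<in>SO U. h *v u = - u \<and> h *v u' = u')"
proof (cases "dim U = 1")
  case True
  obtain e where e: "e \<in> U" "norm e = 1" by (rule unit_vector) (rule that)
  obtain k k' where k: "u = k *\<^sub>R e" "u' = k' *\<^sub>R e"
    using one_dimensional_collinear[OF subspace_U True e] u u' by metis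
  have "e \<bullet> e = 1" using e(2) by (simp add: norm_eq_1)
  then have "k * k' = 0" using orth unfolding k inner_scaleR_left inner_scaleR_right by auto
  then show ?thesis by (auto simp: k)
next
  case False
  then have "dim U \<ge> 3" using assms(1) dim_U by linarith
  then show ?thesis using half_turn_fixing[OF subspace_U _ u u' orth] by metis
qed

lemma Ad_mix: "h \<in> SOxSO U W \<Longrightarrow> Ad h (mix i Z) = mix i (Ad h Z)"
  by (simp add: mix_def linear_add[OF linear_Ad] linear_diff[OF linear_Ad] H_Ad(5))

lemma mixed_space_model: "(t, Z, S, T) \<in> model_space U W \<longleftrightarrow> Z \<in> mixed_space U W \<and> S \<in> S20 U \<and> T \<in> S20 W"
  by (simp add: model_space_def mixed_space_def)

text \<open>The change of variable \<open>L\<close> acts on \<open>(U \<otimes> W) \<otimes> \<real>\<^sup>2\<close> alone and maps it onto itself, so the image of this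
  summand is unchanged.\<close>
lemma module_iso_twisted:
  assumes L: "linear L" and onto: "L ` mixed_space U W = mixed_space U W" and inj: "inj_on L (mixed_space U W)"
    and comm: "\<And>h Z. h \<in> SOxSO U W \<Longrightarrow> Z \<in> mixed_space U W \<Longrightarrow>
      L (\<chi> i. Ad h (Z $ i)) = (\<chi> i. Ad h (L Z $ i))"
  defines "\<Phi> \<equiv> \<lambda>(t, Z, S, T). canonical_iso U W (t, L Z, S, T)"
  shows "module_iso U W \<Phi>" "adapted_iso U W \<Phi>"
proof -
  define \<Lambda> :: "'n model \<Rightarrow> 'n model" where "\<Lambda> = (\<lambda>(t, Z, S, T). (t, L Z, S, T))"
  have \<Phi>: "\<Phi> = canonical_iso U W \<circ> \<Lambda>" by (auto simp: \<Phi>_def \<Lambda>_def fun_eq_iff)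
  have lin: "linear \<Lambda>"
    by (rule linearI) (auto simp: \<Lambda>_def linear_add[OF L] linear_scale[OF L])
  have "\<Lambda> ` model_space U W = model_space U W"
  proof
    show "\<Lambda> ` model_space U W \<subseteq> model_space U W"
      using onto by (auto simp: \<Lambda>_def mixed_space_model)
    show "model_space U W \<subseteq> \<Lambda> ` model_space U W"
    proof clarify
      fix t S T and Z :: "(real^'n^'n)^2" assume z: "(t, Z, S, T) \<in> model_space U W"
      then have "Z \<in> L ` mixed_space U W" by (simp only: onto mixed_space_model)
      then obtain Z' where "Z' \<in> mixed_space U W" "Z = L Z'" by blast
      then show "(t, Z, S, T) \<in> \<Lambda> ` model_space U W"
        using z by (intro image_eqI[of _ _ "(t, Z', S, T)"]) (simp_all add: \<Lambda>_def mixed_space_model)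
    qed
  qed
  moreover have "inj_on \<Lambda> (model_space U W)"
    using inj by (auto simp: inj_on_def \<Lambda>_def mixed_space_model)
  ultimately have "bij_betw \<Lambda> (model_space U W) (model_space U W)" by (simp add: bij_betw_def)
  moreover have "bij_betw (canonical_iso U W) (model_space U W) (m_space U W)"
    using inj_canonical canonical_onto by (simp add: bij_betw_def)
  ultimately have "bij_betw \<Phi> (model_space U W) (m_space U W)" unfolding \<Phi> by (rule bij_betw_trans)
  moreover have "linear \<Phi>" unfolding \<Phi> by (rule linear_compose[OF lin linear_canonical_iso])
  moreover have "\<Phi> (model_action h z) = Ad h (\<Phi> z)" if h: "h \<in> SOxSO U W" and z: "z \<in> model_space U W" for h z
  proof -
    have "\<Lambda> (model_action h z) = model_action h (\<Lambda> z)"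
      using comm[OF h] z by (cases z) (simp add: \<Lambda>_def model_action_def mixed_space_model)
    then show ?thesis by (simp add: \<Phi> canonical_equivariant[OF h])
  qed
  ultimately show "module_iso U W \<Phi>" by (simp add: module_iso_def)
  have "\<Phi> (t, 0, S, T) = t *\<^sub>R b_endo U W + S + T" for t S T
    by (simp add: \<Phi>_def canonical_iso_eq linear_0[OF L] linear_0[OF linear_mix_sum])
  moreover have "(\<lambda>Z. \<Phi> (0, Z, 0, 0)) ` mixed_space U W =
    {A + C | A C. A \<in> wedge_space U W \<and> C \<in> vee_space U W}"
  proof -
    have "(\<lambda>Z. \<Phi> (0, Z, 0, 0)) ` mixed_space U W = mix_sum ` L ` mixed_space U W"
      by (simp add: \<Phi>_def canonical_iso_eq image_image)
    also have "\<dots> = mix_sum ` mixed_space U W" by (simp only: onto)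
    also have "\<dots> = {A + C | A C. A \<in> wedge_space U W \<and> C \<in> vee_space U W}"
    proof (intro set_eqI iffI)
      fix X assume "X \<in> mix_sum ` mixed_space U W"
      then show "X \<in> {A + C | A C. A \<in> wedge_space U W \<and> C \<in> vee_space U W}"
        by (auto simp: mix_sum_def mix_def mixed_space_def wedge_space_eq vee_space_eq)
    next
      fix X assume "X \<in> {A + C | A C. A \<in> wedge_space U W \<and> C \<in> vee_space U W}"
      then obtain Z1 Z2 where Z: "X = (Z1 - transpose Z1) + (Z2 + transpose Z2)"
        "Z1 \<in> tensor_space U W" "Z2 \<in> tensor_space U W"
        unfolding wedge_space_eq vee_space_eq by blast
      then show "X \<in> mix_sum ` mixed_space U W"
        by (intro image_eqI[of _ _ "\<chi> i. if i = 1 then Z1 else Z2"])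
          (simp_all add: mix_sum_def mix_def mixed_space_def)
    qed
    finally show ?thesis .
  qed
  ultimately show "adapted_iso U W \<Phi>" by (simp add: adapted_iso_def mixed_space_def)
qed

end

context invariant_form
begin

text \<open>If \<open>dim U\<close> and \<open>dim W\<close> differ from 2, then for any two nonzero orthogonal vectors of \<open>U\<close> or of
  \<open>W\<close> there is a rotation reversing one and fixing the other, which forces the form on \<open>U \<otimes> W\<close> to be a multiple of
  the inner product in each factor.\<close>
lemma form_on_mixed:
  assumes "dim U \<noteq> 2" "dim W \<noteq> 2"
  obtains g where "\<And>Z Z'. Z \<in> tensor_space U W \<Longrightarrow> Z' \<in> tensor_space U W \<Longrightarrow>
    B (mix i Z) (mix j Z') = g * (Z \<bullet> Z')"
proof -
  interpret swap: invariant_form W U R P B by (rule invariant_form_swap)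
  define F where "F u w u' w' = B (mix i (tensor u w)) (mix j (tensor u' w'))" for u w u' w'
  have lin1: "linear (\<lambda>Z. B (mix i Z) Y)" for Y
    using linear_compose[OF linear_mix linear_B'] by (simp add: o_def)
  have lin2: "linear (\<lambda>Z. B Y (mix j Z))" for Y
    using linear_compose[OF linear_mix linear_B] by (simp add: o_def)
  have bilU: "bilinear (\<lambda>u u'. F u w u' w')" for w w'
    unfolding bilinear_def F_def
    using linear_compose[OF linear_tensor_left lin1] linear_compose[OF linear_tensor_left lin2]
    by (simp add: o_def)
  have bilW: "bilinear (\<lambda>w w'. F u w u' w')" for u u'
    unfolding bilinear_def F_def
    using linear_compose[OF linear_tensor_right lin1] linear_compose[OF linear_tensor_right lin2]
    by (simp add: o_def)
  have zero: "F 0 w u' w' = 0" "F u w 0 w' = 0" "F u 0 u' w' = 0" "F u w u' 0 = 0" for u w u' w'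
    by (simp_all add: F_def tensor_bilinear linear_0[OF linear_mix] B_simps)
  have invF: "F (h *v u) (h *v w) (h *v u') (h *v w') = F u w u' w'" if "h \<in> SOxSO U W" for h u w u' w'
    using inv[OF that, of "mix i (tensor u w)" "mix j (tensor u' w')"]
    by (simp add: Ad_mix[OF that] Ad_tensor[OF H_orthogonal[OF that]] F_def)
  have neg: "F (- u) w u' w' = - F u w u' w'" "F u (- w) u' w' = - F u w u' w'" for u w u' w'
    using bilinear_lneg[OF bilU] bilinear_lneg[OF bilW] by simp_all
  have orthU: "F u w u' w' = 0" if a: "u \<in> U" "u' \<in> U" "u \<bullet> u' = 0" "w \<in> W" "w' \<in> W" for u u' w w'
  proof -
    consider "u = 0" | "u' = 0" | h where "h \<in> SO U" "h *v u = - u" "h *v u' = u'"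
      using sign_change[OF assms(1) a(1-3)] by blast
    then show ?thesis
    proof cases
      case 3
      then have "h \<in> SOxSO U W" "h *v w = w" "h *v w' = w'"
        using SO_subset SO_U_vec(2) a(4,5) by auto
      then show ?thesis using invF[of h u w u' w'] 3 neg(1)[of u w u' w'] by simp
    qed (simp_all add: zero)
  qed
  have orthW: "F u w u' w' = 0" if a: "u \<in> U" "u' \<in> U" "w \<bullet> w' = 0" "w \<in> W" "w' \<in> W" for u u' w w'
  proof -
    consider "w = 0" | "w' = 0" | h where "h \<in> SO W" "h *v w = - w" "h *v w' = w'"
      using swap.sign_change[OF assms(2) a(4,5,3)] by blast
    then show ?thesis
    proof cases
      case 3
      then have "h \<in> SOxSO U W" "h *v u = u" "h *v u' = u'"
        using SO_subset swap.SO_U_vec(2) a(1,2) by auto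
      then show ?thesis using invF[of h u w u' w'] 3 neg(2)[of u w u' w'] by simp
    qed (simp_all add: zero)
  qed
  obtain e where e: "e \<in> U" "norm e = 1" by (rule unit_vector) (rule that)
  have 1: "F u w u' w' = F e w e w' * (u \<bullet> u')" if uw: "u \<in> U" "u' \<in> U" "w \<in> W" "w' \<in> W" for u w u' w'
  proof -
    obtain c where c: "\<And>u u'. u \<in> U \<Longrightarrow> u' \<in> U \<Longrightarrow> F u w u' w' = c * (u \<bullet> u')"
      using form_vanishing_on_orthogonal_pairs[OF bilU subspace_U orthU[OF _ _ _ uw(3,4)]] by blast
    have "F e w e w' = c" using c[OF e(1) e(1)] e(2) by (simp add: norm_eq_1)
    then show ?thesis using c[OF uw(1,2)] by simp
  qed
  obtain g where g: "\<And>w w'. w \<in> W \<Longrightarrow> w' \<in> W \<Longrightarrow> F e w e w' = g * (w \<bullet> w')"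
    using form_vanishing_on_orthogonal_pairs[OF bilW swap.subspace_U orthW[OF e(1) e(1)]] by blast
  have bil1: "bilinear (\<lambda>Z Z'. B (mix i Z) (mix j Z'))" unfolding bilinear_def using lin1 lin2 by blast
  have bil2: "bilinear (\<lambda>Z Z'::real^'n^'n. g * (Z \<bullet> Z'))"
    unfolding bilinear_def by (auto intro!: linearI simp: inner_add algebra_simps)
  have "B (mix i Z) (mix j Z') = g * (Z \<bullet> Z')" if Z: "Z \<in> tensor_space U W" "Z' \<in> tensor_space U W" for Z Z'
  proof (rule bilinear_eq[OF bil1 bil2 subset_refl subset_refl])
    show "Z \<in> span {tensor u w | u w. u \<in> U \<and> w \<in> W}" "Z' \<in> span {tensor u w | u w. u \<in> U \<and> w \<in> W}"
      using Z by (simp_all add: tensor_space_def)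
    fix X Y assume "X \<in> {tensor u w | u w. u \<in> U \<and> w \<in> W}" "Y \<in> {tensor u w | u w. u \<in> U \<and> w \<in> W}"
    then obtain u w u' w' where XY: "X = tensor u w" "Y = tensor u' w'" "u \<in> U" "u' \<in> U" "w \<in> W" "w' \<in> W" by blast
    show "B (mix i X) (mix j Y) = g * (X \<bullet> Y)"
      using 1[OF XY(3-6)] g[OF XY(5,6)] by (simp add: XY(1,2) F_def inner_tensor)
  qed
  then show ?thesis by (rule that)
qed

end

text \<open>An invariant Lorentzian scalar product on \<open>\<mm>\<close>, pulled back to all matrices: the radical is spanned by \<open>\<hh>\<close>
  and the identity. The index 1 enters through two of its consequences, the existence of a negative vector and the
  absence of two orthogonal ones.\<close>
locale lorentz_form = invariant_form U W P R B
  for U W :: "(real^'n) set" and P R :: "real^'n^'n" and B +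
  assumes B_one: "B X (mat 1) = 0"
    and B_h: "X \<in> so_plus_so U W \<Longrightarrow> B Y X = 0"
    and nondegenerate: "trace X = 0 \<Longrightarrow> (\<And>Y. B X Y = 0) \<Longrightarrow> X \<in> so_plus_so U W"
    and negative: "\<exists>X. B X X < 0"
    and no_two: "B X X < 0 \<Longrightarrow> B Y Y < 0 \<Longrightarrow> B X Y \<noteq> 0"
begin

lemma lorentz_form_swap: "lorentz_form W U R P B"
proof -
  interpret swap: invariant_form W U R P B by (rule invariant_form_swap)
  have "so_plus_so W U = so_plus_so U W"
  proof -
    have "{X + Y |X Y. X \<in> A \<and> Y \<in> C} = {X + Y |X Y. X \<in> C \<and> Y \<in> A}" for A C :: "(real^'n^'n) set"
      by (metis (no_types, opaque_lifting) add.commute)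
    then show ?thesis by (simp only: so_plus_so_def)
  qed
  then show ?thesis
  proof unfold_locales
    show "B X Y \<noteq> 0" if "B X X < 0" "B Y Y < 0" for X Y using no_two[OF that] .
    show "X \<in> so_plus_so W U" if "trace X = 0" "\<And>Y. B X Y = 0" for X
      unfolding \<open>so_plus_so W U = so_plus_so U W\<close> using nondegenerate[OF that] .
  qed (use B_one B_h negative \<open>so_plus_so W U = so_plus_so U W\<close> in simp_all)
qed

text \<open>The trace part and the component in \<open>\<hh>\<close> lie in the radical, which leaves the component in \<open>\<mm>\<close>.\<close>
lemma B_reduce:
  obtains z where "z \<in> model_space U W" "\<And>X. B X Y = B X (canonical_iso U W z)"
proof -
  define Y0 where "Y0 = Y - (trace Y / real CARD('n)) *\<^sub>R mat 1"
  have "trace Y0 = 0" by (simp add: Y0_def trace_ring trace_I)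
  then obtain z where z: "z \<in> model_space U W" "Y0 = h_part Y0 + canonical_iso U W z"
    using sl_decomposition by blast
  have "B X Y = B X (canonical_iso U W z)" for X
  proof -
    have Y: "Y = (trace Y / real CARD('n)) *\<^sub>R mat 1 + (h_part Y0 + canonical_iso U W z)"
      using z(2) by (simp add: Y0_def)
    have "B X Y = B X ((trace Y / real CARD('n)) *\<^sub>R mat 1 + (h_part Y0 + canonical_iso U W z))"
      using Y by simp
    then show ?thesis
      by (simp add: bilinear_radd[OF bil] bilinear_rmul[OF bil] B_one B_h[OF h_part_in])
  qed
  with z(1) show ?thesis by (rule that)
qed

lemma model_radical:
  assumes z: "z \<in> model_space U W"
    and 0: "\<And>y. y \<in> model_space U W \<Longrightarrow> B (canonical_iso U W z) (canonical_iso U W y) = 0"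
  shows "z = 0"
proof (rule canonical_kernel[OF z nondegenerate])
  show "trace (canonical_iso U W z) = 0" by (rule trace_canonical[OF z])
  show "B (canonical_iso U W z) Y = 0" for Y
    using B_reduce[of Y] 0 by metis
qed

lemma S20_b: "S \<in> S20 U \<Longrightarrow> B (b_endo U W) S = 0"
  using fixed_orthogonal_S20 Ad_b SO_subset by blast

lemma S20_mix_sum: "S \<in> S20 U \<Longrightarrow> Z \<in> mixed_space U W \<Longrightarrow> B S (mix_sum Z) = 0"
  by (rule mix_sum_vanish[where U = U and W = W, OF linear_B]) (use S20_orthogonal_mixed in blast)+

lemma S20_mix_sum_W: "T \<in> S20 W \<Longrightarrow> Z \<in> mixed_space U W \<Longrightarrow> B T (mix_sum Z) = 0"
proof -
  interpret swap: lorentz_form W U R P B by (rule lorentz_form_swap)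
  show "T \<in> S20 W \<Longrightarrow> Z \<in> mixed_space U W \<Longrightarrow> B T (mix_sum Z) = 0"
    by (rule mix_sum_vanish[where U = U and W = W, OF linear_B]) (use swap.S20_orthogonal_mixed in blast)+
qed

lemma S20_W_b: "T \<in> S20 W \<Longrightarrow> B (b_endo U W) T = 0"
proof -
  interpret swap: lorentz_form W U R P B by (rule lorentz_form_swap)
  show "T \<in> S20 W \<Longrightarrow> B (b_endo U W) T = 0"
    using swap.fixed_orthogonal_S20 Ad_b SO_subset by blast
qed

lemma S20_S20: "S \<in> S20 U \<Longrightarrow> T \<in> S20 W \<Longrightarrow> B S T = 0"
proof -
  interpret swap: lorentz_form W U R P B by (rule lorentz_form_swap)
  assume S: "S \<in> S20 U" and T: "T \<in> S20 W"
  have "B T S = 0"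
    using fixed_orthogonal_S20[OF Ad_fix_W_block S] T by (simp add: swap.S20_U)
  then show ?thesis using sym by simp
qed

text \<open>The coefficient is not zero since the form is nondegenerate on \<open>\<mm>\<close>, and not negative since \<open>x\<^sup>2 - z\<^sup>2\<close> and
  \<open>x z + z x\<close> would be two orthogonal negative vectors. If \<open>dim U = 1\<close> the space is 0.\<close>
lemma S20_positive:
  obtains k where "k > 0" "\<And>X Y. X \<in> S20 U \<Longrightarrow> Y \<in> S20 U \<Longrightarrow> B X Y = k * (X \<bullet> Y)"
proof (cases "dim U = 1")
  case True
  then show ?thesis using that[of 1] S20_one_dimensional by (metis B_simps(9) inner_zero_left mult_zero_right zero_less_one)
next
  case False
  then have d: "dim U \<ge> 2" using dim_U by simp
  obtain k where k: "\<And>X Y. X \<in> S20 U \<Longrightarrow> Y \<in> S20 U \<Longrightarrow> B X Y = k * (X \<bullet> Y)"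
    using form_on_S20 by blast
  obtain x where x: "x \<in> U" "norm x = 1" by (rule unit_vector) (rule that)
  obtain z where z: "z \<in> U" "norm z = 1" "x \<bullet> z = 0"
    using unit_orthogonal_exists[OF subspace_U, of "{x}"] d x by auto
  have ip: "x \<bullet> x = 1" "z \<bullet> z = 1" "z \<bullet> x = 0" "x \<bullet> z = 0" using x(2) z(2,3) by (auto simp: norm_eq_1 inner_commute)
  define D where "D = tensor x x - tensor z z"
  define E where "E = tensor x z + tensor z x"
  have Pxz: "P *v x = x" "P *v z = z" using x z by (simp_all add: U_iff)
  have m: "P ** tensor a b ** P = tensor a b" if "P *v a = a" "P *v b = b" for a b
    using that tensor_mul_matrix[of a b P, unfolded P_sym] by (simp add: matrix_mul_tensor)
  have DS: "D \<in> S20 U" and ES: "E \<in> S20 U"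
    by (simp_all add: S20_U D_def E_def matrix_sub_ldistrib matrix_sub_rdistrib matrix_add_ldistrib
        matrix_mul_add_left m Pxz transpose_ring transpose_tensor trace_ring trace_tensor ip add.commute)
  have DE: "D \<bullet> E = 0" "D \<bullet> D = 2" "E \<bullet> E = 2"
    by (simp_all add: D_def E_def inner_add inner_diff_left inner_diff_right inner_tensor ip)
  have "k \<noteq> 0"
  proof
    assume "k = 0"
    have "(0, 0, D, 0) = (0 :: 'n model)"
    proof (rule model_radical)
      show m: "(0, 0, D, 0) \<in> model_space U W"
        using DS by (simp add: model_space_def S20_def tensor_space_def transpose_zero trace_zero span_0)
      fix y assume y: "y \<in> model_space U W"
      obtain t Z S T where yy: "y = (t, Z, S, T)" by (metis prod.exhaust)
      have y': "Z \<in> mixed_space U W" "S \<in> S20 U" "T \<in> S20 W" using y by (auto simp: yy mixed_space_model)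
      have "B D (canonical_iso U W y) = 0"
        using S20_b[OF DS] sym[of D "b_endo U W"] S20_mix_sum[OF DS y'(1)] k[OF DS y'(2)] S20_S20[OF DS y'(3)] \<open>k = 0\<close>
        by (simp add: yy canonical_iso_eq bilinear_radd[OF bil] bilinear_rmul[OF bil])
      then show "B (canonical_iso U W (0, 0, D, 0)) (canonical_iso U W y) = 0"
        by (simp add: canonical_iso_eq linear_0[OF linear_mix_sum])
    qed
    then have "D = 0" by (simp add: zero_prod_def)
    then show False using DE(2) by simp
  qed
  moreover have "\<not> k < 0"
  proof
    assume "k < 0"
    then have "B D D < 0" "B E E < 0" "B D E = 0" using k[OF DS DS] k[OF ES ES] k[OF DS ES] DE by auto
    then show False using no_two by blast
  qed
  ultimately have "k > 0" by simp
  then show ?thesis using k by (rule that)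
qed

lemma b_mix_sum:
  assumes "dim U + dim W \<ge> 3" "Z \<in> mixed_space U W"
  shows "B (b_endo U W) (mix_sum Z) = 0"
proof (rule mix_sum_vanish[OF linear_B _ assms(2)])
  interpret swap: lorentz_form W U R P B by (rule lorentz_form_swap)
  fix u w assume uw: "u \<in> U" "w \<in> W"
  have "dim U \<ge> 2 \<or> dim W \<ge> 2" using assms(1) by linarith
  then show "B (b_endo U W) (tensor u w) = 0 \<and> B (b_endo U W) (tensor w u) = 0"
    using fixed_orthogonal_mixed[OF _ _ uw] swap.fixed_orthogonal_mixed[OF _ _ uw(2,1)] Ad_b SO_subset
    by (meson subsetD)
qed

lemma block_form:
  assumes n: "dim U + dim W \<ge> 3"
    and x: "(t, Z, S, T) \<in> model_space U W" and y: "(t', Z', S', T') \<in> model_space U W"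
  shows "B (canonical_iso U W (t, Z, S, T)) (canonical_iso U W (t', Z', S', T')) =
    t * t' * B (b_endo U W) (b_endo U W) + B (mix_sum Z) (mix_sum Z') + B S S' + B T T'"
proof -
  let ?b = "b_endo U W"
  have x': "Z \<in> mixed_space U W" "S \<in> S20 U" "T \<in> S20 W" using x by (auto simp: mixed_space_model)
  have y': "Z' \<in> mixed_space U W" "S' \<in> S20 U" "T' \<in> S20 W" using y by (auto simp: mixed_space_model)
  have 1: "B ?b (mix_sum Z') = 0" "B ?b S' = 0" "B ?b T' = 0"
    using b_mix_sum[OF n] S20_b S20_W_b y' by auto
  have 2: "B (mix_sum Z) ?b = 0" "B (mix_sum Z) S' = 0" "B (mix_sum Z) T' = 0"
    using b_mix_sum[OF n x'(1)] S20_mix_sum[OF y'(2) x'(1)] S20_mix_sum_W[OF y'(3) x'(1)]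
    by (simp_all add: sym[of "mix_sum Z"])
  have 3: "B S ?b = 0" "B S (mix_sum Z') = 0" "B S T' = 0"
    using S20_b[OF x'(2)] S20_mix_sum[OF x'(2) y'(1)] S20_S20[OF x'(2) y'(3)] sym[of S ?b] by simp_all
  have 4: "B T ?b = 0" "B T (mix_sum Z') = 0" "B T S' = 0"
    using S20_W_b[OF x'(3)] S20_mix_sum_W[OF x'(3) y'(1)] S20_S20[OF y'(2) x'(3)] sym[of T ?b] sym[of T S']
    by simp_all
  show ?thesis
    by (simp add: canonical_iso_eq bilinear_ladd[OF bil] bilinear_radd[OF bil] bilinear_lmul[OF bil]
        bilinear_rmul[OF bil] 1 2 3 4)
qed

end

section \<open>Positivity and the normal form\<close>

lemma inner_pair_matrices: "(Z::(real^'n^'n)^2) \<bullet> Z' = Z$1 \<bullet> Z'$1 + Z$2 \<bullet> Z'$2"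
  by (simp add: inner_vec_def sum_2)

lemma euclidean_scalar_product_inner:
  "euclidean_scalar_product_on UNIV (\<lambda>c d :: 'a::real_inner. c \<bullet> d)"
  by (auto simp: euclidean_scalar_product_on_def symmetric_form_on_def inner_add_left intro: inner_commute)

context lorentz_form
begin

lemma mix_sum_blocks:
  assumes "Z \<in> mixed_space U W"
  shows "P ** mix_sum Z ** P = 0" "R ** mix_sum Z ** R = 0"
proof -
  have "(0, Z, 0, 0) \<in> model_space U W"
    using assms by (simp add: mixed_space_model S20_def tensor_space_def transpose_zero trace_zero span_0)
  from canonical_components(3,4)[OF this] show "P ** mix_sum Z ** P = 0" "R ** mix_sum Z ** R = 0"
    by (simp_all add: canonical_iso_eq)
qed

text \<open>If \<open>dim U = 2\<close>, the quarter turn \<open>h\<close> of \<open>U\<close> is a complex structure on the mixed summands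
  preserving \<open>B\<close>. Hence \<open>B X (h X) = 0\<close>, and a negative vector \<open>X\<close> comes with a second one.\<close>
lemma complex_structure_nonneg:
  assumes d: "dim U = 2" and X: "P ** X ** P = 0" "R ** X ** R = 0"
  shows "B X X \<ge> 0"
proof -
  obtain x where x: "x \<in> U" "norm x = 1" by (rule unit_vector) (rule that)
  obtain z where z: "z \<in> U" "norm z = 1" "x \<bullet> z = 0"
    using unit_orthogonal_exists[OF subspace_U, of "{x}"] d x by auto
  have ip: "x \<bullet> x = 1" "z \<bullet> z = 1" "z \<bullet> x = 0" "x \<bullet> z = 0" using x(2) z(2,3) by (auto simp: norm_eq_1 inner_commute)
  have basis: "u = (x \<bullet> u) *\<^sub>R x + (z \<bullet> u) *\<^sub>R z" if u: "u \<in> U" for u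
  proof (rule ccontr)
    define r where "r = u - ((x \<bullet> u) *\<^sub>R x + (z \<bullet> u) *\<^sub>R z)"
    assume "u \<noteq> (x \<bullet> u) *\<^sub>R x + (z \<bullet> u) *\<^sub>R z"
    then have r: "r \<noteq> 0" by (simp add: r_def)
    have rU: "r \<in> U" using u x z subspace_U by (simp add: r_def subspace_diff subspace_add subspace_scale)
    have o: "x \<bullet> r = 0" "z \<bullet> r = 0" by (simp_all add: r_def inner_diff_right inner_add_right ip)
    have nz: "x \<noteq> 0" "z \<noteq> 0" using x z by auto
    have ne: "x \<noteq> z" "x \<noteq> r" "z \<noteq> r" using ip o r by auto
    have "pairwise orthogonal {x, z, r}"
      using o ip by (auto simp: pairwise_def orthogonal_def inner_commute)
    then have "independent {x, z, r}"
      using r nz by (intro pairwise_orthogonal_independent) auto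
    then have "card {x, z, r} \<le> dim U" using x z rU by (intro independent_card_le_dim) auto
    then show False using ne d by simp
  qed
  define h where "h = plane_rotation x z (pi/2)"
  have hSO: "h \<in> SO U" unfolding h_def by (rule plane_rotation_in_SO[OF x(2) z(2,3) x(1) z(1)])
  note o = SO_orthogonal[OF hSO]
  have "h ** h = plane_rotation x z pi" by (simp add: h_def plane_rotation_add[OF x(2) z(2,3)])
  also have "\<dots> = R - P"
  proof -
    have "plane_rotation x z pi *v v = (R - P) *v v" for v
    proof -
      have Pv: "P *v v = (x \<bullet> v) *\<^sub>R x + (z \<bullet> v) *\<^sub>R z"
        using basis[OF P_in_U[of v]] inner_P[of x v] inner_P[of z v] x(1) z(1) by (simp add: U_iff)
      have "R *v v = v - P *v v" using vec_split[of v] by (simp add: eq_diff_eq add.commute)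
      then have "(R - P) *v v = v - P *v v - P *v v" by (simp add: matrix_vector_mult_diff_rdistrib)
      then show ?thesis unfolding Pv by (simp add: plane_rotation_vec vec_eq_iff)
    qed
    then show ?thesis by (simp add: matrix_eq)
  qed
  finally have hh: "h ** h = R - P" .
  have XX: "X = P ** X ** R + R ** X ** P"
  proof -
    have "X = (P + R) ** X ** (P + R)" by (simp add: PR_sum)
    also have "\<dots> = P ** X ** P + R ** X ** R + (P ** X ** R + R ** X ** P)" by (simp add: matrix_ring)
    finally show ?thesis using X by simp
  qed
  define Y where "Y = Ad h X"
  have "Ad h Y = (h ** h) ** X ** transpose (h ** h)"
    unfolding Y_def Ad_orthogonal[OF o] matrix_transpose_mul by (simp only: matrix_mul_assoc)
  also have "\<dots> = P ** X ** P + R ** X ** R - (P ** X ** R + R ** X ** P)"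
    unfolding hh by (simp add: matrix_ring transpose_ring P_sym R_sym)
  also have "\<dots> = - X" using X XX by simp
  finally have "Ad h Y = - X" .
  then have "B X Y = - B Y X"
    using inv_U[OF hSO, of X Y] by (simp add: Y_def[symmetric] bilinear_rneg[OF bil])
  then have "B X Y = 0" using sym[of X Y] by simp
  moreover have "B Y Y = B X X" unfolding Y_def by (rule inv_U[OF hSO])
  ultimately show ?thesis using no_two[of X Y] by linarith
qed

lemma generic_mixed_form:
  assumes "dim U \<noteq> 2" "dim W \<noteq> 2"
  obtains g :: "2 \<Rightarrow> 2 \<Rightarrow> real" where "g 1 2 = g 2 1"
    "\<And>Z Z'. Z \<in> mixed_space U W \<Longrightarrow> Z' \<in> mixed_space U W \<Longrightarrow>
      B (mix_sum Z) (mix_sum Z') = g 1 1 * (Z$1 \<bullet> Z'$1) + g 1 2 * (Z$1 \<bullet> Z'$2)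
        + g 2 1 * (Z$2 \<bullet> Z'$1) + g 2 2 * (Z$2 \<bullet> Z'$2)"
proof -
  have "\<exists>g. \<forall>Z\<in>tensor_space U W. \<forall>Z'\<in>tensor_space U W. B (mix i Z) (mix j Z') = g * (Z \<bullet> Z')" for i j
    by (rule form_on_mixed[OF assms, of i j]) blast
  then have "\<exists>g. \<forall>i j. \<forall>Z\<in>tensor_space U W. \<forall>Z'\<in>tensor_space U W. B (mix i Z) (mix j Z') = g i j * (Z \<bullet> Z')"
    by (intro choice allI)
  then obtain g where g: "\<And>i j Z Z'. Z \<in> tensor_space U W \<Longrightarrow> Z' \<in> tensor_space U W \<Longrightarrow>
    B (mix i Z) (mix j Z') = g i j * (Z \<bullet> Z')" by blast
  obtain u where u: "u \<in> U" "norm u = 1" by (rule unit_vector) (rule that)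
  interpret swap: lorentz_form W U R P B by (rule lorentz_form_swap)
  obtain w where w: "w \<in> W" "norm w = 1" by (rule swap.unit_vector) (rule that)
  have t: "tensor u w \<in> tensor_space U W" unfolding tensor_space_def using u w by (blast intro: span_base)
  have "tensor u w \<bullet> tensor u w = 1" using u w by (simp add: inner_tensor norm_eq_1)
  then have "g 1 2 = g 2 1"
    using g[OF t t, of 1 2] g[OF t t, of 2 1] sym[of "mix 1 (tensor u w)"] by simp
  then show ?thesis
  proof (rule that)
    fix Z Z' assume "Z \<in> mixed_space U W" "Z' \<in> mixed_space U W"
    then have "Z$i \<in> tensor_space U W" "Z'$i \<in> tensor_space U W" for i by (auto simp: mixed_space_def)
    then show "B (mix_sum Z) (mix_sum Z') = g 1 1 * (Z$1 \<bullet> Z'$1) + g 1 2 * (Z$1 \<bullet> Z'$2)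
        + g 2 1 * (Z$2 \<bullet> Z'$1) + g 2 2 * (Z$2 \<bullet> Z'$2)"
      by (simp add: mix_sum_def bilinear_ladd[OF bil] bilinear_radd[OF bil] g)
  qed
qed

text \<open>If neither dimension is 2, then the form is \<open>g\<^sub>1 \<otimes> \<gamma>\<close>, and a negative vector \<open>c\<close> of \<open>\<gamma>\<close> yields the negative vectors
  \<open>(u \<otimes> w) \<otimes> c\<close>. Two of these are orthogonal because \<open>U\<close> or \<open>W\<close> contains two orthogonal vectors.\<close>
lemma generic_nonneg:
  assumes n: "dim U + dim W \<ge> 3" and d: "dim U \<noteq> 2" "dim W \<noteq> 2" and Z: "Z \<in> mixed_space U W"
  shows "B (mix_sum Z) (mix_sum Z) \<ge> 0"
proof (rule ccontr)
  interpret swap: lorentz_form W U R P B by (rule lorentz_form_swap)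
  assume "\<not> B (mix_sum Z) (mix_sum Z) \<ge> 0"
  obtain g :: "2 \<Rightarrow> 2 \<Rightarrow> real" where "g 1 2 = g 2 1" and g: "\<And>Z Z'. Z \<in> mixed_space U W \<Longrightarrow> Z' \<in> mixed_space U W \<Longrightarrow>
      B (mix_sum Z) (mix_sum Z') = g 1 1 * (Z$1 \<bullet> Z'$1) + g 1 2 * (Z$1 \<bullet> Z'$2)
        + g 2 1 * (Z$2 \<bullet> Z'$1) + g 2 2 * (Z$2 \<bullet> Z'$2)"
    by (rule generic_mixed_form[OF d]) (rule that)
  define q where "q a b = g 1 1 * (a * a) + g 1 2 * (a * b) + g 2 1 * (b * a) + g 2 2 * (b * b)" for a b
  have "B (mix_sum Z) (mix_sum Z) = (\<Sum>r\<in>UNIV. \<Sum>s\<in>UNIV. q (Z$1$r$s) (Z$2$r$s))"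
  proof -
    have "Z$i \<bullet> Z$j = (\<Sum>r\<in>UNIV. \<Sum>s\<in>UNIV. Z$i$r$s * Z$j$r$s)" for i j
      by (simp add: inner_vec_def)
    then show ?thesis unfolding g[OF Z Z] by (simp only: q_def sum.distrib sum_distrib_left)
  qed
  then have "\<not> (\<Sum>r\<in>UNIV. \<Sum>s\<in>UNIV. q (Z$1$r$s) (Z$2$r$s)) \<ge> 0"
    using \<open>\<not> B (mix_sum Z) (mix_sum Z) \<ge> 0\<close> by simp
  then have "\<not> (\<forall>r s. q (Z$1$r$s) (Z$2$r$s) \<ge> 0)"
    by (metis (no_types, lifting) sum_nonneg)
  then obtain a b where ab: "q a b < 0" by (meson not_le)
  obtain u where u: "u \<in> U" "norm u = 1" by (rule unit_vector) (rule that)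
  obtain w where w: "w \<in> W" "norm w = 1" by (rule swap.unit_vector) (rule that)
  obtain u' w' where uw': "u' \<in> U" "norm u' = 1" "w' \<in> W" "norm w' = 1" "(u \<bullet> u') * (w \<bullet> w') = 0"
  proof (cases "dim U \<ge> 2")
    case True
    then obtain f where "f \<in> U" "norm f = 1" "u \<bullet> f = 0"
      using unit_orthogonal_exists[OF subspace_U, of "{u}"] u by auto
    then show ?thesis using that[of f w] w by simp
  next
    case False
    then have "dim W \<ge> 2" using n by linarith
    then obtain f where "f \<in> W" "norm f = 1" "w \<bullet> f = 0"
      using unit_orthogonal_exists[OF swap.subspace_U, of "{w}"] w by auto
    then show ?thesis using that[of u f] u by simp
  qed
  define V :: "real^'n^'n \<Rightarrow> (real^'n^'n)^2" where "V x = (\<chi> i. (if i = 1 then a else b) *\<^sub>R x)" for x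
  have "tensor x y \<in> tensor_space U W" if "x \<in> U" "y \<in> W" for x y
    unfolding tensor_space_def using that by (blast intro: span_base)
  then have t: "tensor u w \<in> tensor_space U W" "tensor u' w' \<in> tensor_space U W"
    using u(1) w(1) uw'(1,3) by simp_all
  have VE: "V x \<in> mixed_space U W" if "x \<in> tensor_space U W" for x
    using that subspace_tensor_space[of U W] by (simp add: V_def mixed_space_def subspace_scale)
  have VB: "B (mix_sum (V x)) (mix_sum (V y)) = q a b * (x \<bullet> y)"
    if "x \<in> tensor_space U W" "y \<in> tensor_space U W" for x y
    unfolding g[OF VE[OF that(1)] VE[OF that(2)]] by (simp add: V_def q_def algebra_simps)
  have "tensor u w \<bullet> tensor u w = 1" "tensor u' w' \<bullet> tensor u' w' = 1" "tensor u w \<bullet> tensor u' w' = 0"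
    using u w uw' by (simp_all add: inner_tensor norm_eq_1)
  then show False
    using no_two[of "mix_sum (V (tensor u w))" "mix_sum (V (tensor u' w'))"] ab
    by (simp add: VB[OF t(1) t(1)] VB[OF t(2) t(2)] VB[OF t(1) t(2)])
qed

lemma mixed_nonneg:
  assumes n: "dim U + dim W \<ge> 3" and Z: "Z \<in> mixed_space U W"
  shows "B (mix_sum Z) (mix_sum Z) \<ge> 0"
proof -
  interpret swap: lorentz_form W U R P B by (rule lorentz_form_swap)
  consider "dim U = 2" | "dim W = 2" | "dim U \<noteq> 2" "dim W \<noteq> 2" by blast
  then show ?thesis
    using complex_structure_nonneg[OF _ mix_sum_blocks[OF Z]]
      swap.complex_structure_nonneg[OF _ mix_sum_blocks(2,1)[OF Z]] generic_nonneg[OF n _ _ Z]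
    by cases auto
qed

lemma bilinear_mixed: "bilinear (\<lambda>Z Z'. B (mix_sum Z) (mix_sum Z'))"
  unfolding bilinear_def
  using linear_compose[OF linear_mix_sum linear_B] linear_compose[OF linear_mix_sum linear_B']
  by (simp add: o_def)

text \<open>A null vector of the semidefinite form would lie in the radical of \<open>B\<close>, by \<open>block_form\<close>.\<close>
lemma mixed_positive:
  assumes n: "dim U + dim W \<ge> 3" and Z: "Z \<in> mixed_space U W" "Z \<noteq> 0"
  shows "B (mix_sum Z) (mix_sum Z) > 0"
proof (rule ccontr)
  assume "\<not> B (mix_sum Z) (mix_sum Z) > 0"
  then have 0: "B (mix_sum Z) (mix_sum Z) = 0" using mixed_nonneg[OF n Z(1)] by linarith
  have rad: "B (mix_sum Z) (mix_sum Z') = 0" if "Z' \<in> mixed_space U W" for Z'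
    using isotropic_imp_radical[OF bilinear_mixed sym subspace_mixed_space mixed_nonneg[OF n] Z(1) 0 that] .
  have z: "(0, Z, 0, 0) \<in> model_space U W"
    using Z by (simp add: mixed_space_model S20_def tensor_space_def transpose_zero trace_zero span_0)
  have "(0, Z, 0, 0) = (0 :: 'n model)"
  proof (rule model_radical[OF z])
    fix y assume y: "y \<in> model_space U W"
    obtain t Z' S T where yy: "y = (t, Z', S, T)" by (metis prod.exhaust)
    have "Z' \<in> mixed_space U W" using y by (simp add: yy mixed_space_model)
    then show "B (canonical_iso U W (0, Z, 0, 0)) (canonical_iso U W y) = 0"
      using block_form[OF n z y[unfolded yy]] by (simp add: yy rad bilinear_lzero[OF bil])
  qed
  then show False using Z(2) by (simp add: zero_prod_def)
qed

text \<open>There is a negative vector, and the other summands contribute nonnegative terms to its square.\<close>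
lemma b_negative:
  assumes n: "dim U + dim W \<ge> 3"
  shows "B (b_endo U W) (b_endo U W) < 0"
proof -
  interpret swap: lorentz_form W U R P B by (rule lorentz_form_swap)
  obtain X where X: "B X X < 0" using negative by blast
  obtain z where z: "z \<in> model_space U W" "\<And>Y. B Y X = B Y (canonical_iso U W z)"
    by (rule B_reduce[of X]) (rule that)
  have "B X X = B (canonical_iso U W z) (canonical_iso U W z)"
    using z(2)[of X] z(2)[of "canonical_iso U W z"] sym[of X "canonical_iso U W z"] by (simp only:)
  moreover obtain t Z S T where zz: "z = (t, Z, S, T)" by (metis prod.exhaust)
  moreover have m: "Z \<in> mixed_space U W" "S \<in> S20 U" "T \<in> S20 W" using z(1) by (auto simp: zz mixed_space_model)
  moreover obtain k where "k > 0" and k: "\<And>X Y. X \<in> S20 U \<Longrightarrow> Y \<in> S20 U \<Longrightarrow> B X Y = k * (X \<bullet> Y)"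
    by (rule S20_positive) (rule that)
  moreover obtain l where "l > 0" and l: "\<And>X Y. X \<in> S20 W \<Longrightarrow> Y \<in> S20 W \<Longrightarrow> B X Y = l * (X \<bullet> Y)"
    by (rule swap.S20_positive) (rule that)
  ultimately have "t * t * B (b_endo U W) (b_endo U W) + B (mix_sum Z) (mix_sum Z) + k * (S \<bullet> S) + l * (T \<bullet> T) < 0"
    using X block_form[OF n z(1)[unfolded zz] z(1)[unfolded zz]] k[OF m(2) m(2)] l[OF m(3) m(3)] by simp
  moreover have "k * (S \<bullet> S) \<ge> 0" "l * (T \<bullet> T) \<ge> 0" using \<open>k > 0\<close> \<open>l > 0\<close> by simp_all
  ultimately have "t * t * B (b_endo U W) (b_endo U W) < 0" using mixed_nonneg[OF n m(1)] by linarith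
  then show ?thesis by (simp add: mult_less_0_iff not_square_less_zero)
qed

text \<open>If one of the dimensions is 2, then \<open>\<gamma>\<close> is the standard product of \<open>\<real>\<^sup>2\<close>, all the information being
  contained in \<open>L\<close>.\<close>
lemma mixed_normalization:
  assumes n: "dim U + dim W \<ge> 3"
  obtains L \<gamma> where "linear L" "L ` mixed_space U W = mixed_space U W" "inj_on L (mixed_space U W)"
    "\<And>h Z. h \<in> SOxSO U W \<Longrightarrow> Z \<in> mixed_space U W \<Longrightarrow> L (\<chi> i. Ad h (Z $ i)) = (\<chi> i. Ad h (L Z $ i))"
    "dim U \<noteq> 2 \<Longrightarrow> dim W \<noteq> 2 \<Longrightarrow> L = (\<lambda>Z. Z)"
    "euclidean_scalar_product_on UNIV (\<gamma> :: real^2 \<Rightarrow> real^2 \<Rightarrow> real)"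
    "\<And>Z Z'. Z \<in> mixed_space U W \<Longrightarrow> Z' \<in> mixed_space U W \<Longrightarrow>
      B (mix_sum (L Z)) (mix_sum (L Z')) =
        (\<Sum>i\<in>UNIV. \<Sum>j\<in>UNIV. (Z $ i \<bullet> Z' $ j) * \<gamma> (axis i 1) (axis j 1))"
proof (cases "dim U \<noteq> 2 \<and> dim W \<noteq> 2")
  case True
  then have d: "dim U \<noteq> 2" "dim W \<noteq> 2" by auto
  interpret swap: lorentz_form W U R P B by (rule lorentz_form_swap)
  obtain g :: "2 \<Rightarrow> 2 \<Rightarrow> real" where gs: "g 1 2 = g 2 1" and g: "\<And>Z Z'. Z \<in> mixed_space U W \<Longrightarrow> Z' \<in> mixed_space U W \<Longrightarrow>
      B (mix_sum Z) (mix_sum Z') = g 1 1 * (Z$1 \<bullet> Z'$1) + g 1 2 * (Z$1 \<bullet> Z'$2)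
        + g 2 1 * (Z$2 \<bullet> Z'$1) + g 2 2 * (Z$2 \<bullet> Z'$2)"
    by (rule generic_mixed_form[OF d]) (rule that)
  define \<gamma> :: "real^2 \<Rightarrow> real^2 \<Rightarrow> real" where
    "\<gamma> c d = g 1 1 * (c$1 * d$1) + g 1 2 * (c$1 * d$2) + g 2 1 * (c$2 * d$1) + g 2 2 * (c$2 * d$2)" for c d
  have symg: "symmetric_form_on UNIV \<gamma>"
    unfolding symmetric_form_on_def \<gamma>_def by (auto simp: gs algebra_simps)
  have pos: "\<gamma> c c > 0" if "c \<noteq> 0" for c
  proof -
    obtain u where u: "u \<in> U" "norm u = 1" by (rule unit_vector) (rule that)
    obtain w where w: "w \<in> W" "norm w = 1" by (rule swap.unit_vector) (rule that)
    have t: "tensor u w \<in> tensor_space U W" unfolding tensor_space_def using u w by (blast intro: span_base)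
    have tt: "tensor u w \<bullet> tensor u w = 1" using u w by (simp add: inner_tensor norm_eq_1)
    define Z :: "(real^'n^'n)^2" where "Z = (\<chi> i. c$i *\<^sub>R tensor u w)"
    have ZE: "Z \<in> mixed_space U W"
      using t subspace_tensor_space[of U W] by (simp add: Z_def mixed_space_def subspace_scale)
    have "Z \<noteq> 0"
    proof
      assume "Z = 0"
      then have "Z $ i = 0" for i by simp
      then have "c$i *\<^sub>R tensor u w = 0" for i unfolding Z_def vec_lambda_beta .
      moreover have "tensor u w \<noteq> 0" using tt by auto
      ultimately have "c$i = 0" for i unfolding scaleR_eq_0_iff by blast
      then have "c = 0" by (simp add: vec_eq_iff)
      then show False using that by simp
    qed
    then have "B (mix_sum Z) (mix_sum Z) > 0" by (rule mixed_positive[OF n ZE])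
    then show ?thesis unfolding g[OF ZE ZE] by (simp add: Z_def tt \<gamma>_def mult.commute)
  qed
  show ?thesis
  proof (rule that[of "\<lambda>Z. Z" \<gamma>])
    show "euclidean_scalar_product_on UNIV \<gamma>" using symg pos by (simp add: euclidean_scalar_product_on_def)
    show "B (mix_sum Z) (mix_sum Z') = (\<Sum>i\<in>UNIV. \<Sum>j\<in>UNIV. (Z $ i \<bullet> Z' $ j) * \<gamma> (axis i 1) (axis j 1))"
      if "Z \<in> mixed_space U W" "Z' \<in> mixed_space U W" for Z Z'
      unfolding g[OF that] by (simp add: sum_2 \<gamma>_def axis_def)
  qed (simp_all add: linear_id[unfolded id_def])
next
  case False
  let ?E = "mixed_space U W" and ?B = "\<lambda>Z Z'. B (mix_sum Z) (mix_sum Z')"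
  define A where "A = (\<lambda>h (Z :: (real^'n^'n)^2). \<chi> i. Ad h (Z $ i)) ` SOxSO U W"
  have lin: "linear f" if "f \<in> A" for f
    using that by (auto simp: A_def vec_eq_iff linear_add[OF linear_Ad] linear_scale[OF linear_Ad] intro!: linearI)
  have "\<exists>L. linear L \<and> (\<forall>x\<in>?E. L x \<in> ?E) \<and> (\<forall>f\<in>A. \<forall>x\<in>?E. L (f x) = f (L x)) \<and>
    (\<forall>x\<in>?E. \<forall>y\<in>?E. ?B (L x) (L y) = x \<bullet> y)"
  proof (rule equivariant_normalization[OF bilinear_mixed sym subspace_mixed_space mixed_positive[OF n] lin])
    fix f and Z Z' :: "(real^'n^'n)^2" assume "f \<in> A"
    then obtain h where h: "h \<in> SOxSO U W" "f = (\<lambda>Z. \<chi> i. Ad h (Z $ i))" by (auto simp: A_def)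
    show "f Z \<in> ?E" if "Z \<in> ?E" using that Ad_UW[OF h(1)] by (simp add: h(2) mixed_space_def)
    show "f Z \<bullet> f Z' = Z \<bullet> Z'" by (simp add: h(2) inner_pair_matrices inner_Ad[OF H_orthogonal[OF h(1)]])
    have "mix_sum (f Z) = Ad h (mix_sum Z)" for Z
      by (simp add: h(2) mix_sum_def linear_add[OF linear_Ad] Ad_mix[OF h(1)])
    then show "?B (f Z) (f Z') = ?B Z Z'" by (simp add: inv[OF h(1)])
  qed
  then obtain L where L: "linear L" "\<And>x. x \<in> ?E \<Longrightarrow> L x \<in> ?E" "\<And>f x. f \<in> A \<Longrightarrow> x \<in> ?E \<Longrightarrow> L (f x) = f (L x)"
    "\<And>x y. x \<in> ?E \<Longrightarrow> y \<in> ?E \<Longrightarrow> ?B (L x) (L y) = x \<bullet> y" by blast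
  have inj: "x = 0" if "x \<in> ?E" "L x = 0" for x
    using L(4)[OF that(1) that(1)] that(2) by (simp add: linear_0[OF linear_mix_sum] bilinear_lzero[OF bil])
  show ?thesis
  proof (rule that[OF L(1) injective_endomorphism_onto[OF L(1) subspace_mixed_space L(2) inj]])
    show "L (\<chi> i. Ad h (Z $ i)) = (\<chi> i. Ad h (L Z $ i))" if "h \<in> SOxSO U W" "Z \<in> ?E" for h Z
      using L(3)[of "\<lambda>Z. \<chi> i. Ad h (Z $ i)" Z] that by (simp add: A_def)
    show "euclidean_scalar_product_on UNIV (\<lambda>c d :: real^2. c \<bullet> d)"
      by (rule euclidean_scalar_product_inner)
    show "?B (L Z) (L Z') = (\<Sum>i\<in>UNIV. \<Sum>j\<in>UNIV. (Z $ i \<bullet> Z' $ j) * (axis i 1 \<bullet> axis j (1::real)))"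
      if "Z \<in> ?E" "Z' \<in> ?E" for Z Z'
      unfolding L(4)[OF that] by (simp add: sum_2 inner_pair_matrices inner_axis_axis)
    show "L = (\<lambda>Z. Z)" if "dim U \<noteq> 2" "dim W \<noteq> 2" using that False by blast
  qed
qed

lemma normal_form:
  assumes n: "dim U + dim W \<ge> 3"
  shows "\<exists>\<Phi> l1 \<gamma> l2 l3. module_iso U W \<Phi> \<and> adapted_iso U W \<Phi> \<and>
    (dim U \<noteq> 2 \<and> dim W \<noteq> 2 \<longrightarrow> \<Phi> = canonical_iso U W) \<and>
    l1 > 0 \<and> l2 > 0 \<and> l3 > 0 \<and> euclidean_scalar_product_on UNIV \<gamma> \<and>
    (\<forall>x\<in>model_space U W. \<forall>y\<in>model_space U W. B (\<Phi> x) (\<Phi> y) = model_form l1 \<gamma> l2 l3 x y)"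
proof -
  interpret swap: lorentz_form W U R P B by (rule lorentz_form_swap)
  obtain L \<gamma> where L: "linear L" "L ` mixed_space U W = mixed_space U W" "inj_on L (mixed_space U W)"
    "\<And>h Z. h \<in> SOxSO U W \<Longrightarrow> Z \<in> mixed_space U W \<Longrightarrow> L (\<chi> i. Ad h (Z $ i)) = (\<chi> i. Ad h (L Z $ i))"
    and gen: "dim U \<noteq> 2 \<Longrightarrow> dim W \<noteq> 2 \<Longrightarrow> L = (\<lambda>Z. Z)"
    and \<gamma>: "euclidean_scalar_product_on UNIV (\<gamma> :: real^2 \<Rightarrow> real^2 \<Rightarrow> real)"
    and form: "\<And>Z Z'. Z \<in> mixed_space U W \<Longrightarrow> Z' \<in> mixed_space U W \<Longrightarrow>
      B (mix_sum (L Z)) (mix_sum (L Z')) =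
        (\<Sum>i\<in>UNIV. \<Sum>j\<in>UNIV. (Z $ i \<bullet> Z' $ j) * \<gamma> (axis i 1) (axis j 1))"
    by (rule mixed_normalization[OF n]) (rule that)
  obtain k where k: "k > 0" "\<And>X Y. X \<in> S20 U \<Longrightarrow> Y \<in> S20 U \<Longrightarrow> B X Y = k * (X \<bullet> Y)"
    by (rule S20_positive) (rule that)
  obtain l where l: "l > 0" "\<And>X Y. X \<in> S20 W \<Longrightarrow> Y \<in> S20 W \<Longrightarrow> B X Y = l * (X \<bullet> Y)"
    by (rule swap.S20_positive) (rule that)
  define \<Phi> where "\<Phi> = (\<lambda>(t, Z, S, T). canonical_iso U W (t, L Z, S, T))"
  have iso: "module_iso U W \<Phi>" "adapted_iso U W \<Phi>"
    unfolding \<Phi>_def using module_iso_twisted[OF L] by auto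
  have "\<Phi> = canonical_iso U W" if "dim U \<noteq> 2" "dim W \<noteq> 2"
    using gen[OF that] by (auto simp: \<Phi>_def fun_eq_iff)
  moreover have "B (\<Phi> x) (\<Phi> y) = model_form (- B (b_endo U W) (b_endo U W)) \<gamma> k l x y"
    if x: "x \<in> model_space U W" and y: "y \<in> model_space U W" for x y
  proof -
    obtain t Z S T where xx: "x = (t, Z, S, T)" by (metis prod.exhaust)
    obtain t' Z' S' T' where yy: "y = (t', Z', S', T')" by (metis prod.exhaust)
    have x': "Z \<in> mixed_space U W" "S \<in> S20 U" "T \<in> S20 W" using x by (auto simp: xx mixed_space_model)
    have y': "Z' \<in> mixed_space U W" "S' \<in> S20 U" "T' \<in> S20 W" using y by (auto simp: yy mixed_space_model)
    have "L Z \<in> mixed_space U W" "L Z' \<in> mixed_space U W" using L(2) x'(1) y'(1) by blast+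
    then have "(t, L Z, S, T) \<in> model_space U W" "(t', L Z', S', T') \<in> model_space U W"
      using x' y' by (simp_all add: mixed_space_model)
    from block_form[OF n this] show ?thesis
      by (simp add: \<Phi>_def xx yy model_form_def form[OF x'(1) y'(1)] k(2)[OF x'(2) y'(2)] l(2)[OF x'(3) y'(3)]
          mult.commute)
  qed
  moreover have "- B (b_endo U W) (b_endo U W) > 0" using b_negative[OF n] by simp
  ultimately show ?thesis using iso k(1) l(1) \<gamma> by blast
qed

end

section \<open>Two lines\<close>

context orth_split
begin

text \<open>The only other isometry of the line \<open>U\<close> is a reflection.\<close>
lemma SO_one_dimensional:
  assumes "dim U = 1" and h: "h \<in> SO U"
  shows "h = mat 1"
proof -
  obtain e where e: "e \<in> U" "norm e = 1" by (rule unit_vector) (rule that)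
  have ee: "e \<bullet> e = 1" using e(2) by (simp add: norm_eq_1)
  obtain k where k: "h *v e = k *\<^sub>R e"
    using one_dimensional_collinear[OF subspace_U assms(1) e SO_U_vec(1)[OF h e(1)]] by blast
  have P: "P *v x = (e \<bullet> x) *\<^sub>R e" for x
    using one_dimensional_collinear[OF subspace_U assms(1) e P_in_U[of x]] inner_P[of e x] e(1) by (simp add: U_iff)
  have "h *v x = (mat 1 + (k - 1) *\<^sub>R tensor e e) *v x" for x
  proof -
    have "h *v x = h *v (P *v x) + h *v (R *v x)"
      by (simp only: vec_split flip: matrix_vector_right_distrib)
    also have "\<dots> = k *\<^sub>R (P *v x) + R *v x"
      using SO_U_vec(2)[OF h R_in_W] by (simp add: P matrix_vector_mult_scaleR k)
    also have "R *v x = x - P *v x" using vec_split[of x] by (simp add: eq_diff_eq add.commute)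
    finally show ?thesis
      by (simp add: P matrix_vector_mult_add_rdistrib scaleR_matrix_vector_assoc[symmetric] tensor_mult_vec algebra_simps)
  qed
  then have h': "h = mat 1 + (k - 1) *\<^sub>R tensor e e" by (simp only: matrix_eq) simp
  have det_h: "det h = 1" using h by (simp add: SO_def rotation_matrix_def)
  have "(h *v e) \<bullet> (h *v e) = e \<bullet> e"
    using trace_Ad[of h "tensor e e"] det_h by (simp add: Ad_tensor[OF SO_orthogonal[OF h]] trace_tensor)
  then have "k * k = 1" using ee by (simp add: k)
  then have "k = 1 \<or> k = - 1" by (simp add: square_eq_1_iff)
  moreover have "k \<noteq> - 1"
  proof
    assume "k = - 1"
    define i :: 'n where "i = undefined"
    obtain A where A: "orthogonal_matrix A" "A *v axis i 1 = e"
      using orthogonal_matrix_exists_basis[OF e(2)] by metis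
    have tA: "transpose A ** A = mat 1" using A(1) by (simp add: orthogonal_matrix_def)
    have "transpose A *v e = axis i 1"
      unfolding A(2)[symmetric] matrix_vector_mul_assoc tA by simp
    then have conj: "transpose A ** h ** A = mat 1 - 2 *\<^sub>R tensor (axis i 1) (axis i 1)" (is "_ = ?D")
      unfolding h' \<open>k = - 1\<close>
      by (simp add: matrix_ring tA matrix_mul_tensor tensor_mul_matrix del: transpose_matrix_vector)
    have "det ?D = (\<Prod>j\<in>UNIV. ?D $ j $ j)"
      by (rule det_diagonal) (auto simp: mat_def tensor_def axis_def)
    also have "\<dots> = (\<Prod>j\<in>UNIV. if j = i then - 1 else 1)"
      by (intro prod.cong refl) (simp add: mat_def tensor_def axis_def)
    also have "\<dots> = (- 1 :: real)" by simp
    finally have "det (transpose A) * det h * det A = - 1" by (simp only: det_mul flip: conj)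
    moreover have "det (transpose A) * det A = 1" using tA by (metis det_I det_mul)
    ultimately show False using det_h by simp
  qed
  ultimately have "k = 1" by blast
  then show ?thesis using h' by simp
qed

end

context lorentz_form
begin

text \<open>If both dimensions are 1, then the group is trivial, and any orthogonal splitting of the
  three-dimensional space \<open>\<mm>\<close> into a negative line and a positive plane will do.\<close>
lemma normal_form_two_dimensional:
  assumes n: "dim U = 1" "dim W = 1"
  shows "\<exists>\<Phi> l1 \<gamma> l2 l3. module_iso U W \<Phi> \<and>
    l1 > 0 \<and> l2 > 0 \<and> l3 > 0 \<and> euclidean_scalar_product_on UNIV \<gamma> \<and>
    (\<forall>x\<in>model_space U W. \<forall>y\<in>model_space U W. B (\<Phi> x) (\<Phi> y) = model_form l1 \<gamma> l2 l3 x y)"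
proof -
  interpret swap: lorentz_form W U R P B by (rule lorentz_form_swap)
  let ?E = "mixed_space U W" and ?M = "model_space U W" and ?m = "m_space U W" and ?c = "canonical_iso U W"
  have m: "subspace ?m"
    unfolding canonical_onto[symmetric] using linear_canonical_iso subspace_model_space by (rule linear_subspace_image)
  have S0: "S = 0" if "S \<in> S20 U" for S by (rule S20_one_dimensional[OF n(1) that])
  have T0: "T = 0" if "T \<in> S20 W" for T by (rule swap.S20_one_dimensional[OF n(2) that])
  have z0: "0 \<in> S20 U" "0 \<in> S20 W"
    by (simp_all add: S20_def tensor_space_def transpose_zero trace_zero span_0)
  have H: "h = mat 1" if h: "h \<in> SOxSO U W" for h
  proof -
    obtain a c where ac: "h = a ** c" "a \<in> SO U" "c \<in> SO W" using h by (auto simp: SOxSO_def)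
    then show ?thesis
      using SO_one_dimensional[OF n(1) ac(2)] swap.SO_one_dimensional[OF n(2) ac(3)] by simp
  qed
  obtain X where X: "B X X < 0" using negative by blast
  obtain z where z: "z \<in> ?M" "\<And>Y. B Y X = B Y (?c z)" by (rule B_reduce[of X]) (rule that)
  define v where "v = ?c z"
  have v: "v \<in> ?m" "B v v < 0"
    using X z(1) canonical_onto z(2)[of X] z(2)[of v] sym[of X v] by (auto simp: v_def)
  define N where "N = {x \<in> ?m. B x v = 0}"
  have N: "subspace N"
    using m by (auto simp: N_def subspace_def bilinear_lzero[OF bil] bilinear_ladd[OF bil] bilinear_lmul[OF bil])
  have split: "\<exists>c. y - c *\<^sub>R v \<in> N" if "y \<in> ?m" for y
  proof
    show "y - (B y v / B v v) *\<^sub>R v \<in> N"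
      using that v m by (simp add: N_def subspace_diff subspace_scale bilinear_lsub[OF bil] bilinear_lmul[OF bil])
  qed
  have pos: "B x x > 0" if x: "x \<in> N" "x \<noteq> 0" for x
  proof (rule ccontr)
    assume "\<not> B x x > 0"
    moreover have nonneg: "B y y \<ge> 0" if "y \<in> N" for y
      using no_two[OF _ v(2), of y] that by (force simp: N_def not_le)
    ultimately have 0: "B x x = 0" using x(1) by (meson antisym_conv not_le)
    have rad: "B x y = 0" if "y \<in> N" for y
      by (rule isotropic_imp_radical[OF bil sym N nonneg x(1) 0 that])
    have "x \<in> ?c ` ?M" using x(1) unfolding canonical_onto by (simp add: N_def)
    then obtain z' where z': "z' \<in> ?M" "x = ?c z'" by blast
    have "z' = 0"
    proof (rule model_radical[OF z'(1)])
      fix y assume "y \<in> ?M"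
      then have "?c y \<in> ?m" using canonical_onto by blast
      then obtain c where c: "?c y - c *\<^sub>R v \<in> N" using split by blast
      have "B x (?c y) = B x (?c y - c *\<^sub>R v) + c * B x v"
        by (simp add: bilinear_rsub[OF bil] bilinear_rmul[OF bil])
      then show "B (?c z') (?c y) = 0" using rad[OF c] x(1) by (simp add: z'(2)[symmetric] N_def)
    qed
    then show False using x(2) z'(2) by (simp add: linear_0[OF linear_canonical_iso])
  qed
  \<comment> \<open>Both are hyperplanes, in \<open>\<mm>\<close> and in the isomorphic model space.\<close>
  have "dim N = dim ?E"
  proof -
    have "span (insert v N) = ?m"
    proof
      show "span (insert v N) \<subseteq> ?m" using v(1) m by (intro span_minimal) (auto simp: N_def)
      show "?m \<subseteq> span (insert v N)"
      proof
        fix y assume "y \<in> ?m"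
        then obtain c where "y - c *\<^sub>R v \<in> N" using split by blast
        then show "y \<in> span (insert v N)" unfolding span_breakdown_eq using span_base by blast
      qed
    qed
    then have "dim ?m = dim (insert v N)" by (metis dim_span)
    also have "\<dots> = dim N + 1"
    proof -
      have "v \<notin> span N" using N v(2) by (simp add: span_eq_iff[THEN iffD2] N_def)
      then show ?thesis by (simp add: dim_insert)
    qed
    finally have 1: "dim ?m = dim N + 1" .
    have "inj_on ?c (span ?M)" using inj_canonical subspace_model_space by (simp only: span_eq_iff[THEN iffD2])
    then have 2: "dim ?m = dim ?M" using dim_image_eq[OF linear_canonical_iso] canonical_onto by metis
    define \<iota> :: "(real^'n^'n)^2 \<Rightarrow> 'n model" where "\<iota> Z = (0, Z, 0, 0)" for Z
    define o1 :: "'n model" where "o1 = (1, 0, 0, 0)"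
    have \<iota>: "linear \<iota>" "inj_on \<iota> (span ?E)" by (auto intro!: linearI inj_onI simp: \<iota>_def)
    have F: "subspace (\<iota> ` ?E)" using \<iota>(1) subspace_mixed_space by (rule linear_subspace_image)
    have "span (insert o1 (\<iota> ` ?E)) = ?M"
    proof
      have "insert o1 (\<iota> ` ?E) \<subseteq> ?M"
        using z0 subspace_0[OF subspace_mixed_space] by (auto simp: o1_def \<iota>_def mixed_space_model)
      then show "span (insert o1 (\<iota> ` ?E)) \<subseteq> ?M" using subspace_model_space by (rule span_minimal)
      show "?M \<subseteq> span (insert o1 (\<iota> ` ?E))"
      proof clarify
        fix t S T and Z :: "(real^'n^'n)^2" assume "(t, Z, S, T) \<in> ?M"
        then have "Z \<in> ?E" "S = 0" "T = 0" using S0 T0 by (auto simp: mixed_space_model)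
        moreover from this have "(t, Z, S, T) - t *\<^sub>R o1 = \<iota> Z" by (simp add: o1_def \<iota>_def zero_prod_def)
        ultimately have "(t, Z, S, T) - t *\<^sub>R o1 \<in> \<iota> ` ?E" by simp
        then show "(t, Z, S, T) \<in> span (insert o1 (\<iota> ` ?E))" unfolding span_breakdown_eq using span_base by blast
      qed
    qed
    then have "dim ?M = dim (insert o1 (\<iota> ` ?E))" by (metis dim_span)
    also have "\<dots> = dim (\<iota> ` ?E) + 1"
    proof -
      have "o1 \<notin> span (\<iota> ` ?E)" using F by (auto simp: span_eq_iff[THEN iffD2] o1_def \<iota>_def)
      then show ?thesis by (simp add: dim_insert)
    qed
    also have "dim (\<iota> ` ?E) = dim ?E" by (rule dim_image_eq[OF \<iota>])
    finally show ?thesis using 1 2 by simp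
  qed
  then obtain f where f: "linear f" "f ` ?E = N" "\<And>x. x \<in> ?E \<Longrightarrow> norm (f x) = norm x"
    using isometry_subspaces[OF subspace_mixed_space N] by metis
  have fN: "f x \<in> N" if "x \<in> ?E" for x using f(2) that by blast
  have bf: "bilinear (\<lambda>x y. B (f x) (f y))"
    unfolding bilinear_def using linear_compose[OF f(1) linear_B] linear_compose[OF f(1) linear_B']
    by (simp add: o_def)
  have pf: "B (f x) (f x) > 0" if "x \<in> ?E" "x \<noteq> 0" for x
    using pos[OF fN[OF that(1)]] f(3)[OF that(1)] that(2) by (metis norm_eq_zero)
  have "\<exists>L. linear L \<and> (\<forall>x\<in>?E. L x \<in> ?E) \<and> (\<forall>h\<in>{}. \<forall>x\<in>?E. L (h x) = h (L x)) \<and>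
    (\<forall>x\<in>?E. \<forall>y\<in>?E. B (f (L x)) (f (L y)) = x \<bullet> y)"
    by (rule equivariant_normalization[OF bf sym subspace_mixed_space pf]) simp_all
  then obtain L where L: "linear L" "\<And>x. x \<in> ?E \<Longrightarrow> L x \<in> ?E"
    "\<And>x y. x \<in> ?E \<Longrightarrow> y \<in> ?E \<Longrightarrow> B (f (L x)) (f (L y)) = x \<bullet> y" by blast
  define \<Phi> :: "'n model \<Rightarrow> real^'n^'n" where "\<Phi> = (\<lambda>(t, Z, S, T). t *\<^sub>R v + f (L Z))"
  have lin: "linear \<Phi>"
    by (rule linearI) (auto simp: \<Phi>_def linear_add[OF L(1)] linear_scale[OF L(1)] linear_add[OF f(1)]
        linear_scale[OF f(1)] algebra_simps)
  have form: "B (\<Phi> x) (\<Phi> y) = model_form (- B v v) (\<lambda>c d. c \<bullet> d) 1 1 x y" if x: "x \<in> ?M" and y: "y \<in> ?M" for x y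
  proof -
    obtain t Z S T where xx: "x = (t, Z, S, T)" by (metis prod.exhaust)
    obtain t' Z' S' T' where yy: "y = (t', Z', S', T')" by (metis prod.exhaust)
    have x': "Z \<in> ?E" "S = 0" "T = 0" using x S0 T0 by (auto simp: xx mixed_space_model)
    have y': "Z' \<in> ?E" "S' = 0" "T' = 0" using y S0 T0 by (auto simp: yy mixed_space_model)
    have "B (f (L Z)) v = 0" "B v (f (L Z')) = 0"
      using fN[OF L(2)[OF x'(1)]] fN[OF L(2)[OF y'(1)]] sym[of v "f (L Z')"] by (simp_all add: N_def)
    then have "B (\<Phi> x) (\<Phi> y) = t * t' * B v v + Z \<bullet> Z'"
      by (simp add: \<Phi>_def xx yy bilinear_ladd[OF bil] bilinear_radd[OF bil] bilinear_lmul[OF bil]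
          bilinear_rmul[OF bil] L(3)[OF x'(1) y'(1)])
    then show ?thesis
      by (simp add: xx yy x' y' model_form_def sum_2 inner_axis_axis inner_pair_matrices)
  qed
  have into: "\<Phi> x \<in> ?m" if x: "x \<in> ?M" for x
  proof -
    obtain t Z S T where xx: "x = (t, Z, S, T)" by (metis prod.exhaust)
    have "Z \<in> ?E" using x by (simp add: xx mixed_space_model)
    then have "f (L Z) \<in> ?m" using fN[OF L(2)] by (simp add: N_def)
    then show ?thesis using v(1) m by (simp add: xx \<Phi>_def subspace_add subspace_scale)
  qed
  have kernel: "x = 0" if x: "x \<in> ?M" and 0: "\<Phi> x = 0" for x
  proof -
    obtain t Z S T where xx: "x = (t, Z, S, T)" by (metis prod.exhaust)
    have x': "Z \<in> ?E" "S = 0" "T = 0" using x S0 T0 by (auto simp: xx mixed_space_model)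
    have fv: "B (f (L Z)) v = 0" using fN[OF L(2)[OF x'(1)]] by (simp add: N_def)
    have "B (\<Phi> x) v = 0" by (simp add: 0 bilinear_lzero[OF bil])
    then have "t * B v v = 0" by (simp add: xx \<Phi>_def bilinear_ladd[OF bil] bilinear_lmul[OF bil] fv)
    then have t: "t = 0" using v(2) by simp
    then have "f (L Z) = 0" using 0 by (simp add: xx \<Phi>_def)
    then have "Z \<bullet> Z = 0" using L(3)[OF x'(1) x'(1)] by (simp add: bilinear_lzero[OF bil])
    then show ?thesis by (simp add: xx x' t zero_prod_def)
  qed
  have inj: "inj_on \<Phi> ?M"
  proof (rule inj_onI)
    fix x y assume xy: "x \<in> ?M" "y \<in> ?M" "\<Phi> x = \<Phi> y"
    have "x - y \<in> ?M" using xy subspace_model_space by (simp add: subspace_diff)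
    then have "x - y = 0" by (rule kernel) (simp add: linear_diff[OF lin] xy)
    then show "x = y" by simp
  qed
  have "\<Phi> ` ?M = ?m"
  proof (rule subspace_dim_equal[OF linear_subspace_image[OF lin subspace_model_space] m])
    show "\<Phi> ` ?M \<subseteq> ?m" using into by blast
    have M: "span ?M = ?M" using subspace_model_space by (simp only: span_eq_iff)
    have "dim (\<Phi> ` ?M) = dim ?M" by (rule dim_image_eq[OF lin]) (simp only: M inj)
    moreover have "dim (?c ` ?M) = dim ?M" by (rule dim_image_eq[OF linear_canonical_iso]) (simp only: M inj_canonical)
    ultimately show "dim ?m \<le> dim (\<Phi> ` ?M)" by (simp add: canonical_onto)
  qed
  then have "bij_betw \<Phi> ?M ?m" using inj by (simp add: bij_betw_def)
  moreover have "\<Phi> (model_action h x) = Ad h (\<Phi> x)" if "h \<in> SOxSO U W" for h x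
    unfolding H[OF that] by (cases x) (simp add: model_action_def Ad_mat_1 vec_lambda_eta)
  ultimately have iso: "module_iso U W \<Phi>" using lin by (simp add: module_iso_def)
  have "euclidean_scalar_product_on UNIV (\<lambda>c d :: real^2. c \<bullet> d)"
    by (rule euclidean_scalar_product_inner)
  moreover have "- B v v > 0" using v(2) by simp
  ultimately show ?thesis using iso form
    by (intro exI[of _ \<Phi>] exI[of _ "- B v v"] exI[of _ "\<lambda>c d :: real^2. c \<bullet> d"] exI[of _ "1::real"]) simp
qed

end

section \<open>From an orthogonal decomposition to its projections\<close>

lemma orth_split_exists:
  fixes U W :: "(real^'n) set"
  assumes dec: "orthogonal_decomposition U W" and n: "dim U + dim W = CARD('n)"
    and pos: "dim U \<ge> 1" "dim W \<ge> 1"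
  obtains P R where "orth_split U W P R"
proof -
  have U: "subspace U" and W: "subspace W" and orth: "\<And>u w. u \<in> U \<Longrightarrow> w \<in> W \<Longrightarrow> u \<bullet> w = 0"
    and UW: "{u + w | u w. u \<in> U \<and> w \<in> W} = UNIV"
    using dec unfolding orthogonal_decomposition_def orthogonal_def by auto
  have sum: "\<exists>u w. u \<in> U \<and> w \<in> W \<and> x = u + w" for x
  proof -
    have "x \<in> {u + w | u w. u \<in> U \<and> w \<in> W}" unfolding UW by (rule UNIV_I)
    then show ?thesis by blast
  qed
  obtain B where B: "B \<subseteq> U" "pairwise orthogonal B" "\<And>x. x \<in> B \<Longrightarrow> norm x = 1"
    "independent B" "card B = dim U" "span B = U"
    by (rule orthonormal_basis_subspace[OF U]) blast
  have fin: "finite B" using B(4) by (rule independent_imp_finite)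
  define P where "P = (\<Sum>b\<in>B. tensor b b)"
  have lin: "linear (\<lambda>A::real^'n^'n. A *v x)" for x
    by (rule linearI) (simp_all add: matrix_vector_mult_add_rdistrib scaleR_matrix_vector_assoc)
  have Pv: "P *v x = (\<Sum>b\<in>B. (b \<bullet> x) *\<^sub>R b)" for x
    by (simp add: P_def linear_sum[OF lin] tensor_mult_vec)
  have PU: "P *v x \<in> U" for x
    unfolding Pv using B(1) U by (intro subspace_sum) (auto intro: subspace_scale)
  have Pb: "P *v b = b" if b: "b \<in> B" for b
  proof -
    have "P *v b = (\<Sum>c\<in>B. if c = b then b else 0)"
      unfolding Pv using b B(2,3) by (intro sum.cong refl) (auto simp: pairwise_def orthogonal_def norm_eq_1)
    then show ?thesis using b fin by simp
  qed
  have PUx: "P *v u = u" if "u \<in> U" for u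
  proof -
    have "u \<in> span B" using that B(6) by simp
    then show ?thesis using linear_eq_on_span[of "\<lambda>x. P *v x" "\<lambda>x. x" B u] Pb by (simp add: linear_id[unfolded id_def])
  qed
  have PW: "P *v w = 0" if "w \<in> W" for w
    unfolding Pv using orth[OF _ that] B(1) by (intro sum.neutral) auto
  define R where "R = mat 1 - P"
  have Rv: "R *v x = x - P *v x" for x by (simp add: R_def matrix_vector_mult_diff_rdistrib)
  have trP: "trace P = real (dim U)"
  proof -
    have "linear (trace :: real^'n^'n \<Rightarrow> real)" by (rule linearI) (simp_all add: trace_ring)
    then have "trace P = (\<Sum>b\<in>B. b \<bullet> b)" by (simp add: P_def linear_sum trace_tensor)
    also have "\<dots> = (\<Sum>b\<in>B. 1)" using B(3) by (intro sum.cong refl) (simp add: norm_eq_1)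
    finally show ?thesis using B(5) by simp
  qed
  have Psym: "transpose P = P"
    unfolding P_def linear_sum[OF linear_transpose] by (simp add: transpose_tensor)
  have "orth_split U W P R"
  proof
    show "transpose P = P" "transpose R = R" "P + R = mat 1" by (simp_all add: R_def transpose_ring Psym)
    show "P ** P = P" using PUx[OF PU] by (simp add: matrix_eq flip: matrix_vector_mul_assoc)
    show "x \<in> U \<longleftrightarrow> P *v x = x" for x using PUx PU by metis
    show "x \<in> W \<longleftrightarrow> R *v x = x" for x
    proof
      show "R *v x = x" if "x \<in> W" using PW[OF that] by (simp add: Rv)
      assume "R *v x = x"
      then have P0: "P *v x = 0" by (simp add: Rv)
      obtain u w where uw: "u \<in> U" "w \<in> W" "x = u + w" using sum by blast
      have "P *v x = u" using PUx[OF uw(1)] PW[OF uw(2)] by (simp add: uw(3) matrix_vector_right_distrib)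
      then show "x \<in> W" using P0 uw by simp
    qed
    show "trace P = real (dim U)" by (rule trP)
    show "trace R = real (dim W)" using n trP by (simp add: R_def trace_ring trace_I flip: of_nat_add)
  qed (rule pos)+
  then show ?thesis by (rule that)
qed

text \<open>Trace-free projection extends the metric at the base point to a bilinear form on all matrices.\<close>
lemma (in orth_split) lorentz_form_of_metric:
  assumes metric: "lorentzian_metric SL sl (SOxSO U W) (so_plus_so U W) Q"
    and invariant: "invariant_metric SL sl (SOxSO U W) Q"
  obtains B where "lorentz_form U W P R B"
    "\<And>X Y. trace X = 0 \<Longrightarrow> trace Y = 0 \<Longrightarrow> B X Y = Q (SOxSO U W) X Y"
proof -
  let ?H = "SOxSO U W"
  define \<beta> where "\<beta> = Q ?H"
  have H: "coset ?H (mat 1) = ?H" by (simp add: coset_def)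
  have H_in: "?H \<in> coset_space SL ?H"
    unfolding coset_space_def by (rule image_eqI[of _ _ "mat 1"]) (simp_all add: H SL_def)
  have "isotropy_algebra (so_plus_so U W) ?H = so_plus_so U W"
    using isotropy_algebra_coset[of "mat 1"] by (simp add: H Ad_mat_1 image_def)
  then have lor: "symmetric_form_on sl \<beta>" "{x \<in> sl. \<forall>y\<in>sl. \<beta> x y = 0} = so_plus_so U W"
    "form_index sl \<beta> = 1"
    using metric H_in unfolding lorentzian_metric_def lorentzian_mod_def \<beta>_def by auto
  have \<beta>sym: "\<beta> X Y = \<beta> Y X" and \<beta>add: "\<beta> (X + Z) Y = \<beta> X Y + \<beta> Z Y" and \<beta>scale: "\<beta> (c *\<^sub>R X) Y = c * \<beta> X Y"
    if "X \<in> sl" "Y \<in> sl" "Z \<in> sl" for X Y Z c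
    using lor(1) that unfolding symmetric_form_on_def by blast+
  have \<beta>inv: "\<beta> (Ad h X) (Ad h Y) = \<beta> X Y" if h: "h \<in> ?H" and XY: "X \<in> sl" "Y \<in> sl" for h X Y
  proof -
    have "(\<lambda>y. h ** y) ` ?H = ?H"
    proof
      show "(\<lambda>y. h ** y) ` ?H \<subseteq> ?H" using H_mul[OF h] by blast
      show "?H \<subseteq> (\<lambda>y. h ** y) ` ?H"
      proof
        fix y assume "y \<in> ?H"
        then have "transpose h ** y \<in> ?H" using H_mul[OF H_transpose[OF h]] by blast
        moreover have "y = h ** (transpose h ** y)"
          using H_orthogonal[OF h] by (simp add: matrix_mul_assoc orthogonal_matrix_def)
        ultimately show "y \<in> (\<lambda>y. h ** y) ` ?H" by blast
      qed
    qed
    moreover have "h \<in> SL" using H_det[OF h] by (simp add: SL_def)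
    ultimately show ?thesis
      using invariant H_in XY unfolding invariant_metric_def \<beta>_def by metis
  qed
  define \<pi> where "\<pi> X = X - (trace X / real CARD('n)) *\<^sub>R (mat 1 :: real^'n^'n)" for X
  have \<pi>sl: "\<pi> X \<in> sl" for X by (simp add: \<pi>_def sl_def trace_ring trace_I)
  have \<pi>id: "\<pi> X = X" if "trace X = 0" for X using that by (simp add: \<pi>_def)
  have \<pi>1: "\<pi> (mat 1) = 0" by (simp add: \<pi>_def trace_I)
  have \<pi>add: "\<pi> (X + Y) = \<pi> X + \<pi> Y" and \<pi>scale: "\<pi> (c *\<^sub>R X) = c *\<^sub>R \<pi> X" for X Y c
    by (simp_all add: \<pi>_def trace_ring add_divide_distrib scaleR_add_left scaleR_diff_right)
  have \<pi>Ad: "\<pi> (Ad h X) = Ad h (\<pi> X)" if h: "h \<in> ?H" for h X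
  proof -
    have "Ad h (mat 1) = mat 1"
      using H_orthogonal[OF h] by (simp add: Ad_orthogonal orthogonal_matrix_def)
    then show ?thesis
      using H_Ad(6)[OF h] by (simp add: \<pi>_def linear_diff[OF linear_Ad] linear_scale[OF linear_Ad])
  qed
  have zero: "0 \<in> sl" by (simp add: sl_def trace_zero)
  define B where "B X Y = \<beta> (\<pi> X) (\<pi> Y)" for X Y
  have Bsym: "B X Y = B Y X" for X Y unfolding B_def by (rule \<beta>sym[OF \<pi>sl \<pi>sl \<pi>sl])
  have lin1: "linear (\<lambda>X. B X Y)" for Y
    by (rule linearI) (simp_all add: B_def \<pi>add \<pi>scale \<beta>add[OF \<pi>sl \<pi>sl \<pi>sl] \<beta>scale[OF \<pi>sl \<pi>sl \<pi>sl])
  have bil: "bilinear B" unfolding bilinear_def using lin1 Bsym by (metis (no_types, lifting) ext)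
  have agree: "B X Y = \<beta> X Y" if "trace X = 0" "trace Y = 0" for X Y using that by (simp add: B_def \<pi>id)
  have "lorentz_form U W P R B"
  proof
    show "bilinear B" by (rule bil)
    show "B X Y = B Y X" for X Y by (rule Bsym)
    show "B (Ad h X) (Ad h Y) = B X Y" if "h \<in> ?H" for h X Y
      using \<beta>inv[OF that \<pi>sl \<pi>sl] by (simp add: B_def \<pi>Ad[OF that])
    show "B X (mat 1) = 0" for X
      using \<beta>scale[OF zero \<pi>sl zero, of 0 X] \<beta>sym[OF zero \<pi>sl zero, of X] by (simp add: B_def \<pi>1)
    show "B Y X = 0" if "X \<in> so_plus_so U W" for X Y
    proof -
      have "\<beta> X (\<pi> Y) = 0" using that lor(2) \<pi>sl by blast
      then have "B X Y = 0" using trace_so_plus_so[OF that] by (simp add: B_def \<pi>id)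
      then show ?thesis using Bsym by simp
    qed
    show "X \<in> so_plus_so U W" if tr: "trace X = 0" and 0: "\<And>Y. B X Y = 0" for X
    proof -
      have "\<beta> X Y = 0" if "Y \<in> sl" for Y using 0[of Y] agree[OF tr, of Y] that by (simp add: sl_def)
      then show ?thesis using tr lor(2) by (auto simp: sl_def)
    qed
    obtain x where "x \<in> sl" "\<beta> x x < 0" using negative_vector_exists[OF subspace_sl lor(3)] by blast
    then show "\<exists>X. B X X < 0" using agree[of x x] by (intro exI[of _ x]) (simp add: sl_def)
    show "B X Y \<noteq> 0" if "B X X < 0" "B Y Y < 0" for X Y
      using no_two_negative_vectors[OF subspace_sl lor(1,3) \<pi>sl _ \<pi>sl] that by (auto simp: B_def)
  qed
  then show ?thesis
  proof (rule that)
    show "B X Y = Q ?H X Y" if "trace X = 0" "trace Y = 0" for X Y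
      using agree[OF that] by (simp add: \<beta>_def)
  qed
qed

theorem proposition11:
  fixes U W :: "(real^'n) set" and p q :: nat
  assumes "orthogonal_decomposition U W"
    and "dim U = p" and "dim W = q" and "p + q = CARD('n)"
    and "p \<ge> 1" and "q \<ge> 1"
  shows "admissible SL sl (SOxSO U W) (so_plus_so U W) \<and>
    (\<forall>Q. lorentzian_metric SL sl (SOxSO U W) (so_plus_so U W) Q \<and>
         invariant_metric SL sl (SOxSO U W) Q \<longrightarrow>
      (\<exists>\<Phi> l1 \<gamma> l2 l3.
         module_iso U W \<Phi> \<and>
         (CARD('n) \<ge> 3 \<longrightarrow> adapted_iso U W \<Phi>) \<and>
         (CARD('n) \<ge> 3 \<and> p \<noteq> 2 \<and> q \<noteq> 2 \<longrightarrow> \<Phi> = canonical_iso U W) \<and>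
         l1 > 0 \<and> l2 > 0 \<and> l3 > 0 \<and> euclidean_scalar_product_on UNIV \<gamma> \<and>
         (\<forall>x\<in>model_space U W. \<forall>y\<in>model_space U W.
            Q (SOxSO U W) (\<Phi> x) (\<Phi> y) = model_form l1 \<gamma> l2 l3 x y)))"
proof -
  obtain P R where "orth_split U W P R"
    using orth_split_exists[of U W] assms by auto
  then interpret orth_split U W P R .
  show ?thesis
  proof (intro conjI allI impI, rule admissible_split)
    fix Q assume Q: "lorentzian_metric SL sl (SOxSO U W) (so_plus_so U W) Q \<and> invariant_metric SL sl (SOxSO U W) Q"
    obtain B where "lorentz_form U W P R B"
      and B: "\<And>X Y. trace X = 0 \<Longrightarrow> trace Y = 0 \<Longrightarrow> B X Y = Q (SOxSO U W) X Y"
      by (rule lorentz_form_of_metric[OF conjunct1[OF Q] conjunct2[OF Q]]) (rule that)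
    then interpret lorentz_form U W P R B by blast
    have BQ: "Q (SOxSO U W) (\<Phi> x) (\<Phi> y) = B (\<Phi> x) (\<Phi> y)"
      if iso: "module_iso U W \<Phi>" and xy: "x \<in> model_space U W" "y \<in> model_space U W" for \<Phi> x y
    proof -
      have "\<Phi> ` model_space U W = canonical_iso U W ` model_space U W"
        using iso by (simp add: module_iso_def bij_betw_def canonical_onto)
      then have "trace (\<Phi> z) = 0" if "z \<in> model_space U W" for z
        using that trace_canonical by (metis imageE imageI)
      then show ?thesis using B xy by simp
    qed
    show "\<exists>\<Phi> l1 \<gamma> l2 l3.
         module_iso U W \<Phi> \<and>
         (CARD('n) \<ge> 3 \<longrightarrow> adapted_iso U W \<Phi>) \<and>
         (CARD('n) \<ge> 3 \<and> p \<noteq> 2 \<and> q \<noteq> 2 \<longrightarrow> \<Phi> = canonical_iso U W) \<and>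
         l1 > 0 \<and> l2 > 0 \<and> l3 > 0 \<and> euclidean_scalar_product_on UNIV \<gamma> \<and>
         (\<forall>x\<in>model_space U W. \<forall>y\<in>model_space U W.
            Q (SOxSO U W) (\<Phi> x) (\<Phi> y) = model_form l1 \<gamma> l2 l3 x y)"
    proof (cases "CARD('n) \<ge> 3")
      case True
      then have "dim U + dim W \<ge> 3" using assms by simp
      from normal_form[OF this] obtain \<Phi> l1 \<gamma> l2 l3 where \<Phi>: "module_iso U W \<Phi>" "adapted_iso U W \<Phi>"
        "dim U \<noteq> 2 \<and> dim W \<noteq> 2 \<longrightarrow> \<Phi> = canonical_iso U W"
        "l1 > 0" "l2 > 0" "l3 > 0" "euclidean_scalar_product_on UNIV \<gamma>"
        "\<forall>x\<in>model_space U W. \<forall>y\<in>model_space U W. B (\<Phi> x) (\<Phi> y) = model_form l1 \<gamma> l2 l3 x y" by blast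
      show ?thesis
        by (intro exI[of _ \<Phi>] exI[of _ l1] exI[of _ \<gamma>] exI[of _ l2] exI[of _ l3])
          (use \<Phi> BQ[OF \<Phi>(1)] assms(2,3) in simp)
    next
      case False
      then have "dim U = 1" "dim W = 1" using assms by linarith+
      from normal_form_two_dimensional[OF this] obtain \<Phi> l1 \<gamma> l2 l3 where \<Phi>: "module_iso U W \<Phi>"
        "l1 > 0" "l2 > 0" "l3 > 0" "euclidean_scalar_product_on UNIV \<gamma>"
        "\<forall>x\<in>model_space U W. \<forall>y\<in>model_space U W. B (\<Phi> x) (\<Phi> y) = model_form l1 \<gamma> l2 l3 x y" by blast
      show ?thesis
        by (intro exI[of _ \<Phi>] exI[of _ l1] exI[of _ \<gamma>] exI[of _ l2] exI[of _ l3])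
          (use \<Phi> BQ[OF \<Phi>(1)] False in simp)
    qed
  qed
qed

end
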